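(* Let $n\ge 2$ and let $\{M_t\}_{t\ge0}$ be a one-parameter family of smooth compact and strictly convex hypersurfaces in $\mathbf R^{n+1}$ flowing by mean curvature, with width $W(t)$ as defined in the context. Then it becomes extinct after time at most $$\frac{W(0)}{4\pi}.$$
   Context: Mean curvature flow: a one-parameter family of smooth hypersurfaces $\{M_t\}\subset\mathbf R^{n+1}$ flows by mean curvature if $z_t=\mathbf H(z)=\Delta_{M_t}z$, where $z$ are the coordinates on $\mathbf R^{n+1}$ and $\mathbf H$ is the mean curvature vector. A smooth compact strictly convex hypersurface remains smooth, compact and strictly convex under the flow until it disappears in a point (extinction). Each $M_t$ is diffeomorphic to $\mathbf S^n$ by the Gauss map, and the flow gives diffeomorphisms $F_t:M_0\to M_t$. Width: $\mathbf S^1=\mathbf R/2\pi\mathbf Z$, and the energy of a curve $\sigma:\mathbf S^1\to M_t\subset\mathbf R^{n+1}$ is $\mathrm{Energy}(\sigma)=\int_{\mathbf S^1}|\sigma'|^2$. Let $\mathcal P=\overline{B^{n-1}}$ be the closed unit ball in $\mathbf R^{n-1}$. For $M=M_t$, let $\Omega^{\mathcal P}$ be the set of continuous maps $\sigma:\mathbf S^1\times\mathcal P\to M$ such that for each $s\in\mathcal P$ the curve $\sigma(\cdot,s)$ is in $W^{1,2}$, the map $s\mapsto\sigma(\cdot,s)$ is continuous from $\mathcal P$ to $W^{1,2}$, and $\sigma(\cdot,s)$ is a constant (point) curve for each $s\in\partial\mathcal P$. For $\hat\sigma\in\Omega^{\mathcal P}$, let $\Omega^{\mathcal P}_{\hat\sigma}$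 be the set of $\sigma\in\Omega^{\mathcal P}$ homotopic to $\hat\sigma$ through maps in $\Omega^{\mathcal P}$, and set $$W(\hat\sigma,M)=\inf_{\sigma\in\Omega^{\mathcal P}_{\hat\sigma}}\max_{s\in\mathcal P}\mathrm{Energy}(\sigma(\cdot,s)).$$ The sphere $\mathbf S^n=\{(x,y)\in\mathbf R^2\times\mathbf R^{n-1}:|x|^2+|y|^2=1\}$ is equivalent to $\mathbf S^1\times\overline{B^{n-1}}$ with $\mathbf S^1\times\{y\}$ collapsed to a point for each $y\in\partial B^{n-1}$, so each element of $\Omega^{\mathcal P}$ induces a map $\mathbf S^n\to M$. Fix a homotopy class $\beta$ in $\Omega^{\mathcal P}$ whose induced class in $\pi_n(M_t)$ is non-trivial (the classes for different $t$ being identified by means of the flow diffeomorphisms $F_t$). Then $W(t)=W(\beta,M_t)$, which is positive for each $t$ until extinction. *)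

theory Defs
  imports "HOL-Analysis.Analysis"
begin

text \<open>In finite dimension, a map is of class C^(k+1) on an open set iff it is differentiable there
  and each of its directional derivatives is of class C^k.\<close>

primrec C_k_on ::
    "nat \<Rightarrow> ('a::euclidean_space \<Rightarrow> 'b::real_normed_vector) \<Rightarrow> 'a set \<Rightarrow> bool" where
  "C_k_on 0 f U \<longleftrightarrow> continuous_on U f"
| "C_k_on (Suc k) f U \<longleftrightarrow>
     (\<forall>x\<in>U. f differentiable (at x)) \<and> (\<forall>v. C_k_on k (\<lambda>x. frechet_derivative f (at x) v) U)"

text \<open>On a set that need not be open, a map is smooth if it extends smoothly near every point.\<close>

definition smooth_on :: "'a::euclidean_space set \<Rightarrow> ('a \<Rightarrow> 'b::real_normed_vector) \<Rightarrow> bool" where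
  "smooth_on S f \<longleftrightarrow>
     (\<forall>p\<in>S. \<exists>U g. open U \<and> p \<in> U \<and> (\<forall>k. C_k_on k g U) \<and> (\<forall>x\<in>S \<inter> U. g x = f x))"

definition diffeomorphism_betw ::
    "('a::euclidean_space \<Rightarrow> 'b::euclidean_space) \<Rightarrow> 'a set \<Rightarrow> 'b set \<Rightarrow> bool" where
  "diffeomorphism_betw f A B \<longleftrightarrow>
     bij_betw f A B \<and> smooth_on A f \<and> smooth_on B (inv_into A f)"

definition smooth_hypersurface :: "'a::euclidean_space set \<Rightarrow> bool" where
  "smooth_hypersurface M \<longleftrightarrow>
     (\<forall>p\<in>M. \<exists>U (f :: 'a \<Rightarrow> real). open U \<and> p \<in> U \<and> smooth_on U f \<and>
        M \<inter> U = {x\<in>U. f x = 0} \<and> (\<forall>x\<in>U. \<exists>v. frechet_derivative f (at x) v \<noteq> 0))"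

definition tangent_space :: "'a::euclidean_space set \<Rightarrow> 'a \<Rightarrow> 'a set" where
  "tangent_space M p =
     {v. \<exists>\<gamma> e. e > 0 \<and> \<gamma> 0 = p \<and> (\<forall>t\<in>{-e<..<e}. \<gamma> t \<in> M) \<and>
           (\<gamma> has_vector_derivative v) (at (0::real))}"

text \<open>Below, derivatives of maps defined on \<open>M\<close> are taken at \<open>p\<close> within \<open>M\<close>.  Such a derivative is
  a linear map on the ambient space that is unique only on the tangent space of \<open>M\<close> at \<open>p\<close>, and it
  is only ever applied to tangent vectors.\<close>

definition tangential_gradient ::
    "'a::euclidean_space set \<Rightarrow> ('a \<Rightarrow> real) \<Rightarrow> 'a \<Rightarrow> 'a" where
  "tangential_gradient M f p =
     (THE v. v \<in> tangent_space M p \<and>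
        (\<forall>w\<in>tangent_space M p. frechet_derivative f (at p within M) w = v \<bullet> w))"

definition orthonormal_basis_of :: "'a::euclidean_space set \<Rightarrow> 'a set \<Rightarrow> bool" where
  "orthonormal_basis_of V B \<longleftrightarrow> pairwise orthogonal B \<and> (\<forall>b\<in>B. norm b = 1) \<and> span B = V"

definition tangential_divergence ::
    "'a::euclidean_space set \<Rightarrow> ('a \<Rightarrow> 'a) \<Rightarrow> 'a \<Rightarrow> real" where
  "tangential_divergence M X p =
     (\<Sum>e \<in> (SOME B. orthonormal_basis_of (tangent_space M p) B).
        frechet_derivative X (at p within M) e \<bullet> e)"

definition laplace_beltrami ::
    "'a::euclidean_space set \<Rightarrow> ('a \<Rightarrow> real) \<Rightarrow> 'a \<Rightarrow> real" where
  "laplace_beltrami M f = tangential_divergence M (tangential_gradient M f)"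

definition mean_curvature_vector :: "'a::euclidean_space set \<Rightarrow> 'a \<Rightarrow> 'a" where
  "mean_curvature_vector M p = (\<Sum>b\<in>Basis. laplace_beltrami M (\<lambda>z. z \<bullet> b) p *\<^sub>R b)"

definition smooth_unit_normal :: "'a::euclidean_space set \<Rightarrow> ('a \<Rightarrow> 'a) \<Rightarrow> bool" where
  "smooth_unit_normal M \<nu> \<longleftrightarrow>
     smooth_on M \<nu> \<and> (\<forall>p\<in>M. norm (\<nu> p) = 1 \<and> (\<forall>v\<in>tangent_space M p. \<nu> p \<bullet> v = 0))"

text \<open>With this sign, the second fundamental form of a round sphere is positive for the outward
  normal.\<close>

definition second_fundamental_form ::
    "'a::euclidean_space set \<Rightarrow> ('a \<Rightarrow> 'a) \<Rightarrow> 'a \<Rightarrow> 'a \<Rightarrow> 'a \<Rightarrow> real" where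
  "second_fundamental_form M \<nu> p v w = frechet_derivative \<nu> (at p within M) v \<bullet> w"

text \<open>Strict convexity is meant in the differential-geometric sense: \<open>M\<close> bounds a convex body and
  all its principal curvatures are positive, so that its Gauss map is a diffeomorphism onto the
  sphere.\<close>

definition compact_strictly_convex_hypersurface :: "'a::euclidean_space set \<Rightarrow> bool" where
  "compact_strictly_convex_hypersurface M \<longleftrightarrow>
     smooth_hypersurface M \<and> compact M \<and>
     (\<exists>K. convex K \<and> compact K \<and> interior K \<noteq> {} \<and> M = frontier K) \<and>
     (\<exists>\<nu>. smooth_unit_normal M \<nu> \<and>
        (\<forall>p\<in>M. \<forall>v\<in>tangent_space M p. v \<noteq> 0 \<longrightarrow> second_fundamental_form M \<nu> p v v > 0))"

definition time_interval :: "ereal \<Rightarrow> real set" where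
  "time_interval T = {t. 0 \<le> t \<and> ereal t < T}"

text \<open>\<open>F t\<close> is the flow diffeomorphism from \<open>M 0\<close> to \<open>M t\<close>.\<close>

definition strictly_convex_mcf ::
    "(real \<Rightarrow> 'a::euclidean_space set) \<Rightarrow> (real \<Rightarrow> 'a \<Rightarrow> 'a) \<Rightarrow> ereal \<Rightarrow> bool" where
  "strictly_convex_mcf M F T \<longleftrightarrow>
     0 < T \<and>
     (\<forall>t\<in>time_interval T. compact_strictly_convex_hypersurface (M t)) \<and>
     (\<forall>z\<in>M 0. F 0 z = z) \<and>
     (\<forall>t\<in>time_interval T. diffeomorphism_betw (F t) (M 0) (M t)) \<and>
     smooth_on (time_interval T \<times> M 0) (\<lambda>(t, z). F t z) \<and>
     (\<forall>t\<in>time_interval T. \<forall>z\<in>M 0.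
        ((\<lambda>s. F s z) has_vector_derivative mean_curvature_vector (M t) (F t z))
          (at t within time_interval T))"

definition extinct_at :: "(real \<Rightarrow> 'a::euclidean_space set) \<Rightarrow> real \<Rightarrow> bool" where
  "extinct_at M \<tau> \<longleftrightarrow> (\<exists>p. \<forall>e>0. \<forall>\<^sub>F t in at_left \<tau>. M t \<subseteq> ball p e)"

text \<open>Curves on the circle R/2 pi Z are treated as 2 pi-periodic functions on the reals.\<close>

definition circle_L2 :: "(real \<Rightarrow> 'a::euclidean_space) \<Rightarrow> bool" where
  "circle_L2 g \<longleftrightarrow> g \<in> borel_measurable borel \<and>
     set_integrable lborel {0..2*pi} (\<lambda>\<theta>. (norm (g \<theta>))\<^sup>2)"

definition circle_test_function :: "(real \<Rightarrow> real) \<Rightarrow> bool" where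
  "circle_test_function \<phi> \<longleftrightarrow> smooth_on UNIV \<phi> \<and> (\<forall>\<theta>. \<phi> (\<theta> + 2*pi) = \<phi> \<theta>)"

definition is_weak_derivative ::
    "(real \<Rightarrow> 'a::euclidean_space) \<Rightarrow> (real \<Rightarrow> 'a) \<Rightarrow> bool" where
  "is_weak_derivative \<gamma> g \<longleftrightarrow> circle_L2 g \<and>
     (\<forall>\<phi>. circle_test_function \<phi> \<longrightarrow>
        (LINT \<theta>:{0..2*pi}|lborel. deriv \<phi> \<theta> *\<^sub>R \<gamma> \<theta>) =
          - (LINT \<theta>:{0..2*pi}|lborel. \<phi> \<theta> *\<^sub>R g \<theta>))"

definition W12 :: "(real \<Rightarrow> 'a::euclidean_space) \<Rightarrow> bool" where
  "W12 \<gamma> \<longleftrightarrow> circle_L2 \<gamma> \<and> (\<exists>g. is_weak_derivative \<gamma> g)"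

text \<open>Unique up to null sets within one period, and only used under integrals over that period.\<close>

definition weak_deriv :: "(real \<Rightarrow> 'a::euclidean_space) \<Rightarrow> real \<Rightarrow> 'a" where
  "weak_deriv \<gamma> = (SOME g. is_weak_derivative \<gamma> g)"

definition energy :: "(real \<Rightarrow> 'a::euclidean_space) \<Rightarrow> real" where
  "energy \<gamma> = (LINT \<theta>:{0..2*pi}|lborel. (norm (weak_deriv \<gamma> \<theta>))\<^sup>2)"

definition W12_norm :: "(real \<Rightarrow> 'a::euclidean_space) \<Rightarrow> real" where
  "W12_norm \<gamma> = sqrt ((LINT \<theta>:{0..2*pi}|lborel. (norm (\<gamma> \<theta>))\<^sup>2) + energy \<gamma>)"

text \<open>Maps on the product of the circle and the closed unit ball are functions on \<open>complex \<times> 'p\<close>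
  of which only the values on \<open>sphere 0 1 \<times> cball 0 1\<close> matter; the circle R/2 pi Z is identified
  with the unit circle by \<^const>\<open>cis\<close>.\<close>

definition slice :: "(complex \<times> 'p::euclidean_space \<Rightarrow> 'a::euclidean_space) \<Rightarrow> 'p \<Rightarrow> real \<Rightarrow> 'a" where
  "slice \<sigma> s = (\<lambda>\<theta>. \<sigma> (cis \<theta>, s))"

definition sweepouts ::
    "'a::euclidean_space set \<Rightarrow> (complex \<times> 'p::euclidean_space \<Rightarrow> 'a) set" where
  "sweepouts M = {\<sigma>.
     continuous_on (sphere 0 1 \<times> cball 0 1) \<sigma> \<and>
     \<sigma> ` (sphere 0 1 \<times> cball 0 1) \<subseteq> M \<and>
     (\<forall>s\<in>cball 0 1. W12 (slice \<sigma> s)) \<and>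
     (\<forall>s\<in>cball 0 1.
        ((\<lambda>s'. W12_norm (\<lambda>\<theta>. slice \<sigma> s' \<theta> - slice \<sigma> s \<theta>)) \<longlongrightarrow> 0) (at s within cball 0 1)) \<and>
     (\<forall>s\<in>sphere 0 1. \<exists>c. \<forall>z\<in>sphere 0 1. \<sigma> (z, s) = c)}"

definition sweepout_class ::
    "'a::euclidean_space set \<Rightarrow> (complex \<times> 'p::euclidean_space \<Rightarrow> 'a) \<Rightarrow>
      (complex \<times> 'p \<Rightarrow> 'a) set" where
  "sweepout_class M \<sigma>\<^sub>0 = {\<sigma>\<in>sweepouts M.
     homotopic_with_canon (\<lambda>\<rho>. \<rho> \<in> sweepouts M) (sphere 0 1 \<times> cball 0 1) M \<sigma>\<^sub>0 \<sigma>}"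

text \<open>The supremum over the closed ball is a maximum, because the energy of the slices of a sweepout
  depends continuously on the parameter.\<close>

definition width ::
    "'a::euclidean_space set \<Rightarrow> (complex \<times> 'p::euclidean_space \<Rightarrow> 'a) \<Rightarrow> real" where
  "width M \<sigma>\<^sub>0 = (INF \<sigma>\<in>sweepout_class M \<sigma>\<^sub>0. SUP s\<in>cball 0 1. energy (slice \<sigma> s))"

text \<open>The map from \<open>sphere 0 1\<close> in \<open>complex \<times> 'p\<close> induced by a sweepout, via the quotient map
  that takes \<open>(z, y)\<close> to \<open>(sqrt (1 - |y|\<^sup>2) z, y)\<close>.\<close>

definition induced_map ::
    "(complex \<times> 'p::euclidean_space \<Rightarrow> 'a::euclidean_space) \<Rightarrow> complex \<times> 'p \<Rightarrow> 'a" where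
  "induced_map \<sigma> = (\<lambda>(x, y). \<sigma> (if x = 0 then 1 else sgn x, y))"

text \<open>Triviality of the class of the induced map in the homotopy group based at the image of
  \<open>(1, 0)\<close>: homotopy to a constant map relative to the base point.\<close>

definition trivial_induced_class ::
    "'a::euclidean_space set \<Rightarrow> (complex \<times> 'p::euclidean_space \<Rightarrow> 'a) \<Rightarrow> bool" where
  "trivial_induced_class M \<sigma> \<longleftrightarrow>
     (let q = induced_map \<sigma> (1, 0) in
        homotopic_with_canon (\<lambda>g. g (1, 0) = q) (sphere 0 1) M (induced_map \<sigma>) (\<lambda>_. q))"

text \<open>The width \<open>W(t)\<close> along a flow: the class of \<open>\<sigma>\<^sub>0\<close> in \<open>M 0\<close> is transported to \<open>M t\<close> by
  \<open>F t\<close>.\<close>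

definition flow_width ::
    "(real \<Rightarrow> 'a::euclidean_space set) \<Rightarrow> (real \<Rightarrow> 'a \<Rightarrow> 'a) \<Rightarrow>
      (complex \<times> 'p::euclidean_space \<Rightarrow> 'a) \<Rightarrow> real \<Rightarrow> real" where
  "flow_width M F \<sigma>\<^sub>0 t = width (M t) (F t \<circ> \<sigma>\<^sub>0)"

end

theory Submission
  imports Defs
begin

text \<open>
  A sweepout by curves of small energy can be contracted in the complement of a point that the flow
  has not yet reached; this is why a sweepout with a nontrivial class contains a curve of large
  energy.

  Let \<open>t\<close> be a time before extinction, let \<open>p\<close> be a point inside \<open>M t\<close>, and suppose that all
  curves of a sweepout of \<open>M 0\<close> have energy less than \<open>4 \<pi> t\<close>.  The curves are allowed to leave the
  hypersurface and are moved in the ambient space by the heat equation \<open>\<gamma>\<^sub>t = c \<gamma>''\<close>.  Where such a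
  curve first touches \<open>M s\<close> from outside, its inward normal speed is at most \<open>c |\<gamma>'|\<^sup>2\<close> times the
  normal curvature of \<open>M s\<close> in the direction of \<open>\<gamma>'\<close>.  The hypersurface itself moves inwards with
  speed the sum of all principal curvatures, which are positive.  If \<open>c |\<gamma>'|\<^sup>2 < 1\<close>, then the
  hypersurface is faster, so there is no first contact: the curves stay outside the convex bodies
  bounded by the \<open>M s\<close> (\<open>avoidance_principle\<close>), and hence away from \<open>p\<close>.

  Meanwhile the curves shrink.  A curve of length \<open>2 \<pi> l\<close> traversed at constant speed \<open>l\<close> has energy
  \<open>2 \<pi> l\<^sup>2\<close>.  By Wirtinger's inequality, running the heat equation with speed \<open>c\<close> for a time \<open>h\<close>
  multiplies the energy by at most \<open>exp (- 2 c h)\<close>, and it does not increase the Lipschitz constant,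
  so that \<open>c\<close> may be any number below \<open>1 / l\<^sup>2\<close>.  Reparametrizing the result to constant speed
  replaces \<open>l\<^sup>2\<close> by about \<open>l\<^sup>2 - 2 h\<close> (\<open>shortening_step\<close>).  Repeating this, the curves become
  arbitrarily short before the time \<open>l\<^sup>2 / 2\<close>, which for the original sweepout is its maximal energy
  divided by \<open>4 \<pi>\<close>, and thus less than \<open>t\<close>.  Short curves away from \<open>p\<close> can be contracted
  (\<open>bounded_energy_family_contractible\<close>), so the sweepout is homotopic to a constant in the
  complement of \<open>p\<close>.  The complement retracts onto \<open>M 0\<close>, so the sweepout has a trivial class in
  \<open>M 0\<close>.  Therefore the width is at least \<open>4 \<pi> t\<close> for all \<open>t\<close> before extinction
  (\<open>extinction_time_le_width\<close>).

  All constructions have to be continuous in the parameter of the sweepout.  For this reason the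
  curves are first replaced by trigonometric polynomials, by convolution with a positive kernel.
  Their coefficients are integrals that depend continuously on the parameter, the heat flow is
  explicit on them, and the weak derivative enters the argument only through its Fourier
  coefficients.
\<close>


section \<open>Smooth hypersurfaces as level sets\<close>

lemma smooth_on_imp_continuous_on:
  assumes "smooth_on S f" shows "continuous_on S f"
  unfolding continuous_on_eq_continuous_within
proof
  fix p assume p: "p \<in> S"
  from bspec[OF assms[unfolded smooth_on_def] p]
  obtain U g where U: "open U" "p \<in> U" "\<forall>k. C_k_on k g U" "\<forall>x\<in>S \<inter> U. g x = f x"
    by (elim exE conjE)
  have "continuous_on (S \<inter> U) g"
    using U(3)[rule_format, of 0] by (auto intro: continuous_on_subset)
  hence "continuous_on (S \<inter> U) f"
    using U(4) by (metis (no_types, lifting) continuous_on_cong)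
  hence "continuous (at p within S \<inter> U) f"
    using p U by (simp add: continuous_on_eq_continuous_within)
  moreover have "at p within S \<inter> U = at p within S"
    by (rule at_within_nhd[OF U(2,1)]) auto
  ultimately show "continuous (at p within S) f" by simp
qed

definition defining_function ::
  "'a::euclidean_space set \<Rightarrow> 'a set \<Rightarrow> ('a \<Rightarrow> real) \<Rightarrow> ('a \<Rightarrow> 'a) \<Rightarrow> bool" where
  "defining_function M V f G \<longleftrightarrow> open V \<and> M \<inter> V = {x\<in>V. f x = 0} \<and>
     (\<forall>x\<in>V. (f has_derivative (\<lambda>v. G x \<bullet> v)) (at x) \<and> G differentiable (at x) \<and> G x \<noteq> 0)"

text \<open>Comparing a curve with a hypersurface to second order requires a gradient that is itself
  differentiable.  It is assembled from the partial derivatives, which are differentiable for a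
  function of class C^2.\<close>

lemma smooth_on_gradient:
  fixes f :: "'a::euclidean_space \<Rightarrow> real"
  assumes "open U" "smooth_on U f" "p \<in> U"
  obtains V G where "open V" "p \<in> V" "V \<subseteq> U"
    "\<And>x. x \<in> V \<Longrightarrow> (f has_derivative (\<lambda>v. G x \<bullet> v)) (at x)"
    "\<And>x. x \<in> V \<Longrightarrow> G differentiable (at x)"
proof -
  from bspec[OF assms(2)[unfolded smooth_on_def] assms(3)]
  obtain U' g where U': "open U'" "p \<in> U'" "\<forall>k. C_k_on k g U'" "\<forall>x\<in>U \<inter> U'. g x = f x"
    by (elim exE conjE)
  define G where "G x = (\<Sum>b\<in>Basis. frechet_derivative g (at x) b *\<^sub>R b)" for x
  have C2: "C_k_on (Suc (Suc 0)) g U'" using U'(3) by blast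
  have dg: "(g has_derivative frechet_derivative g (at x)) (at x)" if "x \<in> U'" for x
    using C2 that by (auto simp: frechet_derivative_works[symmetric])
  have Gx: "frechet_derivative g (at x) v = G x \<bullet> v" if "x \<in> U'" for x v
  proof -
    interpret linear "frechet_derivative g (at x)"
      using dg[OF that] has_derivative_linear by blast
    have "frechet_derivative g (at x) v = frechet_derivative g (at x) (\<Sum>b\<in>Basis. (v \<bullet> b) *\<^sub>R b)"
      by (simp add: euclidean_representation)
    also have "\<dots> = G x \<bullet> v"
      by (simp add: sum scale G_def inner_sum_right inner_commute[of _ v] mult.commute)
    finally show ?thesis .
  qed
  show ?thesis
  proof
    show "open (U \<inter> U')" "p \<in> U \<inter> U'" "U \<inter> U' \<subseteq> U" using assms U' by auto
    show "(f has_derivative (\<lambda>v. G x \<bullet> v)) (at x)" if x: "x \<in> U \<inter> U'" for x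
    proof -
      have "(g has_derivative (\<lambda>v. G x \<bullet> v)) (at x)"
        using dg[of x] Gx[of x] x by (metis IntD2 ext)
      thus ?thesis
        by (rule has_derivative_transform_within_open[of _ _ _ _ "U \<inter> U'"])
           (use x assms(1) U'(1,4) in auto)
    qed
    show "G differentiable (at x)" if x: "x \<in> U \<inter> U'" for x
    proof -
      have "(\<lambda>x. frechet_derivative g (at x) v) differentiable (at x)" for v
        using C2 x by auto
      thus ?thesis unfolding G_def by (intro differentiable_sum differentiable_scaleR) auto
    qed
  qed
qed

lemma smooth_hypersurface_defining_function:
  assumes "smooth_hypersurface M" "p \<in> M"
  obtains V f G where "defining_function M V f G" "p \<in> V"
proof -
  obtain U f where U: "open U" "p \<in> U" "smooth_on U f" "M \<inter> U = {x\<in>U. f x = 0}"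
    "\<forall>x\<in>U. \<exists>v. frechet_derivative f (at x) v \<noteq> (0::real)"
    using assms unfolding smooth_hypersurface_def by blast
  obtain V G where V: "open V" "p \<in> V" "V \<subseteq> U"
    "\<And>x. x \<in> V \<Longrightarrow> (f has_derivative (\<lambda>v. G x \<bullet> v)) (at x)"
    "\<And>x. x \<in> V \<Longrightarrow> G differentiable (at x)"
    using smooth_on_gradient[OF U(1,3,2)] by metis
  have "G x \<noteq> 0" if "x \<in> V" for x
  proof
    assume "G x = 0"
    hence "frechet_derivative f (at x) v = 0" for v
      using fun_cong[OF frechet_derivative_at[OF V(4)[OF that]], of v] by simp
    thus False using U(5) V(3) that by blast
  qed
  hence "defining_function M V f G"
    unfolding defining_function_def using V U(4) by auto
  thus ?thesis using that V by blast
qed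

lemma inner_gradient_eq_0_of_curve:
  assumes "(f has_derivative (\<lambda>v. (g::'a::euclidean_space) \<bullet> v)) (at q)" "\<gamma> 0 = q"
    "(\<gamma> has_vector_derivative v) (at 0)" "\<forall>\<^sub>F t in nhds 0. f (\<gamma> t) = (0::real)"
  shows "g \<bullet> v = 0"
proof -
  have "(f has_derivative (\<lambda>v. g \<bullet> v)) (at (\<gamma> 0))" using assms by simp
  from vector_derivative_diff_chain_within[OF assms(3) has_derivative_at_withinI[OF this]]
  have "((f \<circ> \<gamma>) has_vector_derivative g \<bullet> v) (at 0)" by simp
  moreover have "((f \<circ> \<gamma>) has_vector_derivative 0) (at 0)"
  proof -
    obtain S where S: "open S" "0 \<in> S" "\<And>t. t \<in> S \<Longrightarrow> f (\<gamma> t) = 0"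
      using assms(4) unfolding eventually_nhds by blast
    have "((\<lambda>_. 0) has_vector_derivative 0) (at (0::real))" by simp
    thus ?thesis
      by (rule has_vector_derivative_transform_within_open[OF _ S(1,2)]) (use S in auto)
  qed
  ultimately show ?thesis by (metis vector_derivative_unique_at)
qed

text \<open>A derivative within \<open>M\<close> is arbitrary in normal directions, but along a curve in \<open>M\<close> the
  chain rule determines it on the velocity.  Hence the choice made by \<^const>\<open>frechet_derivative\<close>
  is invisible on tangent vectors.\<close>

lemma has_derivative_within_tangent_unique:
  fixes f :: "'a::euclidean_space \<Rightarrow> 'b::real_normed_vector"
  assumes "(f has_derivative D) (at q within M)" "(f has_derivative D') (at q within M)"
    "w \<in> tangent_space M q"
  shows "D w = D' w"
proof -
  obtain \<gamma> e where g: "e > 0" "\<gamma> 0 = q" "\<And>t. t \<in> {-e<..<e} \<Longrightarrow> \<gamma> t \<in> M"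
    "(\<gamma> has_vector_derivative w) (at (0::real))"
    using assms(3) unfolding tangent_space_def by blast
  have vw: "(\<gamma> has_vector_derivative w) (at 0 within {-e<..<e})"
    using g(4) by (rule has_vector_derivative_at_within)
  have *: "((f \<circ> \<gamma>) has_vector_derivative E w) (at 0)" if "(f has_derivative E) (at q within M)" for E
  proof -
    have "(f has_derivative E) (at (\<gamma> 0) within \<gamma> ` {-e<..<e})"
      unfolding g(2) by (rule has_derivative_subset[OF that]) (use g(3) in blast)
    moreover have "at 0 within {-e<..<e} = at 0"
      using g(1) by (intro at_within_open) auto
    ultimately show ?thesis using vector_derivative_diff_chain_within[OF vw] by metis
  qed
  show ?thesis by (rule vector_derivative_unique_at[OF *[OF assms(1)] *[OF assms(2)]])
qed

text \<open>If \<open>v\<close> is orthogonal to the gradient, then \<open>q + t v\<close> is within \<open>o(t)\<close> of \<open>M\<close>: moving it by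
  \<open>\<plusminus> \<eta> t\<close> along the gradient gives both signs of \<open>f\<close>, and the intermediate value theorem gives a
  zero of \<open>f\<close> in between.\<close>

lemma defining_function_near:
  fixes M :: "'a::euclidean_space set"
  assumes "defining_function M V f G" "q \<in> M" "q \<in> V" "G q \<bullet> v = 0" "\<eta> > 0"
  shows "\<exists>d>0. \<forall>t::real. \<bar>t\<bar> < d \<longrightarrow> (\<exists>x\<in>M. norm (x - (q + t *\<^sub>R v)) \<le> \<eta> * \<bar>t\<bar>)"
proof -
  let ?g = "G q"
  have g0: "norm ?g > 0" and V: "open V" and f0: "f q = 0"
    and df: "(f has_derivative (\<lambda>v. ?g \<bullet> v)) (at q)"
    and cont: "continuous_on V f"
    using assms unfolding defining_function_def
    by (auto intro!: continuous_at_imp_continuous_on has_derivative_continuous)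
  define \<mu> where "\<mu> = \<eta> / norm ?g"
  have mu: "\<mu> > 0" using assms(5) g0 by (simp add: \<mu>_def)
  define C where "C = norm v + \<mu> * norm ?g"
  have C: "C > 0" using mu g0 unfolding C_def by (smt (verit) mult_pos_pos norm_ge_zero)
  define e where "e = \<mu> * (norm ?g)\<^sup>2 / (2 * C)"
  have e: "e > 0" using mu g0 C by (simp add: e_def)
  obtain d1 where d1: "d1 > 0" "\<And>y. norm (y - q) < d1 \<Longrightarrow>
      norm (f y - f q - ?g \<bullet> (y - q)) \<le> e * norm (y - q)"
    using df e unfolding has_derivative_at_alt by metis
  obtain d2 where d2: "d2 > 0" "ball q d2 \<subseteq> V" using V assms(3) open_contains_ball by blast
  define d where "d = min d1 d2 / C"
  have d: "d > 0" using d1 d2 C by (simp add: d_def)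
  show ?thesis
  proof (intro exI conjI allI impI)
    show "d > 0" by fact
    fix t :: real assume t: "\<bar>t\<bar> < d"
    define c where "c r = q + t *\<^sub>R v + r *\<^sub>R ?g" for r
    define R where "R = \<mu> * \<bar>t\<bar>"
    have R: "R \<ge> 0" using mu by (simp add: R_def)
    have nc: "norm (c r - q) \<le> C * \<bar>t\<bar>" if "\<bar>r\<bar> \<le> R" for r
    proof -
      have "norm (c r - q) \<le> \<bar>t\<bar> * norm v + \<bar>r\<bar> * norm ?g"
        unfolding c_def by (smt (verit) add_diff_cancel_left' diff_add_eq norm_scaleR norm_triangle_ineq)
      also have "\<bar>r\<bar> * norm ?g \<le> R * norm ?g" using that by (simp add: mult_right_mono)
      finally show ?thesis unfolding C_def R_def by (simp add: algebra_simps)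
    qed
    have Ct: "C * \<bar>t\<bar> < min d1 d2" using t C unfolding d_def by (simp add: field_simps)
    have inV: "c r \<in> V" if "\<bar>r\<bar> \<le> R" for r
      using nc[OF that] Ct d2 by (auto simp: dist_norm norm_minus_commute subset_iff)
    have est: "\<bar>f (c r) - r * (norm ?g)\<^sup>2\<bar> \<le> R * (norm ?g)\<^sup>2 / 2" if "\<bar>r\<bar> \<le> R" for r
    proof -
      have i: "?g \<bullet> (c r - q) = r * (norm ?g)\<^sup>2"
        using assms(4) by (simp add: c_def inner_add_right power2_norm_eq_inner)
      have "\<bar>f (c r) - r * (norm ?g)\<^sup>2\<bar> \<le> e * norm (c r - q)"
        using d1(2)[of "c r"] nc[OF that] Ct f0 i by simp
      also have "\<dots> \<le> e * (C * \<bar>t\<bar>)" using nc[OF that] e by simp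
      also have "\<dots> = R * (norm ?g)\<^sup>2 / 2" using C by (simp add: e_def R_def)
      finally show ?thesis .
    qed
    have "\<exists>r\<ge>-R. r \<le> R \<and> f (c r) = 0"
    proof (rule IVT')
      have "R * (norm ?g)\<^sup>2 \<ge> 0" using R by simp
      moreover have "\<bar>f (c (-R)) + R * (norm ?g)\<^sup>2\<bar> \<le> R * (norm ?g)\<^sup>2 / 2"
        using est[of "-R"] R by simp
      moreover have "\<bar>f (c R) - R * (norm ?g)\<^sup>2\<bar> \<le> R * (norm ?g)\<^sup>2 / 2"
        using est[of R] R by simp
      ultimately show "f (c (-R)) \<le> 0" "0 \<le> f (c R)" by linarith+
      show "continuous_on {-R..R} (\<lambda>a. f (c a))"
        by (rule continuous_on_compose2[OF cont]) (auto simp: c_def intro!: continuous_intros inV[unfolded c_def])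
    qed (use R in auto)
    then obtain r where "- R \<le> r" "r \<le> R" and r0: "f (c r) = 0" by blast
    hence r: "\<bar>r\<bar> \<le> R" by simp
    have "c r \<in> M" using inV[OF r] r0 assms(1) unfolding defining_function_def by blast
    moreover have "norm (c r - (q + t *\<^sub>R v)) \<le> \<eta> * \<bar>t\<bar>"
      using r g0 unfolding c_def R_def \<mu>_def by (simp add: field_simps)
    ultimately show "\<exists>x\<in>M. norm (x - (q + t *\<^sub>R v)) \<le> \<eta> * \<bar>t\<bar>" by blast
  qed
qed

text \<open>A vector orthogonal to the gradient is the velocity of the curve that consists of the points of
  \<open>M\<close> nearest to \<open>q + t v\<close>, because these are \<open>o(t)\<close> away from \<open>q + t v\<close>.\<close>

lemma tangent_space_defining_function:
  fixes M :: "'a::euclidean_space set"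
  assumes "defining_function M V f G" "q \<in> M" "q \<in> V" "closed M"
  shows "tangent_space M q = {v. G q \<bullet> v = 0}"
proof (intro set_eqI iffI)
  fix v assume "v \<in> tangent_space M q"
  then obtain \<gamma> e where g: "e > 0" "\<gamma> 0 = q" "\<And>t. t \<in> {-e<..<e} \<Longrightarrow> \<gamma> t \<in> M"
    "(\<gamma> has_vector_derivative v) (at (0::real))"
    unfolding tangent_space_def by blast
  have V: "open V" and MV: "M \<inter> V = {x\<in>V. f x = 0}" using assms unfolding defining_function_def by auto
  have "isCont \<gamma> 0" using g(4) has_vector_derivative_continuous by blast
  hence "(\<gamma> \<longlongrightarrow> q) (nhds 0)" using g(2) by (simp add: continuous_at tendsto_nhds_iff)
  hence 1: "\<forall>\<^sub>F t in nhds 0. \<gamma> t \<in> V" using V assms(3) by (metis topological_tendstoD)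
  have 2: "\<forall>\<^sub>F t in nhds 0. t \<in> {-e<..<e}"
    using g(1) by (intro eventually_nhds_in_open) auto
  have "\<forall>\<^sub>F t in nhds 0. f (\<gamma> t) = 0" using 1 2 by eventually_elim (use g(3) MV in blast)
  with g assms show "v \<in> {v. G q \<bullet> v = 0}"
    using inner_gradient_eq_0_of_curve[of f "G q" q \<gamma> v] unfolding defining_function_def by blast
next
  fix v assume v: "v \<in> {v. G q \<bullet> v = 0}"
  define \<gamma> where "\<gamma> t = closest_point M (q + t *\<^sub>R v)" for t
  have "(\<gamma> has_vector_derivative v) (at 0)"
    unfolding has_vector_derivative_def has_derivative_at_alt
  proof (intro conjI allI impI)
    show "bounded_linear (\<lambda>x. x *\<^sub>R v)" by (rule bounded_linear_scaleR_left)
    fix e :: real assume "e > 0"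
    then obtain d where d: "d > 0"
      "\<forall>t::real. \<bar>t\<bar> < d \<longrightarrow> (\<exists>x\<in>M. norm (x - (q + t *\<^sub>R v)) \<le> e * \<bar>t\<bar>)"
      using defining_function_near[OF assms(1-3), of v e] v by blast
    have "norm (\<gamma> y - \<gamma> 0 - (y - 0) *\<^sub>R v) \<le> e * norm (y - 0)" if y: "norm (y - 0) < d" for y
    proof -
      obtain x where x: "x \<in> M" "norm (x - (q + y *\<^sub>R v)) \<le> e * \<bar>y\<bar>"
        using d(2)[rule_format, of y] y by auto
      have "dist (q + y *\<^sub>R v) (\<gamma> y) \<le> dist (q + y *\<^sub>R v) x"
        unfolding \<gamma>_def by (rule closest_point_le[OF assms(4) x(1)])
      hence "norm (\<gamma> y - (q + y *\<^sub>R v)) \<le> e * \<bar>y\<bar>" using x by (simp add: dist_norm norm_minus_commute)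
      moreover have "\<gamma> 0 = q" using assms(2) by (simp add: \<gamma>_def closest_point_self)
      ultimately show ?thesis by (simp add: algebra_simps)
    qed
    thus "\<exists>d>0. \<forall>y. norm (y - 0) < d \<longrightarrow> norm (\<gamma> y - \<gamma> 0 - (y - 0) *\<^sub>R v) \<le> e * norm (y - 0)"
      using d(1) by blast
  qed
  moreover have "\<gamma> 0 = q" using assms(2) by (simp add: \<gamma>_def closest_point_self)
  moreover have "\<gamma> t \<in> M" for t
    unfolding \<gamma>_def using assms(2,4) by (intro closest_point_in_set) auto
  ultimately show "v \<in> tangent_space M q" unfolding tangent_space_def
    by (intro CollectI exI[of _ \<gamma>] exI[of _ "1::real"] conjI ballI zero_less_one)
qed

section \<open>Mean curvature at a point of contact\<close>

lemma second_derivative_test_nonneg: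
  fixes h h' :: "real \<Rightarrow> real"
  assumes "e > 0" "\<And>s. \<bar>s\<bar> < e \<Longrightarrow> (h has_real_derivative h' s) (at s)"
    "(h' has_real_derivative l) (at 0)" "h 0 = 0" "\<And>s. \<bar>s\<bar> < e \<Longrightarrow> h s \<ge> 0"
  shows "h' 0 = 0" "l \<ge> 0"
proof -
  show h0: "h' 0 = 0"
    by (rule DERIV_local_min[OF assms(2) assms(1)]) (use assms in auto)
  show "l \<ge> 0"
  proof (rule ccontr)
    assume "\<not> l \<ge> 0"
    then obtain d where d: "d > 0" "\<And>s. 0 < s \<Longrightarrow> s < d \<Longrightarrow> h' s < 0"
      using DERIV_neg_dec_right[OF assms(3)] h0 by auto
    define s where "s = min d e / 2"
    have s: "0 < s" "s < d" "s < e" using d(1) assms(1) by (auto simp: s_def)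
    have "\<exists>z>0. z < s \<and> h s - h 0 = (s - 0) * h' z"
      by (rule MVT2) (use s assms(2) in auto)
    then obtain z where z: "z > 0" "z < s" "h s - h 0 = (s - 0) * h' z" by blast
    hence "h s < 0" using d(2)[of z] s assms(4) by (simp add: mult_pos_neg)
    thus False using assms(5)[of s] s by auto
  qed
qed

text \<open>The form is nonnegative at \<open>v\<^sub>f e - v\<^sub>e f\<close> for any two elements \<open>e\<close>, \<open>f\<close> of the basis.  Summing
  over all pairs, the diagonal terms add up to twice \<open>|v|\<^sup>2\<close> times the trace, and the mixed terms to
  twice the value at \<open>v\<close>.\<close>

lemma nonneg_form_le_trace:
  fixes D :: "'a::euclidean_space \<Rightarrow> 'a"
  assumes D: "linear D" and B: "pairwise orthogonal B" "\<And>b. b \<in> B \<Longrightarrow> norm b = 1"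
    and nonneg: "\<And>v. v \<in> span B \<Longrightarrow> D v \<bullet> v \<ge> 0" and v: "v \<in> span B"
  shows "D v \<bullet> v \<le> (norm v)\<^sup>2 * (\<Sum>e\<in>B. D e \<bullet> e)"
proof -
  interpret linear D by fact
  have "0 \<notin> B" using B(2) by force
  hence fin: "finite B" using pairwise_orthogonal_independent[OF B(1)] independent_imp_finite by blast
  define c where "c e = v \<bullet> e" for e
  have v_eq: "v = (\<Sum>e\<in>B. c e *\<^sub>R e)"
  proof -
    obtain r where r: "v = (\<Sum>e\<in>B. r e *\<^sub>R e)"
      using v span_finite[OF fin] by auto
    have "c e = r e" if "e \<in> B" for e
    proof -
      have "c e = (\<Sum>e'\<in>B. r e' * (e' \<bullet> e))"
        unfolding c_def by (subst r) (simp add: inner_sum_left)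
      also have "\<dots> = (\<Sum>e'\<in>B. if e' = e then r e else 0)"
        using B that by (intro sum.cong) (auto simp: pairwise_def orthogonal_def power2_norm_eq_inner[symmetric])
      also have "\<dots> = r e" using that fin by simp
      finally show ?thesis .
    qed
    thus ?thesis using r by simp
  qed
  have norm_v: "(norm v)\<^sup>2 = (\<Sum>e\<in>B. (c e)\<^sup>2)"
  proof -
    have "(norm v)\<^sup>2 = v \<bullet> (\<Sum>e\<in>B. c e *\<^sub>R e)" using v_eq power2_norm_eq_inner by metis
    thus ?thesis by (simp add: inner_sum_right c_def power2_eq_square)
  qed
  have Dv: "D v \<bullet> v = (\<Sum>e\<in>B. \<Sum>e'\<in>B. c e * c e' * (D e \<bullet> e'))"
  proof -
    have "D v \<bullet> v = D (\<Sum>e\<in>B. c e *\<^sub>R e) \<bullet> (\<Sum>e\<in>B. c e *\<^sub>R e)" using v_eq by simp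
    also have "\<dots> = (\<Sum>e\<in>B. \<Sum>e'\<in>B. c e' * c e * (D e' \<bullet> e))"
      by (simp add: sum scale inner_sum_left inner_sum_right sum_distrib_left mult_ac)
    also have "\<dots> = (\<Sum>e\<in>B. \<Sum>e'\<in>B. c e * c e' * (D e \<bullet> e'))" by (rule sum.swap)
    finally show ?thesis .
  qed
  \<comment> \<open>The form at the tangent vectors orthogonal to \<open>v\<close> within each coordinate plane.\<close>
  have "0 \<le> (\<Sum>e\<in>B. \<Sum>e'\<in>B. D (c e' *\<^sub>R e - c e *\<^sub>R e') \<bullet> (c e' *\<^sub>R e - c e *\<^sub>R e'))"
    by (intro sum_nonneg nonneg span_diff span_scale span_base)
  also have "\<dots> = (\<Sum>e\<in>B. \<Sum>e'\<in>B. (c e')\<^sup>2 * (D e \<bullet> e) + (c e)\<^sup>2 * (D e' \<bullet> e')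
      - c e * c e' * (D e \<bullet> e') - c e' * c e * (D e' \<bullet> e))"
    by (intro sum.cong refl)
      (simp add: diff scale inner_diff_left inner_diff_right power2_eq_square algebra_simps)
  also have "\<dots> = 2 * ((norm v)\<^sup>2 * (\<Sum>e\<in>B. D e \<bullet> e)) - 2 * (D v \<bullet> v)"
  proof -
    have 1: "(\<Sum>e\<in>B. \<Sum>e'\<in>B. (c e')\<^sup>2 * (D e \<bullet> e)) = (norm v)\<^sup>2 * (\<Sum>e\<in>B. D e \<bullet> e)"
      by (simp add: norm_v sum_distrib_right[symmetric] sum_distrib_left[symmetric])
    have 2: "(\<Sum>e\<in>B. \<Sum>e'\<in>B. (c e)\<^sup>2 * (D e' \<bullet> e')) = (norm v)\<^sup>2 * (\<Sum>e\<in>B. D e \<bullet> e)"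
      by (subst sum.swap) (rule 1)
    have 3: "(\<Sum>e\<in>B. \<Sum>e'\<in>B. c e' * c e * (D e' \<bullet> e)) = D v \<bullet> v"
      unfolding Dv by (subst sum.swap) simp
    show ?thesis using 1 2 3 Dv by (simp add: sum.distrib sum_subtractf)
  qed
  finally show ?thesis by simp
qed

lemma supporting_vector_exists:
  fixes K :: "'a::euclidean_space set"
  assumes "convex K" "interior K \<noteq> {}" "x \<notin> interior K"
  shows "\<exists>u. norm u = 1 \<and> (\<forall>q\<in>K. u \<bullet> q \<le> u \<bullet> x)"
proof -
  obtain a b where a: "a \<noteq> 0" "\<And>q. q \<in> interior K \<Longrightarrow> a \<bullet> q \<le> b" "b \<le> a \<bullet> x"
    using separating_hyperplane_sets[of "interior K" "{x}"] assms by (auto simp: convex_interior)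
  have "closure (interior K) \<subseteq> {q. a \<bullet> q \<le> b}"
    by (rule closure_minimal) (use a(2) closed_halfspace_le in auto)
  hence le: "a \<bullet> q \<le> a \<bullet> x" if "q \<in> K" for q
    using that a(3) convex_closure_interior[OF assms(1,2)] closure_subset[of K] by force
  have "norm (sgn a) = 1" using a(1) by (simp add: norm_sgn)
  moreover have "sgn a \<bullet> q \<le> sgn a \<bullet> x" if "q \<in> K" for q
    using mult_left_mono[OF le[OF that], of "inverse (norm a)"] by (simp add: sgn_div_norm)
  ultimately show ?thesis by blast
qed

definition supports :: "'a::euclidean_space \<Rightarrow> 'a \<Rightarrow> 'a set \<Rightarrow> bool" where
  "supports u x K \<longleftrightarrow> norm u = 1 \<and> (\<forall>q\<in>K. u \<bullet> q \<le> u \<bullet> x)"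

lemma unit_vectors_subsequence:
  fixes u :: "nat \<Rightarrow> 'a::euclidean_space"
  assumes "\<And>n. norm (u n) = 1"
  obtains v r where "strict_mono (r::nat \<Rightarrow> nat)" "(u \<circ> r) \<longlonglongrightarrow> v" "norm v = 1"
proof -
  have "compact (sphere (0::'a) 1)" "\<forall>n. u n \<in> sphere 0 1" using assms by auto
  thus ?thesis using that unfolding compact_def by (metis mem_sphere_0)
qed

text \<open>The data at a contact point: \<open>u\<close> is the outward unit normal of \<open>M\<close> at \<open>p\<close>, and the local
  defining function \<open>f\<close> increases in the outward direction.\<close>

locale convex_contact =
  fixes M :: "'a::euclidean_space set" and p u V f G
  assumes M: "compact_strictly_convex_hypersurface M" and pM: "p \<in> M"
    and df: "defining_function M V f G" and pV: "p \<in> V"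
    and supp: "supports u p M" and oriented: "G p = norm (G p) *\<^sub>R u"
begin

lemma closed_M: "closed M"
  using M compact_imp_closed unfolding compact_strictly_convex_hypersurface_def by auto

lemma norm_G_pos: "norm (G p) > 0" and f_p: "f p = 0" and open_V: "open V"
  and f_deriv: "x \<in> V \<Longrightarrow> (f has_derivative (\<lambda>v. G x \<bullet> v)) (at x)"
  and G_deriv: "x \<in> V \<Longrightarrow> G differentiable (at x)"
  using df pM pV unfolding defining_function_def by auto

lemma tangent_space_at: "q \<in> M \<Longrightarrow> q \<in> V \<Longrightarrow> tangent_space M q = {v. G q \<bullet> v = 0}"
  by (rule tangent_space_defining_function[OF df _ _ closed_M])

end

text \<open>By the Krein-Milman theorem, the convex body bounded by \<open>M\<close> is the convex hull of \<open>M\<close>.  This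
  gives a canonical name to the body in all that follows.\<close>

lemma hull_of_compact_strictly_convex_hypersurface:
  assumes "compact_strictly_convex_hypersurface M"
  shows "compact (convex hull M)" "interior (convex hull M) \<noteq> {}" "frontier (convex hull M) = M"
    "M \<noteq> {}"
proof -
  obtain K where K: "convex K" "compact K" "interior K \<noteq> {}" "M = frontier K"
    using assms unfolding compact_strictly_convex_hypersurface_def by blast
  have "K = convex hull M" using Krein_Milman_frontier[OF K(1,2)] K(4) by simp
  thus "compact (convex hull M)" "interior (convex hull M) \<noteq> {}" "frontier (convex hull M) = M"
    "M \<noteq> {}" using K by auto
qed

lemma supports_hull: "supports u p (convex hull M) \<longleftrightarrow> supports u p M"
proof -
  have "convex hull M \<subseteq> {q. u \<bullet> q \<le> u \<bullet> p}" if "\<forall>q\<in>M. u \<bullet> q \<le> u \<bullet> p"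
    by (rule hull_minimal) (use that convex_halfspace_le in auto)
  thus ?thesis unfolding supports_def using hull_subset[of M convex] by blast
qed

text \<open>Along a curve in \<open>M\<close> through \<open>p\<close>, the linear function \<open>u\<close> is maximal at \<open>p\<close>; so \<open>u\<close> is
  orthogonal to the tangent space.\<close>

lemma supports_eq_gradient:
  fixes M :: "'a::euclidean_space set"
  assumes "closed M" "p \<in> M" "defining_function M V f G" "p \<in> V" "supports u p M"
  shows "u = sgn (G p) \<or> u = - sgn (G p)"
proof -
  have g0: "G p \<noteq> 0" using assms unfolding defining_function_def by auto
  have orth: "u \<bullet> v = 0" if "G p \<bullet> v = 0" for v
  proof -
    have "v \<in> tangent_space M p"
      using tangent_space_defining_function[OF assms(3,2,4,1)] that by simp
    then obtain \<gamma> e where g: "e > 0" "\<gamma> 0 = p" "\<And>t. t \<in> {-e<..<e} \<Longrightarrow> \<gamma> t \<in> M"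
      "(\<gamma> has_vector_derivative v) (at (0::real))" unfolding tangent_space_def by blast
    have "((\<lambda>t. u \<bullet> \<gamma> t) has_real_derivative u \<bullet> v) (at 0)"
      unfolding has_real_derivative_iff_has_vector_derivative
      by (rule bounded_linear.has_vector_derivative[OF bounded_linear_inner_right g(4)])
    moreover have "\<forall>y. \<bar>0 - y\<bar> < e \<longrightarrow> u \<bullet> \<gamma> y \<le> u \<bullet> \<gamma> 0"
      using g(2,3) assms(5) unfolding supports_def by (auto simp: abs_less_iff)
    ultimately show ?thesis using g(1) DERIV_local_max by blast
  qed
  define w where "w = u - (u \<bullet> sgn (G p)) *\<^sub>R sgn (G p)"
  have n: "norm (sgn (G p)) = 1" using g0 by (simp add: norm_sgn)
  hence nn: "sgn (G p) \<bullet> sgn (G p) = 1" by (simp add: dot_square_norm)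
  have gs: "G p = norm (G p) *\<^sub>R sgn (G p)" using g0 by (simp add: sgn_div_norm)
  have "sgn (G p) \<bullet> w = 0" unfolding w_def using nn by (simp add: inner_diff_right inner_commute)
  hence "G p \<bullet> w = 0" by (subst gs) simp
  hence "u \<bullet> w = 0" by (rule orth)
  hence "w \<bullet> w = 0" using \<open>sgn (G p) \<bullet> w = 0\<close> unfolding w_def by (simp add: inner_diff_left)
  hence u: "u = (u \<bullet> sgn (G p)) *\<^sub>R sgn (G p)" unfolding w_def by simp
  hence "\<bar>u \<bullet> sgn (G p)\<bar> = 1" using assms(5) n unfolding supports_def by (metis mult.right_neutral norm_scaleR)
  thus ?thesis using u by (metis abs_eq_iff' abs_1 scaleR_minus1_left scaleR_one)
qed

lemma convex_contact_exists:
  assumes "compact_strictly_convex_hypersurface M" "p \<in> M" "supports u p M"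
  obtains V f G where "convex_contact M p u V f G"
proof -
  have sm: "smooth_hypersurface M" and cl: "closed M"
    using assms compact_imp_closed unfolding compact_strictly_convex_hypersurface_def by auto
  obtain V f G where d: "defining_function M V f G" "p \<in> V"
    using smooth_hypersurface_defining_function[OF sm assms(2)] .
  have n: "G p = norm (G p) *\<^sub>R sgn (G p)" by (cases "G p = 0") (simp_all add: sgn_div_norm)
  from supports_eq_gradient[OF cl assms(2) d assms(3)] show ?thesis
  proof
    assume "u = sgn (G p)"
    thus ?thesis using that[of V f G] n assms d unfolding convex_contact_def by simp
  next
    assume u: "u = - sgn (G p)"
    have "defining_function M V (\<lambda>x. - f x) (\<lambda>x. - G x)"
    proof -
      have hm: "((\<lambda>x. - f x) has_derivative (\<lambda>v. - G x \<bullet> v)) (at x)" if "x \<in> V" for x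
        using has_derivative_minus[of f "\<lambda>v. G x \<bullet> v"] d(1) that
        unfolding defining_function_def inner_minus_left by blast
      show ?thesis using d(1) unfolding defining_function_def by (auto intro: differentiable_minus hm)
    qed
    moreover have "- G p = norm (- G p) *\<^sub>R u" using n u by simp
    ultimately have "convex_contact M p u V (\<lambda>x. - f x) (\<lambda>x. - G x)"
      using assms d by (intro convex_contact.intro)
    thus ?thesis by (rule that)
  qed
qed

context convex_contact
begin

text \<open>Otherwise \<open>- u\<close> would be a supporting vector as well, and the convex body would lie in a
  hyperplane.\<close>

lemma unique_support:
  assumes "supports v p M" shows "v = u"
proof (rule ccontr)
  assume ne: "v \<noteq> u"
  have "sgn (G p) = u" using oriented norm_G_pos
    by (metis norm_eq_zero less_irrefl mult.commute scaleR_cancel_left sgn_div_norm scaleR_scaleR scaleR_one right_inverse)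
  hence v: "v = - u" using supports_eq_gradient[OF closed_M pM df pV assms] ne by auto
  have "supports u p (convex hull M)" "supports v p (convex hull M)"
    using supp assms supports_hull by auto
  hence sub: "convex hull M \<subseteq> {q. u \<bullet> q = u \<bullet> p}" unfolding v supports_def by (auto simp: order.antisym)
  have "u \<noteq> 0" using supp unfolding supports_def by auto
  hence "interior {q. u \<bullet> q = u \<bullet> p} = {}" by (rule interior_hyperplane)
  thus False using interior_mono[OF sub] hull_of_compact_strictly_convex_hypersurface(2)[OF M] by blast
qed

text \<open>Suppose that \<open>f\<close> is negative at a point \<open>x\<close> near \<open>p\<close> that is not inside the body.  A vector
  that separates \<open>x\<close> from the body is close to \<open>u\<close>, since a limit of such vectors supports \<open>M\<close> at
  \<open>p\<close>.  On the way from \<open>x\<close> in the direction of the gradient, \<open>f\<close> becomes positive, so this way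
  meets \<open>M\<close>; but it leads away from the body.\<close>

lemma f_nonneg_outside:
  "\<exists>d>0. \<forall>x. dist x p < d \<longrightarrow> x \<in> V \<and> (x \<notin> interior (convex hull M) \<longrightarrow> f x \<ge> 0)"
proof (rule ccontr)
  let ?K = "convex hull M"
  obtain d0 where d0: "d0 > 0" "ball p d0 \<subseteq> V" using open_V pV open_contains_ball by blast
  assume neg: "\<not> ?thesis"
  have "\<exists>x. dist x p < min d0 (1 / Suc n) \<and> x \<notin> interior ?K \<and> f x < 0" for n
  proof -
    have "\<not> (\<forall>x. dist x p < min d0 (1 / Suc n) \<longrightarrow> x \<in> V \<and> (x \<notin> interior (convex hull M) \<longrightarrow> f x \<ge> 0))"
      using neg d0(1) by (metis (no_types, lifting) divide_pos_pos min_less_iff_conj of_nat_0_less_iff zero_less_Suc zero_less_one)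
    thus ?thesis using d0(2) by (auto simp: dist_commute subset_iff not_le)
  qed
  then obtain x where x: "\<And>n. dist (x n) p < min d0 (1 / Suc n)" "\<And>n. x n \<notin> interior ?K" "\<And>n. f (x n) < 0"
    by metis
  have xlim: "x \<longlonglongrightarrow> p"
  proof (rule metric_LIMSEQ_I)
    fix e :: real assume "e > 0"
    then obtain N where "1 / Suc N < e" using nat_approx_posE by blast
    moreover have "1 / Suc n \<le> 1 / Suc N" if "n \<ge> N" for n using that by (simp add: frac_le)
    ultimately have "\<forall>n\<ge>N. dist (x n) p < e" using x(1)
      by (meson min_less_iff_conj order.strict_trans order.strict_trans1 less_le_trans)
    thus "\<exists>N. \<forall>n\<ge>N. dist (x n) p < e" by blast
  qed
  have "\<forall>n. \<exists>w. norm w = 1 \<and> (\<forall>q\<in>?K. w \<bullet> q \<le> w \<bullet> x n)"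
    using supporting_vector_exists[OF convex_convex_hull
        hull_of_compact_strictly_convex_hypersurface(2)[OF M] x(2)] by blast
  then obtain v where "\<forall>n. norm (v n) = 1 \<and> (\<forall>q\<in>?K. v n \<bullet> q \<le> v n \<bullet> x n)"
    using choice[of "\<lambda>n w. norm w = 1 \<and> (\<forall>q\<in>?K. w \<bullet> q \<le> w \<bullet> x n)"] by blast
  hence v: "\<And>n. norm (v n) = 1" "\<And>n q. q \<in> ?K \<Longrightarrow> v n \<bullet> q \<le> v n \<bullet> x n" by auto
  obtain w r where w: "strict_mono (r::nat\<Rightarrow>nat)" "(v \<circ> r) \<longlonglongrightarrow> w" "norm w = 1"
    using unit_vectors_subsequence[OF v(1)] .
  have xr: "(x \<circ> r) \<longlonglongrightarrow> p" using xlim w(1) by (rule LIMSEQ_subseq_LIMSEQ)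
  have "supports w p M" unfolding supports_def
  proof (intro conjI ballI w(3))
    fix q assume "q \<in> M"
    hence "q \<in> ?K" by (simp add: hull_inc)
    hence le: "(v \<circ> r) n \<bullet> q \<le> (v \<circ> r) n \<bullet> (x \<circ> r) n" for n using v(2) by simp
    have a: "(\<lambda>n. (v \<circ> r) n \<bullet> q) \<longlonglongrightarrow> w \<bullet> q" by (intro tendsto_intros w(2))
    have b: "(\<lambda>n. (v \<circ> r) n \<bullet> (x \<circ> r) n) \<longlonglongrightarrow> w \<bullet> p" by (intro tendsto_intros w(2) xr)
    show "w \<bullet> q \<le> w \<bullet> p" using tendsto_le[OF _ b a] le by simp
  qed
  hence wu: "w = u" by (rule unique_support)
  have "((\<lambda>n. (v \<circ> r) n \<bullet> G p) \<longlonglongrightarrow> u \<bullet> G p)" unfolding wu[symmetric] by (intro tendsto_intros w(2))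
  moreover have "u \<bullet> G p > 0"
  proof -
    have "u \<bullet> G p = norm (G p)" using oriented supp unfolding supports_def
      by (metis inner_scaleR_right mult.right_neutral norm_eq_1)
    thus ?thesis using norm_G_pos by simp
  qed
  ultimately have ev1: "\<forall>\<^sub>F n in sequentially. (v \<circ> r) n \<bullet> G p > 0"
    by (rule order_tendstoD)
  \<comment> \<open>a point of \<open>M\<close> above \<open>x n\<close> in the direction of the gradient\<close>
  have "((\<lambda>h. f (p + h *\<^sub>R G p)) has_real_derivative G p \<bullet> G p) (at 0)"
  proof -
    have "((\<lambda>h. p + h *\<^sub>R G p) has_vector_derivative G p) (at 0)"
      by (auto intro!: derivative_eq_intros)
    moreover have "(f has_derivative (\<lambda>v. G p \<bullet> v)) (at (p + 0 *\<^sub>R G p))" using f_deriv[OF pV] by simp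
    ultimately show ?thesis
      unfolding has_real_derivative_iff_has_vector_derivative
      using vector_derivative_diff_chain_within[of "\<lambda>h. p + h *\<^sub>R G p" "G p" 0 UNIV f "\<lambda>v. G p \<bullet> v"]
      by (simp add: o_def has_derivative_at_withinI)
  qed
  then obtain d1 where d1: "d1 > 0" "\<And>h. 0 < h \<Longrightarrow> h < d1 \<Longrightarrow> f (p + h *\<^sub>R G p) > 0"
    using DERIV_pos_inc_right[of "\<lambda>h. f (p + h *\<^sub>R G p)"] norm_G_pos f_p by force
  define h where "h = min (d1 / 2) (d0 / (2 * norm (G p)))"
  have h: "h > 0" "h < d1" "h * norm (G p) < d0"
  proof -
    show "h > 0" "h < d1" using d1 d0 norm_G_pos by (auto simp: h_def)
    have "h * norm (G p) \<le> d0 / (2 * norm (G p)) * norm (G p)"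
      by (rule mult_right_mono) (auto simp: h_def)
    also have "\<dots> < d0" using norm_G_pos d0(1) by simp
    finally show "h * norm (G p) < d0" .
  qed
  have in0: "p + h *\<^sub>R G p \<in> ball p d0" using h by (simp add: dist_norm)
  have contf: "continuous_on V f"
    by (intro continuous_at_imp_continuous_on ballI has_derivative_continuous[OF f_deriv])
  have xh: "(\<lambda>n. (x \<circ> r) n + h *\<^sub>R G p) \<longlonglongrightarrow> p + h *\<^sub>R G p" by (intro tendsto_intros xr)
  have "isCont f (p + h *\<^sub>R G p)" using contf open_V in0 d0(2) continuous_on_eq_continuous_at by blast
  hence "(\<lambda>n. f ((x \<circ> r) n + h *\<^sub>R G p)) \<longlonglongrightarrow> f (p + h *\<^sub>R G p)" using xh isCont_tendsto_compose by blast
  hence ev2: "\<forall>\<^sub>F n in sequentially. f ((x \<circ> r) n + h *\<^sub>R G p) > 0"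
    by (rule order_tendstoD) (use d1(2) h in auto)
  have ev3: "\<forall>\<^sub>F n in sequentially. (x \<circ> r) n + h *\<^sub>R G p \<in> ball p d0"
    by (rule topological_tendstoD[OF xh open_ball in0])
  obtain n where n: "(v \<circ> r) n \<bullet> G p > 0" "f ((x \<circ> r) n + h *\<^sub>R G p) > 0" "(x \<circ> r) n + h *\<^sub>R G p \<in> ball p d0"
    using eventually_happens'[OF _ eventually_conj[OF ev1 eventually_conj[OF ev2 ev3]]] by auto
  define y where "y = (x \<circ> r) n"
  have y0: "y \<in> ball p d0" "f y < 0" using x by (auto simp: y_def dist_commute)
  have seg: "y + a *\<^sub>R G p \<in> ball p d0" if "0 \<le> a" "a \<le> h" for a
  proof -
    have "y + a *\<^sub>R G p = (1 - a / h) *\<^sub>R y + (a / h) *\<^sub>R (y + h *\<^sub>R G p)"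
      using h(1) by (simp add: algebra_simps)
    also have "\<dots> \<in> ball p d0"
      by (rule convexD[OF convex_ball y0(1) n(3)[folded y_def]]) (use that h in auto)
    finally show ?thesis .
  qed
  have "\<exists>a\<ge>0. a \<le> h \<and> f (y + a *\<^sub>R G p) = 0"
  proof (rule IVT')
    show "continuous_on {0..h} (\<lambda>a. f (y + a *\<^sub>R G p))"
      by (rule continuous_on_compose2[OF contf]) (use seg d0(2) in \<open>auto intro!: continuous_intros\<close>)
  qed (use y0 n h in \<open>auto simp: y_def\<close>)
  then obtain a where a: "0 \<le> a" "a \<le> h" "f (y + a *\<^sub>R G p) = 0" by blast
  have "a \<noteq> 0" using a(3) y0(2) by auto
  have "y + a *\<^sub>R G p \<in> M" using seg[OF a(1,2)] d0(2) a(3) df unfolding defining_function_def by blast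
  hence "v (r n) \<bullet> (y + a *\<^sub>R G p) \<le> v (r n) \<bullet> y" using v(2) hull_inc by (fastforce simp: y_def)
  hence "a * (v (r n) \<bullet> G p) \<le> 0" by (simp add: inner_add_right)
  thus False using n(1) a(1) \<open>a \<noteq> 0\<close> by (simp add: mult_le_0_iff)
qed


abbreviation "hessian \<equiv> frechet_derivative G (at p)"

lemma hessian: "(G has_derivative hessian) (at p)" "linear hessian"
  using G_deriv[OF pV] frechet_derivative_works has_derivative_linear by blast+

text \<open>The function \<open>f\<close> is nonnegative along \<open>\<gamma>\<close> and vanishes at the contact point, so the second
  derivative test applies to \<open>f \<circ> \<gamma>\<close>.\<close>

lemma second_order_contact:
  assumes "e > 0" "\<gamma> 0 = p" "\<And>s. \<bar>s\<bar> < e \<Longrightarrow> (\<gamma> has_vector_derivative \<gamma>' s) (at s)"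
    "(\<gamma>' has_vector_derivative a) (at 0)"
    "\<And>s. \<bar>s\<bar> < e \<Longrightarrow> \<gamma> s \<notin> interior (convex hull M)"
  shows "G p \<bullet> \<gamma>' 0 = 0" "hessian (\<gamma>' 0) \<bullet> \<gamma>' 0 + G p \<bullet> a \<ge> 0"
proof -
  obtain d where d: "d > 0" "\<And>x. dist x p < d \<Longrightarrow> x \<in> V"
    "\<And>x. dist x p < d \<Longrightarrow> x \<notin> interior (convex hull M) \<Longrightarrow> f x \<ge> 0"
    using f_nonneg_outside by blast
  have "isCont \<gamma> 0" using assms(1,3) has_vector_derivative_continuous by force
  then obtain e1 where e1: "e1 > 0" "\<And>s. \<bar>s\<bar> < e1 \<Longrightarrow> dist (\<gamma> s) p < d"
    using d(1) unfolding continuous_at_eps_delta assms(2) by force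
  define e2 where "e2 = min e e1"
  have e2: "e2 > 0" using assms(1) e1(1) by (simp add: e2_def)
  have "((\<lambda>s. f (\<gamma> s)) has_real_derivative G (\<gamma> s) \<bullet> \<gamma>' s) (at s)" if "\<bar>s\<bar> < e2" for s
  proof -
    have s: "\<bar>s\<bar> < e" "\<gamma> s \<in> V" using that e1(2) d(2) by (auto simp: e2_def)
    show ?thesis unfolding has_real_derivative_iff_has_vector_derivative
      using vector_derivative_diff_chain_within[OF assms(3)[OF s(1)] has_derivative_at_withinI[OF f_deriv[OF s(2)]]]
      by (simp add: o_def)
  qed
  moreover have "((\<lambda>s. G (\<gamma> s) \<bullet> \<gamma>' s) has_real_derivative G (\<gamma> 0) \<bullet> a + hessian (\<gamma>' 0) \<bullet> \<gamma>' 0) (at 0)"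
  proof -
    have "(G has_derivative hessian) (at (\<gamma> 0))" using hessian assms(2) by simp
    from vector_derivative_diff_chain_within[OF assms(3)[of 0] has_derivative_at_withinI[OF this]]
    have "((\<lambda>s. G (\<gamma> s)) has_vector_derivative hessian (\<gamma>' 0)) (at 0)" using assms(1) by (simp add: o_def)
    from bounded_bilinear.has_vector_derivative[OF bounded_bilinear_inner this assms(4)]
    show ?thesis unfolding has_real_derivative_iff_has_vector_derivative .
  qed
  moreover have "f (\<gamma> 0) = 0" using assms(2) f_p by simp
  moreover have "f (\<gamma> s) \<ge> 0" if "\<bar>s\<bar> < e2" for s
    using that e1(2) d(3) assms(5) by (auto simp: e2_def)
  ultimately have "G (\<gamma> 0) \<bullet> \<gamma>' 0 = 0" "G (\<gamma> 0) \<bullet> a + hessian (\<gamma>' 0) \<bullet> \<gamma>' 0 \<ge> 0"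
    using second_derivative_test_nonneg[OF e2, of "\<lambda>s. f (\<gamma> s)" "\<lambda>s. G (\<gamma> s) \<bullet> \<gamma>' s"] by blast+
  thus "G p \<bullet> \<gamma>' 0 = 0" "hessian (\<gamma>' 0) \<bullet> \<gamma>' 0 + G p \<bullet> a \<ge> 0" using assms(2) by auto
qed

lemma norm_u: "norm u = 1" using supp unfolding supports_def by simp

text \<open>A line in a tangent direction lies in the supporting hyperplane and hence does not enter the
  interior of the body.\<close>

lemma hessian_nonneg:
  assumes "G p \<bullet> v = 0" shows "hessian v \<bullet> v \<ge> 0"
proof -
  have uv: "u \<bullet> v = 0" using assms norm_G_pos by (subst (asm) oriented) simp
  have "p + s *\<^sub>R v \<notin> interior (convex hull M)" for s
  proof
    assume "p + s *\<^sub>R v \<in> interior (convex hull M)"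
    then obtain r where r: "r > 0" "cball (p + s *\<^sub>R v) r \<subseteq> convex hull M"
      using mem_interior_cball by blast
    have "p + s *\<^sub>R v + r *\<^sub>R u \<in> cball (p + s *\<^sub>R v) r" using norm_u r(1) by (simp add: dist_norm)
    hence "p + s *\<^sub>R v + r *\<^sub>R u \<in> convex hull M" using r(2) by blast
    hence "u \<bullet> (p + s *\<^sub>R v + r *\<^sub>R u) \<le> u \<bullet> p" using supp supports_hull unfolding supports_def by blast
    thus False using r(1) uv norm_u by (simp add: inner_add_right dot_square_norm)
  qed
  moreover have "((\<lambda>s. p + s *\<^sub>R v) has_vector_derivative v) (at s)" for s
    by (auto intro!: derivative_eq_intros)
  ultimately show ?thesis
    using second_order_contact(2)[of 1 "\<lambda>s. p + s *\<^sub>R v" "\<lambda>_. v" 0] by simp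
qed

definition unit_normal where "unit_normal x = inverse (norm (G x)) *\<^sub>R G x"

text \<open>On tangent vectors, the derivative of the unit normal is the Hessian of \<open>f\<close> divided by the length
  of the gradient; the second summand is normal to \<open>M\<close>.\<close>

lemma unit_normal_derivative:
  obtains \<iota> where "(unit_normal has_derivative (\<lambda>v. inverse (norm (G p)) *\<^sub>R hessian v + \<iota> v *\<^sub>R G p)) (at p)"
proof -
  have "(\<lambda>x. inverse (norm (G x))) differentiable (at p)"
  proof -
    have "norm differentiable (at (G p))" using norm_G_pos by (intro differentiable_norm_at) auto
    from differentiable_chain_at[OF G_deriv[OF pV] this]
    have "(\<lambda>x. norm (G x)) differentiable (at p)" by (simp add: o_def)
    thus ?thesis using norm_G_pos by (intro differentiable_inverse) auto
  qed
  then obtain \<iota> where "((\<lambda>x. inverse (norm (G x))) has_derivative \<iota>) (at p)" unfolding differentiable_def by blast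
  from has_derivative_scaleR[OF this hessian(1)] show ?thesis using that unfolding unit_normal_def by blast
qed

lemma tangential_gradient_coordinate:
  assumes "q \<in> M" "q \<in> V"
  shows "tangential_gradient M (\<lambda>z. z \<bullet> b) q = b - (b \<bullet> unit_normal q) *\<^sub>R unit_normal q"
proof -
  have Gq: "G q \<noteq> 0" using df assms(2) unfolding defining_function_def by auto
  hence nn: "unit_normal q \<bullet> unit_normal q = 1" unfolding unit_normal_def by (simp add: power2_norm_eq_inner[symmetric] power2_eq_square)
  have T: "w \<in> tangent_space M q \<longleftrightarrow> unit_normal q \<bullet> w = 0" for w
    using tangent_space_at[OF assms] Gq by (auto simp: unit_normal_def)
  have fd: "frechet_derivative (\<lambda>z. z \<bullet> b) (at q within M) w = b \<bullet> w" if "w \<in> tangent_space M q" for w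
  proof -
    have hd: "((\<lambda>z. z \<bullet> b) has_derivative (\<lambda>w. w \<bullet> b)) (at q within M)"
      by (intro derivative_eq_intros refl) auto
    hence "((\<lambda>z. z \<bullet> b) has_derivative frechet_derivative (\<lambda>z. z \<bullet> b) (at q within M)) (at q within M)"
      using frechet_derivative_works differentiable_def by blast
    from has_derivative_within_tangent_unique[OF this hd that] show ?thesis by (simp add: inner_commute)
  qed
  let ?v = "b - (b \<bullet> unit_normal q) *\<^sub>R unit_normal q"
  have v: "?v \<in> tangent_space M q" unfolding T using nn by (simp add: inner_diff_right inner_commute)
  have vw: "?v \<bullet> w = b \<bullet> w" if "w \<in> tangent_space M q" for w
    using that unfolding T by (simp add: inner_diff_left)
  show ?thesis unfolding tangential_gradient_def
  proof (rule the_equality)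
    show "?v \<in> tangent_space M q \<and>
      (\<forall>w\<in>tangent_space M q. frechet_derivative (\<lambda>z. z \<bullet> b) (at q within M) w = ?v \<bullet> w)"
      using v vw fd by auto
    fix v' assume v': "v' \<in> tangent_space M q \<and>
      (\<forall>w\<in>tangent_space M q. frechet_derivative (\<lambda>z. z \<bullet> b) (at q within M) w = v' \<bullet> w)"
    hence *: "(v' - ?v) \<bullet> w = 0" if "w \<in> tangent_space M q" for w
      using that fd vw by (simp add: inner_diff_left)
    have "v' - ?v \<in> tangent_space M q" using v v' unfolding T by (simp add: inner_diff_right)
    hence "(v' - ?v) \<bullet> (v' - ?v) = 0" by (rule *)
    thus "v' = ?v" by simp
  qed
qed

text \<open>The orthonormal basis that is chosen in the definition of the tangential divergence.\<close>

definition "frame = (SOME frame. orthonormal_basis_of (tangent_space M p) frame)"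

lemma frame: "pairwise orthogonal frame" "\<And>b. b \<in> frame \<Longrightarrow> norm b = 1" "span frame = {v. G p \<bullet> v = 0}" "finite frame"
proof -
  have "subspace {v. G p \<bullet> v = 0}" by (rule subspace_hyperplane)
  then obtain B' where "pairwise orthogonal B'" "\<And>x. x \<in> B' \<Longrightarrow> norm x = 1" "span B' = {v. G p \<bullet> v = 0}"
    using orthonormal_basis_subspace by metis
  hence "orthonormal_basis_of (tangent_space M p) B'"
    unfolding orthonormal_basis_of_def tangent_space_at[OF pM pV] by auto
  hence "orthonormal_basis_of (tangent_space M p) frame" unfolding frame_def by (rule someI)
  thus b: "pairwise orthogonal frame" "\<And>b. b \<in> frame \<Longrightarrow> norm b = 1" "span frame = {v. G p \<bullet> v = 0}"
    unfolding orthonormal_basis_of_def tangent_space_at[OF pM pV] by auto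
  have "0 \<notin> frame" using b(2) by force
  thus "finite frame" using pairwise_orthogonal_independent[OF b(1)] independent_imp_finite by blast
qed

lemma unit_normal_p: "unit_normal p = u"
  unfolding unit_normal_def using norm_G_pos by (subst (2) oriented) simp

text \<open>The gradient of the coordinate \<open>z \<bullet> b\<close> is the tangential part of \<open>b\<close>, and the divergence of this
  field is the trace of the derivative of the unit normal times the normal component of \<open>b\<close>.\<close>

lemma laplace_coordinate:
  "laplace_beltrami M (\<lambda>z. z \<bullet> b) p = - ((\<Sum>e\<in>frame. hessian e \<bullet> e) / norm (G p)) * (u \<bullet> b)"
proof -
  obtain \<iota> where nd: "(unit_normal has_derivative (\<lambda>v. inverse (norm (G p)) *\<^sub>R hessian v + \<iota> v *\<^sub>R G p)) (at p)"
    (is "(_ has_derivative ?N) _") by (rule unit_normal_derivative)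
  let ?X = "tangential_gradient M (\<lambda>z. z \<bullet> b)"
  let ?D = "\<lambda>v. 0 - ((b \<bullet> unit_normal p) *\<^sub>R ?N v + (b \<bullet> ?N v) *\<^sub>R unit_normal p)"
  have "((\<lambda>q. b - (b \<bullet> unit_normal q) *\<^sub>R unit_normal q) has_derivative ?D) (at p within M)"
    by (rule has_derivative_at_withinI[OF has_derivative_diff[OF has_derivative_const
          has_derivative_scaleR[OF has_derivative_inner_right[OF nd] nd]]])
  moreover have "\<exists>d>0. \<forall>q\<in>M. dist q p < d \<longrightarrow> q \<in> V"
    using open_V pV unfolding open_dist by blast
  then obtain d where d: "d > 0" "\<And>q. q \<in> M \<Longrightarrow> dist q p < d \<Longrightarrow> q \<in> V" by blast
  ultimately have hd: "(?X has_derivative ?D) (at p within M)"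
    using has_derivative_transform_within[OF _ d(1) pM, of _ _ ?X] tangential_gradient_coordinate d(2) by simp
  hence "(?X has_derivative frechet_derivative ?X (at p within M)) (at p within M)"
    using frechet_derivative_works differentiable_def by blast
  note fd = has_derivative_within_tangent_unique[OF this hd]
  have e: "frechet_derivative ?X (at p within M) e \<bullet> e = - (u \<bullet> b) / norm (G p) * (hessian e \<bullet> e)" if "e \<in> frame" for e
  proof -
    have "e \<in> span frame" using that span_base by blast
    hence Ge: "G p \<bullet> e = 0" using frame(3) by blast
    hence ue: "u \<bullet> e = 0" using norm_G_pos by (subst (asm) oriented) simp
    have "frechet_derivative ?X (at p within M) e = ?D e"
      using Ge tangent_space_at[OF pM pV] by (intro fd) simp
    moreover have "?D e \<bullet> e = - ((b \<bullet> u) * (?N e \<bullet> e) + (b \<bullet> ?N e) * (u \<bullet> e))"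
      by (simp add: unit_normal_p inner_diff_left inner_add_left del: scaleR_add_right)
    moreover have "?N e \<bullet> e = inverse (norm (G p)) * (hessian e \<bullet> e)"
      using Ge by (simp add: inner_add_left)
    ultimately show ?thesis using ue by (simp add: inner_commute[of b u] divide_inverse)
  qed
  have "laplace_beltrami M (\<lambda>z. z \<bullet> b) p = (\<Sum>e\<in>frame. - (u \<bullet> b) / norm (G p) * (hessian e \<bullet> e))"
    unfolding laplace_beltrami_def tangential_divergence_def frame_def[symmetric] by (rule sum.cong[OF refl e])
  also have "\<dots> = - (u \<bullet> b) / norm (G p) * (\<Sum>e\<in>frame. hessian e \<bullet> e)" by (rule sum_distrib_left[symmetric])
  finally show ?thesis by simp
qed

lemma mean_curvature_vector_eq:
  "mean_curvature_vector M p = - ((\<Sum>e\<in>frame. hessian e \<bullet> e) / norm (G p)) *\<^sub>R u"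
proof -
  have "mean_curvature_vector M p = (\<Sum>b\<in>Basis. (- ((\<Sum>e\<in>frame. hessian e \<bullet> e) / norm (G p)) * (u \<bullet> b)) *\<^sub>R b)"
    unfolding mean_curvature_vector_def laplace_coordinate ..
  also have "\<dots> = - ((\<Sum>e\<in>frame. hessian e \<bullet> e) / norm (G p)) *\<^sub>R (\<Sum>b\<in>Basis. (u \<bullet> b) *\<^sub>R b)"
    by (simp only: scaleR_sum_right scaleR_scaleR)
  finally show ?thesis by (simp add: euclidean_representation)
qed

text \<open>The unit normal field with positive definite second fundamental form is \<open>\<plusminus> G / |G|\<close>, and the sign
  is locally constant because both fields are continuous.  So the second fundamental form is the
  Hessian of \<open>f\<close>, up to a nonzero factor.\<close>

lemma hessian_nonzero:
  assumes v: "G p \<bullet> v = 0" "v \<noteq> 0" shows "hessian v \<bullet> v \<noteq> 0"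
proof -
  obtain \<nu> where \<nu>: "smooth_unit_normal M \<nu>"
    "\<And>v. v \<in> tangent_space M p \<Longrightarrow> v \<noteq> 0 \<Longrightarrow> second_fundamental_form M \<nu> p v v > 0"
    using M pM unfolding compact_strictly_convex_hypersurface_def by blast
  define c where "c q = \<nu> q \<bullet> unit_normal q" for q
  have eq: "\<nu> q = c q *\<^sub>R unit_normal q" "\<bar>c q\<bar> = 1" if q: "q \<in> M" "q \<in> V" for q
  proof -
    have Gq: "G q \<noteq> 0" using df q unfolding defining_function_def by auto
    hence nq: "unit_normal q \<bullet> unit_normal q = 1" unfolding unit_normal_def by (simp add: power2_norm_eq_inner[symmetric] power2_eq_square)
    have \<nu>q: "norm (\<nu> q) = 1" "\<And>w. G q \<bullet> w = 0 \<Longrightarrow> \<nu> q \<bullet> w = 0"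
      using \<nu>(1) q tangent_space_at[OF q] unfolding smooth_unit_normal_def by auto
    define w where "w = \<nu> q - c q *\<^sub>R unit_normal q"
    have nw: "unit_normal q \<bullet> w = 0" unfolding w_def c_def using nq by (simp add: inner_diff_right inner_commute)
    hence "G q \<bullet> w = 0" using Gq by (simp add: unit_normal_def)
    hence "\<nu> q \<bullet> w = 0" by (rule \<nu>q(2))
    hence "w \<bullet> w = 0" using nw unfolding w_def by (simp add: inner_diff_left)
    thus *: "\<nu> q = c q *\<^sub>R unit_normal q" unfolding w_def by simp
    have "norm (unit_normal q) = 1" using nq by (simp add: norm_eq_1)
    thus "\<bar>c q\<bar> = 1" using * \<nu>q(1) by (metis mult.right_neutral norm_scaleR)
  qed
  obtain \<iota> where nd: "(unit_normal has_derivative (\<lambda>v. inverse (norm (G p)) *\<^sub>R hessian v + \<iota> v *\<^sub>R G p)) (at p)"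
    (is "(_ has_derivative ?N) _") by (rule unit_normal_derivative)
  have "continuous (at p within M) \<nu>"
    using \<nu>(1) pM smooth_on_imp_continuous_on unfolding smooth_unit_normal_def continuous_on_eq_continuous_within by blast
  moreover have "continuous (at p within M) unit_normal"
    using has_derivative_continuous[OF nd] continuous_at_imp_continuous_at_within by blast
  ultimately have "continuous (at p within M) c" unfolding c_def by (intro continuous_intros)
  then obtain d1 where d1: "d1 > 0" "\<And>q. q \<in> M \<Longrightarrow> dist q p < d1 \<Longrightarrow> dist (c q) (c p) < 1"
    unfolding continuous_within_eps_delta by (metis zero_less_one)
  obtain d2 where d2: "d2 > 0" "\<And>q. dist q p < d2 \<Longrightarrow> q \<in> V" using open_V pV unfolding open_dist by blast
  have c_eq: "c q = c p" if "q \<in> M" "dist q p < min d1 d2" for q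
  proof -
    have "\<bar>c q - c p\<bar> < 1" using d1(2)[OF that(1)] that(2) by (simp add: dist_real_def)
    moreover have "\<bar>c q\<bar> = 1" using eq(2)[OF that(1)] d2(2)[of q] that(2) by simp
    moreover have "\<bar>c p\<bar> = 1" by (rule eq(2)[OF pM pV])
    ultimately show ?thesis by linarith
  qed
  have "((\<lambda>q. c p *\<^sub>R unit_normal q) has_derivative (\<lambda>v. c p *\<^sub>R ?N v)) (at p within M)"
    by (rule has_derivative_at_withinI[OF has_derivative_scaleR_right[OF nd]])
  moreover have "0 < min d1 d2" using d1(1) d2(1) by simp
  moreover have "c p *\<^sub>R unit_normal q = \<nu> q" if "q \<in> M" "dist q p < min d1 d2" for q
    using eq(1)[OF that(1)] c_eq[OF that] d2(2)[of q] that(2) by simp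
  ultimately have hd: "(\<nu> has_derivative (\<lambda>v. c p *\<^sub>R ?N v)) (at p within M)"
    using has_derivative_transform_within[OF _ _ pM] by blast
  hence "(\<nu> has_derivative frechet_derivative \<nu> (at p within M)) (at p within M)"
    using frechet_derivative_works differentiable_def by blast
  moreover have vT: "v \<in> tangent_space M p" using v tangent_space_at[OF pM pV] by simp
  ultimately have "frechet_derivative \<nu> (at p within M) v = c p *\<^sub>R ?N v"
    using has_derivative_within_tangent_unique[OF _ hd] by blast
  hence "second_fundamental_form M \<nu> p v v = c p * (hessian v \<bullet> v) / norm (G p)"
    unfolding second_fundamental_form_def using v by (simp add: inner_add_left divide_inverse)
  thus ?thesis using \<nu>(2)[OF vT v(2)] by auto
qed

lemma trace_pos:
  assumes "DIM('a) \<ge> 2" shows "(\<Sum>e\<in>frame. hessian e \<bullet> e) > 0"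
proof -
  obtain v where "v \<noteq> 0" "orthogonal (G p) v" using orthogonal_to_vector_exists[OF assms] by blast
  hence "v \<in> span frame" "v \<noteq> 0" using frame(3) by (auto simp: orthogonal_def)
  hence "frame \<noteq> {}" by auto
  moreover have "hessian e \<bullet> e > 0" if "e \<in> frame" for e
  proof -
    have "G p \<bullet> e = 0" using that frame(3) span_base by blast
    moreover have "e \<noteq> 0" using frame(2)[OF that] by auto
    ultimately show ?thesis using hessian_nonneg hessian_nonzero by (metis less_le)
  qed
  ultimately show ?thesis using frame(4) by (intro sum_pos) auto
qed

text \<open>By second order contact, a curve outside the body bends towards it at most as much as the body
  does in the direction of the curve.  This is at most the squared speed times the trace of the
  second fundamental form, which is the mean curvature.\<close>

lemma acceleration_gt_mean_curvature:
  assumes "DIM('a) \<ge> 2" "e > 0" "\<gamma> 0 = p" "\<And>s. \<bar>s\<bar> < e \<Longrightarrow> (\<gamma> has_vector_derivative \<gamma>' s) (at s)"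
    "(\<gamma>' has_vector_derivative a) (at 0)"
    "\<And>s. \<bar>s\<bar> < e \<Longrightarrow> \<gamma> s \<notin> interior (convex hull M)"
    and c: "c \<ge> 0" "c * (norm (\<gamma>' 0))\<^sup>2 < 1"
  shows "u \<bullet> mean_curvature_vector M p < c * (u \<bullet> a)"
proof -
  let ?tr = "\<Sum>e\<in>frame. hessian e \<bullet> e"
  note so = second_order_contact[OF assms(2-6)]
  have "hessian (\<gamma>' 0) \<bullet> \<gamma>' 0 \<le> (norm (\<gamma>' 0))\<^sup>2 * ?tr"
    by (rule nonneg_form_le_trace[OF hessian(2) frame(1,2)]) (use hessian_nonneg frame(3) so(1) in auto)
  hence "c * (hessian (\<gamma>' 0) \<bullet> \<gamma>' 0) \<le> c * ((norm (\<gamma>' 0))\<^sup>2 * ?tr)" using c(1) by (rule mult_left_mono)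
  also have "\<dots> = (c * (norm (\<gamma>' 0))\<^sup>2) * ?tr" by simp
  also have "\<dots> < 1 * ?tr" using trace_pos[OF assms(1)] c(2) by (rule mult_strict_right_mono[rotated])
  finally have 1: "c * (hessian (\<gamma>' 0) \<bullet> \<gamma>' 0) < ?tr" by simp
  have "c * (hessian (\<gamma>' 0) \<bullet> \<gamma>' 0 + G p \<bullet> a) \<ge> 0" using so(2) c(1) by simp
  moreover have "G p \<bullet> a = norm (G p) * (u \<bullet> a)" by (subst oriented) simp
  ultimately have "c * (hessian (\<gamma>' 0) \<bullet> \<gamma>' 0) + norm (G p) * (c * (u \<bullet> a)) \<ge> 0"
    by (simp add: algebra_simps)
  hence "- ?tr < norm (G p) * (c * (u \<bullet> a))" using 1 by simp
  hence "- ?tr / norm (G p) < c * (u \<bullet> a)" using norm_G_pos by (simp add: field_simps)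
  moreover have "u \<bullet> mean_curvature_vector M p = - ?tr / norm (G p)"
    unfolding mean_curvature_vector_eq using norm_u by (simp add: dot_square_norm)
  ultimately show ?thesis by simp
qed

end

section \<open>Periodic functions\<close>

abbreviation period :: "real set" where "period \<equiv> {0..2 * pi}"

definition periodic :: "(real \<Rightarrow> 'b) \<Rightarrow> bool" where
  "periodic f \<longleftrightarrow> (\<forall>\<theta>. f (\<theta> + 2 * pi) = f \<theta>)"

lemma periodic_int:
  assumes "periodic f" shows "f (\<theta> + 2 * pi * of_int k) = f \<theta>"
proof -
  have n: "f (\<theta> + 2 * pi * of_nat n) = f \<theta>" for \<theta> n
  proof (induction n)
    case (Suc n)
    have "f (\<theta> + 2 * pi * of_nat (Suc n)) = f ((\<theta> + 2 * pi * of_nat n) + 2 * pi)" by (simp add: algebra_simps)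
    also have "\<dots> = f (\<theta> + 2 * pi * of_nat n)" using assms unfolding periodic_def by blast
    finally show ?case using Suc by simp
  qed simp
  show ?thesis
  proof (cases "k \<ge> 0")
    case True thus ?thesis using n[of \<theta> "nat k"] by simp
  next
    case False
    thus ?thesis using n[of "\<theta> + 2 * pi * of_int k" "nat (- k)"] by simp
  qed
qed

lemma periodic_representative:
  obtains k :: int where "\<theta> + 2 * pi * of_int k \<in> {c..<c + 2 * pi}"
proof
  define q where "q = (\<theta> - c) / (2 * pi)"
  have q: "\<theta> - c = 2 * pi * q" by (simp add: q_def)
  have "2 * pi * of_int \<lfloor>q\<rfloor> \<le> 2 * pi * q" by (intro mult_left_mono) auto
  moreover have "2 * pi * q < 2 * pi * (of_int \<lfloor>q\<rfloor> + 1)" by (intro mult_strict_left_mono) auto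
  ultimately show "\<theta> + 2 * pi * of_int (- \<lfloor>q\<rfloor>) \<in> {c..<c + 2 * pi}" using q by (simp add: algebra_simps)
qed

lemma periodic_attained:
  assumes "periodic f" shows "\<exists>\<phi>\<in>period. f \<phi> = f \<theta>"
proof -
  obtain k :: int where "\<theta> + 2 * pi * of_int k \<in> {0..<0 + 2 * pi}" by (rule periodic_representative)
  thus ?thesis using periodic_int[OF assms] by (intro bexI[of _ "\<theta> + 2 * pi * of_int k"]) auto
qed

section \<open>Curves outside a convex mean curvature flow\<close>

lemma supports_not_interior:
  assumes "supports u x K" shows "x \<notin> interior K"
proof
  assume "x \<in> interior K"
  then obtain r where r: "r > 0" "cball x r \<subseteq> K" using mem_interior_cball by blast
  have u: "norm u = 1" using assms unfolding supports_def by simp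
  have "x + r *\<^sub>R u \<in> cball x r" using u r(1) by (simp add: dist_norm)
  hence "u \<bullet> (x + r *\<^sub>R u) \<le> u \<bullet> x" using assms r(2) unfolding supports_def by blast
  thus False using r(1) u by (simp add: inner_add_right dot_square_norm)
qed

locale convex_flow =
  fixes M :: "real \<Rightarrow> 'a::euclidean_space set" and F :: "real \<Rightarrow> 'a \<Rightarrow> 'a" and T :: ereal
  assumes flow: "strictly_convex_mcf M F T" and dim: "DIM('a) \<ge> 2"
begin

abbreviation "I \<equiv> time_interval T"
abbreviation "K t \<equiv> convex hull (M t)"

lemma hypersurface: "t \<in> I \<Longrightarrow> compact_strictly_convex_hypersurface (M t)"
  using flow unfolding strictly_convex_mcf_def by blast

lemmas K_facts = hull_of_compact_strictly_convex_hypersurface[OF hypersurface]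

lemma I_0: "0 \<in> I"
  using flow unfolding strictly_convex_mcf_def time_interval_def by (simp add: zero_ereal_def)

lemma I_mono: "t \<in> I \<Longrightarrow> 0 \<le> s \<Longrightarrow> s \<le> t \<Longrightarrow> s \<in> I"
  unfolding time_interval_def by (auto intro: le_less_trans[of "ereal s" "ereal t"])

lemma image_F: "t \<in> I \<Longrightarrow> F t ` M 0 = M t"
  using flow unfolding strictly_convex_mcf_def diffeomorphism_betw_def bij_betw_def by blast

lemma M_point: "t \<in> I \<Longrightarrow> q \<in> M t \<Longrightarrow> \<exists>z\<in>M 0. q = F t z"
  by (simp add: image_F[symmetric] image_iff)

lemma F_in_M: "t \<in> I \<Longrightarrow> z \<in> M 0 \<Longrightarrow> F t z \<in> M t"
  by (simp add: image_F[symmetric])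

lemma F_derivative:
  "t \<in> I \<Longrightarrow> z \<in> M 0 \<Longrightarrow>
    ((\<lambda>s. F s z) has_vector_derivative mean_curvature_vector (M t) (F t z)) (at t within I)"
  using flow unfolding strictly_convex_mcf_def by blast

lemma continuous_F: "continuous_on (I \<times> M 0) (\<lambda>(t, z). F t z)"
  using flow smooth_on_imp_continuous_on unfolding strictly_convex_mcf_def by blast

lemma tendsto_F:
  assumes "\<And>n. t n \<in> I" "s \<in> I" "t \<longlonglongrightarrow> s" "\<And>n. z n \<in> M 0" "w \<in> M 0" "z \<longlonglongrightarrow> w"
  shows "(\<lambda>n. F (t n) (z n)) \<longlonglongrightarrow> F s w"
proof -
  have "(\<lambda>n. (t n, z n)) \<longlonglongrightarrow> (s, w)" using assms by (intro tendsto_intros)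
  from continuous_on_tendsto_compose[OF continuous_F this]
  show ?thesis using assms by simp
qed

text \<open>Vectors that support the bodies at the times \<open>t n\<close> subconverge, and the limit supports \<open>M s\<close>
  because every point of \<open>M s\<close> is a limit of points of \<open>M (t n)\<close> on the same flow line.\<close>

lemma limit_support:
  assumes "\<And>n. t n \<in> I" "s \<in> I" "t \<longlonglongrightarrow> s" "x \<longlonglongrightarrow> y" "\<And>n. x n \<notin> interior (K (t n))"
  obtains r u v where "strict_mono (r::nat\<Rightarrow>nat)" "\<And>n. supports (u n) (x n) (M (t n))"
    "(u \<circ> r) \<longlonglongrightarrow> v" "supports v y (M s)"
proof -
  have "\<forall>n. \<exists>w. norm w = 1 \<and> (\<forall>q\<in>K (t n). w \<bullet> q \<le> w \<bullet> x n)"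
  proof
    fix n show "\<exists>w. norm w = 1 \<and> (\<forall>q\<in>K (t n). w \<bullet> q \<le> w \<bullet> x n)"
      by (rule supporting_vector_exists[OF convex_convex_hull K_facts(2)[OF assms(1)] assms(5)])
  qed
  from choice[OF this]
  obtain u where u: "\<forall>n. norm (u n) = 1 \<and> (\<forall>q\<in>K (t n). u n \<bullet> q \<le> u n \<bullet> x n)" by (elim exE)
  obtain r v where r: "strict_mono (r::nat\<Rightarrow>nat)" "(u \<circ> r) \<longlonglongrightarrow> v" "norm v = 1"
    by (rule unit_vectors_subsequence[of u]) (simp add: u)
  have xr: "(x \<circ> r) \<longlonglongrightarrow> y" "(t \<circ> r) \<longlonglongrightarrow> s" using assms(3,4) r(1) by (auto intro: LIMSEQ_subseq_LIMSEQ)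
  have supp_n: "supports (u n) (x n) (M (t n))" for n
    unfolding supports_def
  proof (intro conjI ballI)
    show "norm (u n) = 1" using u[rule_format, of n] by (rule conjunct1)
    fix q assume "q \<in> M (t n)"
    hence "q \<in> K (t n)" by (rule hull_inc)
    thus "u n \<bullet> q \<le> u n \<bullet> x n" by (rule bspec[OF conjunct2[OF spec[OF u]]])
  qed
  have "v \<bullet> q \<le> v \<bullet> y" if q: "q \<in> M s" for q
  proof -
    obtain z where z: "z \<in> M 0" "q = F s z" using M_point[OF assms(2) q] by (elim bexE)
    have "(\<lambda>n. F ((t \<circ> r) n) z) \<longlonglongrightarrow> F s z"
      by (rule tendsto_F[OF _ assms(2) xr(2) _ z(1) tendsto_const]) (simp_all add: assms(1) z(1))
    hence a: "(\<lambda>n. (u \<circ> r) n \<bullet> F ((t \<circ> r) n) z) \<longlonglongrightarrow> v \<bullet> F s z" by (intro tendsto_inner r(2))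
    have b: "(\<lambda>n. (u \<circ> r) n \<bullet> (x \<circ> r) n) \<longlonglongrightarrow> v \<bullet> y" by (intro tendsto_inner r(2) xr(1))
    have "(u \<circ> r) n \<bullet> F ((t \<circ> r) n) z \<le> (u \<circ> r) n \<bullet> (x \<circ> r) n" for n
    proof -
      have "F (t (r n)) z \<in> M (t (r n))" using assms(1) z(1) by (rule F_in_M)
      thus ?thesis using supp_n unfolding supports_def by simp
    qed
    thus ?thesis using tendsto_le[OF _ b a] z(2) by simp
  qed
  hence "supports v y (M s)" using r(3) unfolding supports_def by blast
  thus ?thesis by (rule that[OF r(1) supp_n r(2)])
qed

text \<open>If \<open>y\<close> were separated from \<open>K s\<close> by a linear function, then each \<open>M (t n)\<close> would contain a point
  on the side of \<open>x n\<close>, and a subsequence of these points would converge to a point of \<open>M s\<close> on the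
  side of \<open>y\<close>.\<close>

lemma closed_graph_K:
  assumes "\<And>n. t n \<in> I" "s \<in> I" "t \<longlonglongrightarrow> s" "x \<longlonglongrightarrow> y" "\<And>n. x n \<in> K (t n)"
  shows "y \<in> K s"
proof (rule ccontr)
  assume y: "y \<notin> K s"
  have "closed (K s)" using K_facts(1)[OF assms(2)] compact_imp_closed by blast
  then obtain a b where ab: "a \<bullet> y < b" "\<And>q. q \<in> K s \<Longrightarrow> b < a \<bullet> q"
    using separating_hyperplane_closed_point[OF convex_convex_hull _ y] by blast
  have "\<exists>z\<in>M 0. a \<bullet> F (t n) z \<le> a \<bullet> x n" for n
  proof (rule ccontr)
    assume "\<not> ?thesis"
    hence "M (t n) \<subseteq> {q. a \<bullet> q > a \<bullet> x n}"
      unfolding image_F[OF assms(1)[of n], symmetric] by (auto simp: not_le)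
    hence "K (t n) \<subseteq> {q. a \<bullet> q > a \<bullet> x n}" by (rule hull_minimal) (rule convex_halfspace_gt)
    thus False using assms(5)[of n] by blast
  qed
  then obtain z where z: "\<And>n. z n \<in> M 0" "\<And>n. a \<bullet> F (t n) (z n) \<le> a \<bullet> x n" by metis
  have "compact (M 0)" using hypersurface[OF I_0] unfolding compact_strictly_convex_hypersurface_def by blast
  then obtain w r where w: "w \<in> M 0" "strict_mono (r::nat\<Rightarrow>nat)" "(z \<circ> r) \<longlonglongrightarrow> w"
    using z(1) unfolding compact_def by metis
  have xr: "(x \<circ> r) \<longlonglongrightarrow> y" "(t \<circ> r) \<longlonglongrightarrow> s" using assms(3,4) w(2) by (auto intro: LIMSEQ_subseq_LIMSEQ)
  have "(\<lambda>n. F ((t \<circ> r) n) ((z \<circ> r) n)) \<longlonglongrightarrow> F s w"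
    by (rule tendsto_F[OF _ assms(2) xr(2) _ w(1,3)]) (simp_all add: assms(1) z(1))
  hence "(\<lambda>n. a \<bullet> F ((t \<circ> r) n) ((z \<circ> r) n)) \<longlonglongrightarrow> a \<bullet> F s w" by (intro tendsto_intros)
  moreover have "(\<lambda>n. a \<bullet> (x \<circ> r) n) \<longlonglongrightarrow> a \<bullet> y" by (intro tendsto_intros xr)
  moreover have "a \<bullet> F ((t \<circ> r) n) ((z \<circ> r) n) \<le> a \<bullet> (x \<circ> r) n" for n using z(2) by simp
  ultimately have "a \<bullet> F s w \<le> a \<bullet> y" using tendsto_le[OF sequentially_bot] by (metis (no_types, lifting) always_eventually)
  moreover have "F s w \<in> K s" using F_in_M[OF assms(2) w(1)] by (rule hull_inc)
  ultimately show False using ab by force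
qed

text \<open>At a first contact, the vectors that separate \<open>\<gamma> s \<theta>\<close> from \<open>K s\<close> for \<open>s < t\<close> tend to the
  outward normal \<open>v\<close>.  Each of them separates \<open>\<gamma> s \<theta>\<close> from the point of \<open>M s\<close> that reaches the
  contact point along its flow line.  In the limit, the curve approaches the hypersurface in the
  direction \<open>- v\<close>, which contradicts the comparison of acceleration and mean curvature.\<close>

lemma no_first_contact:
  assumes t0: "0 \<le> t0" "t0 < t" "t \<in> I"
    and outside: "\<And>s \<theta>. t0 \<le> s \<Longrightarrow> s < t \<Longrightarrow> \<gamma> s \<theta> \<notin> K s"
    and cont: "\<And>\<theta>. continuous_on {t0..t} (\<lambda>s. \<gamma> s \<theta>)"
    and d1: "\<And>\<theta>. (\<gamma> t has_vector_derivative d\<gamma> \<theta>) (at \<theta>)"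
    and d2: "\<And>\<theta>. (d\<gamma> has_vector_derivative dd\<gamma> \<theta>) (at \<theta>)"
    and dt: "\<And>\<theta>. ((\<lambda>s. \<gamma> s \<theta>) has_vector_derivative c *\<^sub>R dd\<gamma> \<theta>) (at t within {t0..t})"
    and c: "c \<ge> 0" "\<And>\<theta>. c * (norm (d\<gamma> \<theta>))\<^sup>2 < 1"
  shows "\<gamma> t \<theta> \<notin> K t"
proof
  define s where "s n = t - (t - t0) / real (Suc n)" for n
  have s_bounds: "t0 \<le> s n" "s n < t" for n
  proof -
    have "(t - t0) / real (Suc n) \<le> (t - t0) / 1" using t0 by (intro divide_left_mono) auto
    thus "t0 \<le> s n" by (simp add: s_def)
    show "s n < t" using t0 by (simp add: s_def)
  qed
  have "(\<lambda>n. (t - t0) * (1 / real (Suc n))) \<longlonglongrightarrow> (t - t0) * 0"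
    using tendsto_mult[OF tendsto_const LIMSEQ_inverse_real_of_nat, of "t - t0"]
    by (simp add: inverse_eq_divide)
  hence "(\<lambda>n. t - (t - t0) * (1 / real (Suc n))) \<longlonglongrightarrow> t - (t - t0) * 0"
    by (rule tendsto_diff[OF tendsto_const])
  hence s_lim: "s \<longlonglongrightarrow> t" by (simp add: s_def[abs_def])
  have sI: "s n \<in> I" for n using I_mono[OF t0(3)] s_bounds[of n] t0(1) by auto
  have x_lim: "(\<lambda>n. \<gamma> (s n) \<theta>) \<longlonglongrightarrow> \<gamma> t \<theta>" for \<theta>
  proof -
    show ?thesis
      by (rule continuous_on_tendsto_compose[OF cont s_lim])
         (use s_bounds t0 in \<open>auto simp: less_imp_le\<close>)
  qed
  have out_n: "\<gamma> (s n) \<theta> \<notin> interior (K (s n))" for n \<theta>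
    using outside[OF s_bounds] interior_subset by blast
  have not_int: "\<gamma> t \<theta> \<notin> interior (K t)" for \<theta>
    by (rule limit_support[of s t "\<lambda>n. \<gamma> (s n) \<theta>", OF sI t0(3) s_lim x_lim out_n])
       (simp add: supports_not_interior supports_hull)
  assume "\<gamma> t \<theta> \<in> K t"
  hence "\<gamma> t \<theta> \<in> M t"
    using not_int[of \<theta>] K_facts(1,3)[OF t0(3)] closure_subset[of "K t"] unfolding frontier_def by blast
  then obtain z where z: "z \<in> M 0" "F t z = \<gamma> t \<theta>" using M_point[OF t0(3)] by metis
  obtain r u v where u: "strict_mono (r::nat\<Rightarrow>nat)" "\<And>n. supports (u n) (\<gamma> (s n) \<theta>) (M (s n))"
    "(u \<circ> r) \<longlonglongrightarrow> v" "supports v (\<gamma> t \<theta>) (M t)"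
    by (rule limit_support[of s t "\<lambda>n. \<gamma> (s n) \<theta>", OF sI t0(3) s_lim x_lim out_n])
       (rule that, assumption+)
  define L where "L = c *\<^sub>R dd\<gamma> \<theta> - mean_curvature_vector (M t) (\<gamma> t \<theta>)"
  define w where "w s = \<gamma> s \<theta> - F s z" for s
  obtain V f G where cc: "convex_contact (M t) (\<gamma> t \<theta>) v V f G"
    using convex_contact_exists[OF hypersurface[OF t0(3)] \<open>\<gamma> t \<theta> \<in> M t\<close> u(4)] .
  have shift: "((\<lambda>s. g (\<theta> + s)) has_vector_derivative g' (\<theta> + a)) (at a)"
    if "\<And>\<theta>. (g has_vector_derivative g' \<theta>) (at \<theta>)" for g g' :: "real \<Rightarrow> 'a" and a
  proof -
    have "((\<lambda>s. \<theta> + s) has_vector_derivative 1) (at a)" by (auto intro!: derivative_eq_intros)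
    from vector_diff_chain_at[OF this that] show ?thesis by (simp add: o_def)
  qed
  have "v \<bullet> mean_curvature_vector (M t) (\<gamma> t \<theta>) < c * (v \<bullet> dd\<gamma> \<theta>)"
  proof (rule convex_contact.acceleration_gt_mean_curvature[OF cc dim zero_less_one])
    show "\<gamma> t (\<theta> + 0) = \<gamma> t \<theta>" by simp
    show "((\<lambda>s. \<gamma> t (\<theta> + s)) has_vector_derivative d\<gamma> (\<theta> + s)) (at s)" for s
      by (rule shift[OF d1])
    show "((\<lambda>s. d\<gamma> (\<theta> + s)) has_vector_derivative dd\<gamma> \<theta>) (at 0)"
      using shift[OF d2, of 0] by simp
    show "\<gamma> t (\<theta> + s) \<notin> interior (K t)" for s by (rule not_int)
    show "c * (norm (d\<gamma> (\<theta> + 0)))\<^sup>2 < 1" by (rule c(2))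
  qed (rule c(1))
  hence vL: "v \<bullet> L > 0" by (simp add: L_def inner_diff_right)
  have "((\<lambda>s. F s z) has_vector_derivative mean_curvature_vector (M t) (\<gamma> t \<theta>)) (at t within {t0..t})"
  proof (rule has_vector_derivative_within_subset)
    show "((\<lambda>s. F s z) has_vector_derivative mean_curvature_vector (M t) (\<gamma> t \<theta>)) (at t within I)"
      using F_derivative[OF t0(3) z(1)] unfolding z(2) .
    show "{t0..t} \<subseteq> I" using I_mono[OF t0(3)] t0(1) by (auto intro: order_trans)
  qed
  from has_vector_derivative_diff[OF dt[of \<theta>] this]
  have "(w has_vector_derivative L) (at t within {t0..t})"
    unfolding w_def[abs_def] L_def .
  hence "((\<lambda>y. (1 / norm (y - t)) *\<^sub>R (w y - (w t + (y - t) *\<^sub>R L))) \<longlongrightarrow> 0) (at t within {t0..t})"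
    unfolding has_vector_derivative_def has_derivative_within by (rule conjunct2)
  moreover have "filterlim (s \<circ> r) (at t within {t0..t}) sequentially"
    unfolding filterlim_at
  proof
    show "\<forall>\<^sub>F n in sequentially. (s \<circ> r) n \<in> {t0..t} \<and> (s \<circ> r) n \<noteq> t"
    proof (intro always_eventually allI)
      fix n show "(s \<circ> r) n \<in> {t0..t} \<and> (s \<circ> r) n \<noteq> t"
        using s_bounds[of "r n"] by simp
    qed
    show "(s \<circ> r) \<longlonglongrightarrow> t" using s_lim u(1) by (rule LIMSEQ_subseq_LIMSEQ)
  qed
  ultimately have "(\<lambda>n. (1 / norm ((s \<circ> r) n - t)) *\<^sub>R (w ((s \<circ> r) n) - (w t + ((s \<circ> r) n - t) *\<^sub>R L))) \<longlonglongrightarrow> 0"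
    by (rule filterlim_compose)
  hence "(\<lambda>n. (u \<circ> r) n \<bullet> ((1 / norm ((s \<circ> r) n - t)) *\<^sub>R (w ((s \<circ> r) n) - (w t + ((s \<circ> r) n - t) *\<^sub>R L)))) \<longlonglongrightarrow> v \<bullet> 0"
    by (intro tendsto_inner u(3))
  moreover have "(\<lambda>n. (u \<circ> r) n \<bullet> L) \<longlonglongrightarrow> v \<bullet> L" by (intro tendsto_intros u(3))
  moreover have "(u \<circ> r) n \<bullet> L \<le> (u \<circ> r) n \<bullet> ((1 / norm ((s \<circ> r) n - t)) *\<^sub>R (w ((s \<circ> r) n) - (w t + ((s \<circ> r) n - t) *\<^sub>R L)))" for n
  proof -
    let ?s = "s (r n)" and ?u = "u (r n)"
    have "F ?s z \<in> M ?s" using sI z(1) by (rule F_in_M)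
    hence "?u \<bullet> w ?s \<ge> 0" using u(2)[of "r n"] unfolding supports_def w_def by (simp add: inner_diff_right)
    hence "0 \<le> 1 / (t - ?s) * (?u \<bullet> w ?s)" using s_bounds(2)[of "r n"] by simp
    moreover have "w t = 0" using z by (simp add: w_def)
    moreover have "(1 / norm (?s - t)) *\<^sub>R (w ?s - (0 + (?s - t) *\<^sub>R L)) = (1 / (t - ?s)) *\<^sub>R w ?s + L"
    proof -
      have "(?s - t) / (t - ?s) = - 1" using s_bounds(2)[of "r n"] by (simp add: field_simps)
      thus ?thesis using s_bounds(2)[of "r n"] by (simp add: scaleR_diff_right)
    qed
    ultimately show ?thesis by (simp add: inner_add_right)
  qed
  ultimately have "v \<bullet> L \<le> v \<bullet> 0"
    using tendsto_le[OF sequentially_bot] by (metis (no_types, lifting) always_eventually)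
  thus False using vL by simp
qed

text \<open>The contacts of the curves with the bodies form a compact set of times and parameters, so there
  would be a first one.\<close>

lemma avoidance_principle:
  assumes t0: "0 \<le> t0" "t0 \<le> t1" "t1 \<in> I"
    and cont: "continuous_on ({t0..t1} \<times> UNIV) (\<lambda>(t, \<theta>). \<gamma> t \<theta>)"
    and per: "\<And>t. t \<in> {t0..t1} \<Longrightarrow> periodic (\<gamma> t)"
    and d1: "\<And>t \<theta>. t \<in> {t0<..t1} \<Longrightarrow> (\<gamma> t has_vector_derivative d\<gamma> t \<theta>) (at \<theta>)"
    and d2: "\<And>t \<theta>. t \<in> {t0<..t1} \<Longrightarrow> (d\<gamma> t has_vector_derivative dd\<gamma> t \<theta>) (at \<theta>)"
    and dt: "\<And>t \<theta>. t \<in> {t0<..t1} \<Longrightarrow> ((\<lambda>s. \<gamma> s \<theta>) has_vector_derivative c *\<^sub>R dd\<gamma> t \<theta>) (at t within {t0..t})"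
    and c: "c \<ge> 0" "\<And>t \<theta>. t \<in> {t0<..t1} \<Longrightarrow> c * (norm (d\<gamma> t \<theta>))\<^sup>2 < 1"
    and init: "\<And>\<theta>. \<gamma> t0 \<theta> \<notin> K t0"
    and t: "t \<in> {t0..t1}"
  shows "\<gamma> t \<theta> \<notin> K t"
proof
  assume in_K: "\<gamma> t \<theta> \<in> K t"
  have II: "s \<in> I" if "s \<in> {t0..t1}" for s using I_mono[OF t0(3)] that t0(1) by auto
  define S where "S = {(s, \<phi>). s \<in> {t0..t1} \<and> \<phi> \<in> period \<and> \<gamma> s \<phi> \<in> K s}"
  have sub: "S \<subseteq> {t0..t1} \<times> period" by (auto simp: S_def)
  have "closed S"
    unfolding closed_sequential_limits
  proof (intro allI impI)
    fix x l assume x: "(\<forall>n. x n \<in> S) \<and> x \<longlonglongrightarrow> l"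
    have "l \<in> {t0..t1} \<times> period"
      by (rule closed_sequentially[of "{t0..t1} \<times> period" x]) (use x sub in \<open>auto intro: closed_Times\<close>)
    hence l: "fst l \<in> {t0..t1}" "snd l \<in> period" by auto
    have xn: "fst (x n) \<in> {t0..t1}" "\<gamma> (fst (x n)) (snd (x n)) \<in> K (fst (x n))" for n
      using x by (auto simp: S_def split_beta)
    have "(\<lambda>n. (\<lambda>(t, \<theta>). \<gamma> t \<theta>) (x n)) \<longlonglongrightarrow> (\<lambda>(t, \<theta>). \<gamma> t \<theta>) l"
    proof (rule continuous_on_tendsto_compose[OF cont])
      show "x \<longlonglongrightarrow> l" using x by blast
      show "l \<in> {t0..t1} \<times> UNIV" using l by (simp add: mem_Times_iff)
      show "\<forall>\<^sub>F n in sequentially. x n \<in> {t0..t1} \<times> UNIV" using xn(1) by (simp add: mem_Times_iff)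
    qed
    hence "(\<lambda>n. \<gamma> (fst (x n)) (snd (x n))) \<longlonglongrightarrow> \<gamma> (fst l) (snd l)"
      by (simp add: split_beta)
    moreover have "(\<lambda>n. fst (x n)) \<longlonglongrightarrow> fst l" using x by (intro tendsto_intros) auto
    ultimately have "\<gamma> (fst l) (snd l) \<in> K (fst l)"
      using closed_graph_K[of "\<lambda>n. fst (x n)" "fst l"] II xn l by blast
    thus "l \<in> S" using l by (auto simp: S_def split_beta)
  qed
  moreover have "bounded S" by (rule bounded_subset[OF _ sub]) (auto intro: bounded_Times)
  ultimately have "compact S" using compact_eq_bounded_closed by blast
  moreover have "S \<noteq> {}"
  proof -
    obtain \<theta>' where "\<theta>' \<in> period" "\<gamma> t \<theta>' = \<gamma> t \<theta>" using periodic_attained[OF per[OF t]] by blast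
    hence "(t, \<theta>') \<in> S" using in_K t by (simp add: S_def)
    thus ?thesis by blast
  qed
  moreover have "continuous_on S fst" by (intro continuous_intros)
  ultimately obtain x where x: "x \<in> S" "\<And>y. y \<in> S \<Longrightarrow> fst x \<le> fst y"
    using continuous_attains_inf[of S fst] by auto
  obtain s \<phi> where s: "x = (s, \<phi>)" by (cases x)
  have sS: "s \<in> {t0..t1}" "\<gamma> s \<phi> \<in> K s" using x(1) s by (auto simp: S_def)
  hence "s \<noteq> t0" using init by auto
  hence s0: "t0 < s" "s \<in> {t0<..t1}" using sS by auto
  have before: "\<gamma> r \<psi> \<notin> K r" if r: "t0 \<le> r" "r < s" for r \<psi>
  proof
    assume "\<gamma> r \<psi> \<in> K r"
    moreover have rt: "r \<in> {t0..t1}" using r sS by auto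
    moreover obtain \<psi>' where "\<psi>' \<in> period" "\<gamma> r \<psi>' = \<gamma> r \<psi>" using periodic_attained[OF per[OF rt]] by blast
    ultimately have "(r, \<psi>') \<in> S" by (simp add: S_def)
    from x(2)[OF this] show False using r s by simp
  qed
  have "\<gamma> s \<phi> \<notin> K s"
  proof (rule no_first_contact[where d\<gamma> = "d\<gamma> s" and dd\<gamma> = "dd\<gamma> s" and c = c, OF t0(1) s0(1) II[OF sS(1)] before])
    show "continuous_on {t0..s} (\<lambda>r. \<gamma> r \<theta>)" for \<theta>
    proof -
      have "continuous_on {t0..s} (\<lambda>r. (\<lambda>(t, \<theta>). \<gamma> t \<theta>) (r, \<theta>))"
        by (rule continuous_on_compose2[OF cont]) (use sS in \<open>auto intro!: continuous_intros\<close>)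
      thus ?thesis by simp
    qed
  qed (use d1[OF s0(2)] d2[OF s0(2)] dt[OF s0(2)] c(1) c(2)[OF s0(2)] in auto)
  thus False using sS by blast
qed

text \<open>The avoidance principle for constant curves.\<close>

lemma K_antimono:
  assumes "0 \<le> s" "s \<le> t" "t \<in> I" shows "K t \<subseteq> K s"
proof
  fix x assume x: "x \<in> K t"
  show "x \<in> K s"
  proof (rule ccontr)
    assume "x \<notin> K s"
    hence "x \<notin> K t"
      by (intro avoidance_principle[OF assms, of "\<lambda>_ _. x" "\<lambda>_ _. 0" "\<lambda>_ _. 0" 0 t])
         (use assms in \<open>auto simp: periodic_def\<close>)
    thus False using x by blast
  qed
qed

end

section \<open>Trigonometric polynomials and their heat flow\<close>

lemma cos_quadratic_error: "\<bar>cos y - (1 - y\<^sup>2 / 2)\<bar> \<le> y ^ 4 / 24" for y :: real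
proof -
  obtain t where "cos y = (\<Sum>m<4. cos_coeff m * y ^ m) + cos (t + 1 / 2 * real 4 * pi) / fact 4 * y ^ 4"
    using Maclaurin_cos_expansion[of y 4] by blast
  moreover have "(\<Sum>m<4. cos_coeff m * y ^ m) = 1 - y\<^sup>2 / 2"
    by (simp add: cos_coeff_def lessThan_nat_numeral fact_numeral)
  moreover have "\<bar>cos (t + 1 / 2 * real 4 * pi) / fact 4 * y ^ 4\<bar> \<le> 1 / 24 * y ^ 4"
  proof -
    have f: "fact 4 = (24::real)" by (simp add: eval_nat_numeral)
    have "\<bar>cos (t + 1 / 2 * real 4 * pi) / fact 4 * y ^ 4\<bar> = \<bar>cos (t + 1 / 2 * real 4 * pi)\<bar> * (y ^ 4 / 24)"
      unfolding f abs_mult abs_divide by simp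
    also have "\<dots> \<le> 1 * (y ^ 4 / 24)" by (intro mult_right_mono) auto
    finally show ?thesis by simp
  qed
  ultimately show ?thesis by simp
qed

text \<open>Replacing \<open>f \<theta>\<close> by the mean of \<open>f (\<theta> + \<delta>)\<close> and \<open>f (\<theta> - \<delta>)\<close> multiplies the frequency \<open>j\<close> by
  \<open>cos (j \<delta>)\<close>.  So this limit presents the heat flow as a limit of iterated averages, which
  transfers bounds from averages to the heat flow.\<close>

lemma cos_power_tendsto_exp:
  fixes x :: real
  shows "(\<lambda>m. cos (x / sqrt (real m)) ^ m) \<longlonglongrightarrow> exp (- (x\<^sup>2 / 2))"
proof -
  have lim: "(\<lambda>m. (1 + (- (x\<^sup>2 / 2)) / real m) ^ m) \<longlonglongrightarrow> exp (- (x\<^sup>2 / 2))"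
    by (rule tendsto_exp_limit_sequentially)
  have "(\<lambda>m. cos (x / sqrt (real m)) ^ m - (1 + (- (x\<^sup>2 / 2)) / real m) ^ m) \<longlonglongrightarrow> 0"
  proof (rule Lim_null_comparison)
    have "(\<lambda>m. x ^ 4 / 24 * inverse (real m)) \<longlonglongrightarrow> x ^ 4 / 24 * 0"
      by (intro tendsto_mult tendsto_const lim_inverse_n)
    thus "(\<lambda>m. x ^ 4 / 24 * inverse (real m)) \<longlonglongrightarrow> 0" by simp
    obtain N :: nat where N: "x\<^sup>2 < real N" using reals_Archimedean2 by blast
    have "norm (cos (x / sqrt (real m)) ^ m - (1 + (- (x\<^sup>2 / 2)) / real m) ^ m) \<le> x ^ 4 / 24 * inverse (real m)"
      if m: "m \<ge> Suc N" for m
    proof -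
      let ?y = "x / sqrt (real m)" and ?w = "1 + (- (x\<^sup>2 / 2)) / real m"
      have m0: "real m > 0" "x\<^sup>2 \<le> real m" using m N by auto
      have y2: "?y\<^sup>2 = x\<^sup>2 / real m" using m0 by (simp add: power_divide)
      have y4: "?y ^ 4 = x ^ 4 / (real m)\<^sup>2"
      proof -
        have "?y ^ 4 = (?y\<^sup>2)\<^sup>2" by (simp flip: power_mult)
        also have "\<dots> = (x\<^sup>2)\<^sup>2 / (real m)\<^sup>2" unfolding y2 by (rule power_divide)
        finally show ?thesis by (simp flip: power_mult)
      qed
      have "x\<^sup>2 / real m \<le> 1" "x\<^sup>2 / real m \<ge> 0" using m0 by auto
      hence "norm ?w \<le> 1" by simp
      hence "norm (cos ?y ^ m - ?w ^ m) \<le> real m * norm (cos ?y - ?w)"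
        by (intro norm_power_diff) auto
      also have "cos ?y - ?w = cos ?y - (1 - ?y\<^sup>2 / 2)" using y2 by simp
      also have "real m * norm (cos ?y - (1 - ?y\<^sup>2 / 2)) \<le> real m * (?y ^ 4 / 24)"
        using cos_quadratic_error[of ?y] by (intro mult_left_mono) auto
      also have "\<dots> = x ^ 4 / 24 * inverse (real m)"
        unfolding y4 using m0 by (simp add: power2_eq_square field_simps)
      finally show ?thesis .
    qed
    thus "\<forall>\<^sub>F m in sequentially. norm (cos (x / sqrt (real m)) ^ m - (1 + (- (x\<^sup>2 / 2)) / real m) ^ m)
        \<le> x ^ 4 / 24 * inverse (real m)" unfolding eventually_sequentially by blast
  qed
  from tendsto_add[OF this lim] show ?thesis by simp
qed

definition trig_poly :: "nat \<Rightarrow> (nat \<Rightarrow> 'a::real_normed_vector) \<Rightarrow> (nat \<Rightarrow> 'a) \<Rightarrow> real \<Rightarrow> 'a" where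
  "trig_poly N a b \<theta> = (\<Sum>j\<le>N. cos (real j * \<theta>) *\<^sub>R a j + sin (real j * \<theta>) *\<^sub>R b j)"

definition heat :: "nat \<Rightarrow> (nat \<Rightarrow> 'a::real_normed_vector) \<Rightarrow> (nat \<Rightarrow> 'a) \<Rightarrow> real \<Rightarrow> real \<Rightarrow> 'a" where
  "heat N a b \<tau> = trig_poly N (\<lambda>j. exp (- ((real j)\<^sup>2 * \<tau>)) *\<^sub>R a j) (\<lambda>j. exp (- ((real j)\<^sup>2 * \<tau>)) *\<^sub>R b j)"

lemma heat_0: "heat N a b 0 = trig_poly N a b"
  by (simp add: heat_def)

lemma trig_poly_periodic: "trig_poly N a b (\<theta> + 2 * pi) = trig_poly N a b \<theta>"
proof -
  have "cos (real j * (\<theta> + 2 * pi)) = cos (real j * \<theta>)" "sin (real j * (\<theta> + 2 * pi)) = sin (real j * \<theta>)" for j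
    using cos_int_2pin[of "int j"] sin_int_2pin[of "int j"]
    by (simp_all add: distrib_left cos_add sin_add mult.commute mult.left_commute)
  thus ?thesis unfolding trig_poly_def by simp
qed

lemma trig_poly_derivative:
  "(trig_poly N a b has_vector_derivative
    trig_poly N (\<lambda>j. real j *\<^sub>R b j) (\<lambda>j. - (real j *\<^sub>R a j)) \<theta>) (at \<theta>)"
proof -
  have "((\<lambda>\<theta>. cos (real j * \<theta>) *\<^sub>R a j + sin (real j * \<theta>) *\<^sub>R b j) has_vector_derivative
     cos (real j * \<theta>) *\<^sub>R real j *\<^sub>R b j + sin (real j * \<theta>) *\<^sub>R - (real j *\<^sub>R a j)) (at \<theta>)" for j
    by (auto intro!: derivative_eq_intros simp: has_real_derivative_iff_has_vector_derivative[symmetric] algebra_simps)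
  hence "((\<lambda>\<theta>. \<Sum>j\<le>N. cos (real j * \<theta>) *\<^sub>R a j + sin (real j * \<theta>) *\<^sub>R b j) has_vector_derivative
     (\<Sum>j\<le>N. cos (real j * \<theta>) *\<^sub>R real j *\<^sub>R b j + sin (real j * \<theta>) *\<^sub>R - (real j *\<^sub>R a j))) (at \<theta>)"
    by (intro has_vector_derivative_sum)
  thus ?thesis unfolding trig_poly_def[abs_def] .
qed

lemma heat_equation:
  "((\<lambda>\<tau>. heat N a b \<tau> \<theta>) has_vector_derivative
    trig_poly N (\<lambda>j. - ((real j)\<^sup>2 *\<^sub>R exp (- ((real j)\<^sup>2 * \<tau>)) *\<^sub>R a j))
      (\<lambda>j. - ((real j)\<^sup>2 *\<^sub>R exp (- ((real j)\<^sup>2 * \<tau>)) *\<^sub>R b j)) \<theta>) (at \<tau>)"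
proof -
  have "((\<lambda>\<tau>. cos (real j * \<theta>) *\<^sub>R exp (- ((real j)\<^sup>2 * \<tau>)) *\<^sub>R a j + sin (real j * \<theta>) *\<^sub>R exp (- ((real j)\<^sup>2 * \<tau>)) *\<^sub>R b j)
     has_vector_derivative
     cos (real j * \<theta>) *\<^sub>R - ((real j)\<^sup>2 *\<^sub>R exp (- ((real j)\<^sup>2 * \<tau>)) *\<^sub>R a j) +
     sin (real j * \<theta>) *\<^sub>R - ((real j)\<^sup>2 *\<^sub>R exp (- ((real j)\<^sup>2 * \<tau>)) *\<^sub>R b j)) (at \<tau>)" for j
    by (auto intro!: derivative_eq_intros simp: has_real_derivative_iff_has_vector_derivative[symmetric] algebra_simps)
  hence "((\<lambda>\<tau>. \<Sum>j\<le>N. cos (real j * \<theta>) *\<^sub>R exp (- ((real j)\<^sup>2 * \<tau>)) *\<^sub>R a j + sin (real j * \<theta>) *\<^sub>R exp (- ((real j)\<^sup>2 * \<tau>)) *\<^sub>R b j)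
     has_vector_derivative
     (\<Sum>j\<le>N. cos (real j * \<theta>) *\<^sub>R - ((real j)\<^sup>2 *\<^sub>R exp (- ((real j)\<^sup>2 * \<tau>)) *\<^sub>R a j) +
     sin (real j * \<theta>) *\<^sub>R - ((real j)\<^sup>2 *\<^sub>R exp (- ((real j)\<^sup>2 * \<tau>)) *\<^sub>R b j))) (at \<tau>)"
    by (intro has_vector_derivative_sum)
  thus ?thesis unfolding trig_poly_def heat_def .
qed

definition lipschitz_curve :: "real \<Rightarrow> (real \<Rightarrow> 'a::real_normed_vector) \<Rightarrow> bool" where
  "lipschitz_curve l \<gamma> \<longleftrightarrow> (\<forall>\<theta> \<phi>. norm (\<gamma> \<theta> - \<gamma> \<phi>) \<le> l * \<bar>\<theta> - \<phi>\<bar>)"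

lemma lipschitz_curve_average:
  assumes "lipschitz_curve l \<gamma>"
  shows "lipschitz_curve l (\<lambda>\<theta>. (1/2) *\<^sub>R (\<gamma> (\<theta> + \<delta>) + \<gamma> (\<theta> - \<delta>)))"
  unfolding lipschitz_curve_def
proof (intro allI)
  fix \<theta> \<phi>
  have "norm ((1/2) *\<^sub>R (\<gamma> (\<theta> + \<delta>) + \<gamma> (\<theta> - \<delta>)) - (1/2) *\<^sub>R (\<gamma> (\<phi> + \<delta>) + \<gamma> (\<phi> - \<delta>)))
      = (1/2) * norm ((\<gamma> (\<theta> + \<delta>) - \<gamma> (\<phi> + \<delta>)) + (\<gamma> (\<theta> - \<delta>) - \<gamma> (\<phi> - \<delta>)))"
  proof -
    have "(1/2) *\<^sub>R (\<gamma> (\<theta> + \<delta>) + \<gamma> (\<theta> - \<delta>)) - (1/2) *\<^sub>R (\<gamma> (\<phi> + \<delta>) + \<gamma> (\<phi> - \<delta>))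
      = (1/2) *\<^sub>R ((\<gamma> (\<theta> + \<delta>) - \<gamma> (\<phi> + \<delta>)) + (\<gamma> (\<theta> - \<delta>) - \<gamma> (\<phi> - \<delta>)))"
      by (simp add: scaleR_add_right scaleR_diff_right)
    thus ?thesis by (metis abs_of_pos half_gt_zero_iff norm_scaleR zero_less_one)
  qed
  also have "\<dots> \<le> (1/2) * (l * \<bar>\<theta> - \<phi>\<bar> + l * \<bar>\<theta> - \<phi>\<bar>)"
  proof (intro mult_left_mono norm_triangle_le add_mono)
    show "norm (\<gamma> (\<theta> + \<delta>) - \<gamma> (\<phi> + \<delta>)) \<le> l * \<bar>\<theta> - \<phi>\<bar>"
      using assms[unfolded lipschitz_curve_def, rule_format, of "\<theta> + \<delta>" "\<phi> + \<delta>"] by simp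
    show "norm (\<gamma> (\<theta> - \<delta>) - \<gamma> (\<phi> - \<delta>)) \<le> l * \<bar>\<theta> - \<phi>\<bar>"
      using assms[unfolded lipschitz_curve_def, rule_format, of "\<theta> - \<delta>" "\<phi> - \<delta>"] by simp
  qed simp
  finally show "norm ((1/2) *\<^sub>R (\<gamma> (\<theta> + \<delta>) + \<gamma> (\<theta> - \<delta>)) - (1/2) *\<^sub>R (\<gamma> (\<phi> + \<delta>) + \<gamma> (\<phi> - \<delta>))) \<le> l * \<bar>\<theta> - \<phi>\<bar>"
    by simp
qed

lemma trig_poly_average:
  "(1/2) *\<^sub>R (trig_poly N a b (\<theta> + \<delta>) + trig_poly N a b (\<theta> - \<delta>)) =
    trig_poly N (\<lambda>j. cos (real j * \<delta>) *\<^sub>R a j) (\<lambda>j. cos (real j * \<delta>) *\<^sub>R b j) \<theta>"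
  unfolding trig_poly_def sum.distrib[symmetric] scaleR_sum_right
proof (rule sum.cong[OF refl])
  fix j
  have c: "cos (real j * (\<theta> + \<delta>)) + cos (real j * (\<theta> - \<delta>)) = 2 * (cos (real j * \<theta>) * cos (real j * \<delta>))"
    and s: "sin (real j * (\<theta> + \<delta>)) + sin (real j * (\<theta> - \<delta>)) = 2 * (sin (real j * \<theta>) * cos (real j * \<delta>))"
    by (simp_all add: distrib_left right_diff_distrib cos_add cos_diff sin_add sin_diff)
  have "(1/2) *\<^sub>R (cos (real j * (\<theta> + \<delta>)) *\<^sub>R a j + sin (real j * (\<theta> + \<delta>)) *\<^sub>R b j +
      (cos (real j * (\<theta> - \<delta>)) *\<^sub>R a j + sin (real j * (\<theta> - \<delta>)) *\<^sub>R b j)) =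
    (1/2) *\<^sub>R ((cos (real j * (\<theta> + \<delta>)) + cos (real j * (\<theta> - \<delta>))) *\<^sub>R a j +
      (sin (real j * (\<theta> + \<delta>)) + sin (real j * (\<theta> - \<delta>))) *\<^sub>R b j)"
    by (simp add: scaleR_add_left add_ac)
  thus "(1/2) *\<^sub>R (cos (real j * (\<theta> + \<delta>)) *\<^sub>R a j + sin (real j * (\<theta> + \<delta>)) *\<^sub>R b j +
      (cos (real j * (\<theta> - \<delta>)) *\<^sub>R a j + sin (real j * (\<theta> - \<delta>)) *\<^sub>R b j)) =
    cos (real j * \<theta>) *\<^sub>R cos (real j * \<delta>) *\<^sub>R a j + sin (real j * \<theta>) *\<^sub>R cos (real j * \<delta>) *\<^sub>R b j"
    unfolding c s by (simp add: scaleR_add_right)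
qed

lemma lipschitz_curve_iterated_average:
  assumes "lipschitz_curve l (trig_poly N a b)"
  shows "lipschitz_curve l (trig_poly N (\<lambda>j. cos (real j * \<delta>) ^ m *\<^sub>R a j) (\<lambda>j. cos (real j * \<delta>) ^ m *\<^sub>R b j))"
proof (induction m)
  case 0 thus ?case using assms by simp
next
  case (Suc m)
  from lipschitz_curve_average[OF this, of \<delta>] show ?case
    unfolding trig_poly_average by (simp add: mult.commute)
qed

text \<open>Averages do not increase a Lipschitz constant.  Iterating \<open>m\<close> times the average with step
  \<open>sqrt (2 \<tau> / m)\<close> and letting \<open>m\<close> tend to infinity gives the heat flow at time \<open>\<tau>\<close>.\<close>

lemma lipschitz_curve_heat:
  assumes "lipschitz_curve l (trig_poly N a b)" "\<tau> \<ge> 0"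
  shows "lipschitz_curve l (heat N a b \<tau>)"
  unfolding lipschitz_curve_def
proof (intro allI)
  fix \<theta> \<phi>
  define P where "P m = trig_poly N (\<lambda>j. cos (real j * (sqrt (2 * \<tau>) / sqrt (real m))) ^ m *\<^sub>R a j)
      (\<lambda>j. cos (real j * (sqrt (2 * \<tau>) / sqrt (real m))) ^ m *\<^sub>R b j)" for m
  have c: "(\<lambda>m. cos (real j * (sqrt (2 * \<tau>) / sqrt (real m))) ^ m) \<longlonglongrightarrow> exp (- ((real j)\<^sup>2 * \<tau>))" for j
    using cos_power_tendsto_exp[of "real j * sqrt (2 * \<tau>)"] assms(2) by (simp add: power_mult_distrib)
  have lim: "(\<lambda>m. P m \<theta>) \<longlonglongrightarrow> heat N a b \<tau> \<theta>" for \<theta>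
    unfolding P_def heat_def trig_poly_def by (intro tendsto_intros c)
  have "(\<lambda>m. norm (P m \<theta> - P m \<phi>)) \<longlonglongrightarrow> norm (heat N a b \<tau> \<theta> - heat N a b \<tau> \<phi>)"
    by (intro tendsto_intros lim)
  moreover have "\<forall>\<^sub>F m in sequentially. norm (P m \<theta> - P m \<phi>) \<le> l * \<bar>\<theta> - \<phi>\<bar>"
    using lipschitz_curve_iterated_average[OF assms(1)] unfolding P_def lipschitz_curve_def
    by (intro always_eventually allI) blast
  ultimately show "norm (heat N a b \<tau> \<theta> - heat N a b \<tau> \<phi>) \<le> l * \<bar>\<theta> - \<phi>\<bar>"
    by (rule tendsto_upperbound) simp
qed

lemma lipschitz_curve_derivative:
  assumes "lipschitz_curve l \<gamma>" "(\<gamma> has_vector_derivative d) (at \<theta>)"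
  shows "norm d \<le> l"
proof -
  have "((\<lambda>y. (1 / norm (y - \<theta>)) *\<^sub>R (\<gamma> y - (\<gamma> \<theta> + (y - \<theta>) *\<^sub>R d))) \<longlongrightarrow> 0) (at \<theta>)"
    using assms(2) unfolding has_vector_derivative_def has_derivative_within by (rule conjunct2)
  hence "((\<lambda>y. norm ((1 / norm (y - \<theta>)) *\<^sub>R (\<gamma> y - (\<gamma> \<theta> + (y - \<theta>) *\<^sub>R d)))) \<longlongrightarrow> 0) (at \<theta>)"
    by (rule tendsto_norm_zero)
  moreover have "\<forall>\<^sub>F y in at \<theta>. norm d - l \<le> norm ((1 / norm (y - \<theta>)) *\<^sub>R (\<gamma> y - (\<gamma> \<theta> + (y - \<theta>) *\<^sub>R d)))"
    unfolding eventually_at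
  proof (intro exI[of _ 1] conjI ballI impI zero_less_one)
    fix y assume y: "y \<noteq> \<theta> \<and> dist y \<theta> < 1"
    have "\<bar>y - \<theta>\<bar> * norm d \<le> norm (\<gamma> y - (\<gamma> \<theta> + (y - \<theta>) *\<^sub>R d)) + norm (\<gamma> y - \<gamma> \<theta>)"
    proof -
      have "\<bar>y - \<theta>\<bar> * norm d = norm ((\<gamma> y - \<gamma> \<theta>) - (\<gamma> y - (\<gamma> \<theta> + (y - \<theta>) *\<^sub>R d)))" by simp
      thus ?thesis using norm_triangle_ineq4[of "\<gamma> y - \<gamma> \<theta>" "\<gamma> y - (\<gamma> \<theta> + (y - \<theta>) *\<^sub>R d)"]
        by linarith
    qed
    also have "norm (\<gamma> y - \<gamma> \<theta>) \<le> l * \<bar>y - \<theta>\<bar>" using assms(1) unfolding lipschitz_curve_def by blast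
    finally have "\<bar>y - \<theta>\<bar> * (norm d - l) \<le> norm (\<gamma> y - (\<gamma> \<theta> + (y - \<theta>) *\<^sub>R d))"
      by (simp add: right_diff_distrib mult.commute)
    hence "norm d - l \<le> norm (\<gamma> y - (\<gamma> \<theta> + (y - \<theta>) *\<^sub>R d)) / \<bar>y - \<theta>\<bar>"
      using y by (subst pos_le_divide_eq) (auto simp: mult.commute)
    thus "norm d - l \<le> norm ((1 / norm (y - \<theta>)) *\<^sub>R (\<gamma> y - (\<gamma> \<theta> + (y - \<theta>) *\<^sub>R d)))"
      by (simp only: norm_scaleR) simp
  qed
  ultimately have "norm d - l \<le> 0" by (intro tendsto_lowerbound) auto
  thus ?thesis by simp
qed


section \<open>Length and energy of trigonometric polynomials\<close>

lemma has_integral_cos_int: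
  "((\<lambda>\<theta>. cos (of_int k * \<theta>)) has_integral (if k = 0 then 2 * pi else 0)) period"
proof (cases "k = 0")
  case True
  thus ?thesis using has_integral_const_real[of "1::real" 0 "2 * pi"] by simp
next
  case False
  have "((\<lambda>\<theta>. cos (of_int k * \<theta>)) has_integral
     (sin (of_int k * (2 * pi)) / of_int k - sin (of_int k * 0) / of_int k)) period"
  proof (rule fundamental_theorem_of_calculus)
    show "((\<lambda>\<theta>. sin (of_int k * \<theta>) / of_int k) has_vector_derivative cos (of_int k * x)) (at x within period)" for x
      unfolding has_real_derivative_iff_has_vector_derivative[symmetric]
      using False by (auto intro!: derivative_eq_intros)
  qed simp
  thus ?thesis using False sin_int_2pin[of k] by (simp add: mult.commute mult.left_commute)
qed

lemma has_integral_sin_int: "((\<lambda>\<theta>. sin (of_int k * \<theta>)) has_integral 0) period"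
proof (cases "k = 0")
  case False
  have "((\<lambda>\<theta>. sin (of_int k * \<theta>)) has_integral
     (- cos (of_int k * (2 * pi)) / of_int k - - cos (of_int k * 0) / of_int k)) period"
  proof (rule fundamental_theorem_of_calculus)
    show "((\<lambda>\<theta>. - cos (of_int k * \<theta>) / of_int k) has_vector_derivative sin (of_int k * x)) (at x within period)" for x
      unfolding has_real_derivative_iff_has_vector_derivative[symmetric]
      using False by (auto intro!: derivative_eq_intros)
  qed simp
  thus ?thesis using False cos_int_2pin[of k] by (simp add: mult.commute mult.left_commute)
qed simp

lemma has_integral_products:
  fixes j k :: nat
  assumes "j > 0" "k > 0"
  shows "((\<lambda>\<theta>. cos (real j * \<theta>) * cos (real k * \<theta>)) has_integral (if j = k then pi else 0)) period"
    "((\<lambda>\<theta>. sin (real j * \<theta>) * sin (real k * \<theta>)) has_integral (if j = k then pi else 0)) period"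
    "((\<lambda>\<theta>. sin (real j * \<theta>) * cos (real k * \<theta>)) has_integral 0) period"
proof -
  let ?c = "\<lambda>k \<theta>. cos (real_of_int k * \<theta>)" and ?s = "\<lambda>k \<theta>. sin (real_of_int k * \<theta>)"
  have cd: "((\<lambda>\<theta>. ?c (int j - int k) \<theta>) has_integral (if j = k then 2 * pi else 0)) period"
    using has_integral_cos_int[of "int j - int k"] by simp
  have ca: "((\<lambda>\<theta>. ?c (int j + int k) \<theta>) has_integral 0) period"
    using has_integral_cos_int[of "int j + int k"] assms by simp
  have "((\<lambda>\<theta>. (1/2) * (?c (int j - int k) \<theta> + ?c (int j + int k) \<theta>)) has_integral (1/2) * ((if j = k then 2 * pi else 0) + 0)) period"
    by (intro has_integral_mult_right has_integral_add cd ca)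
  moreover have "(1/2) * (?c (int j - int k) \<theta> + ?c (int j + int k) \<theta>) = cos (real j * \<theta>) * cos (real k * \<theta>)" for \<theta>
    by (simp add: cos_add cos_diff left_diff_distrib distrib_right)
  moreover have "(1/2) * ((if j = k then 2 * pi else 0) + 0) = (if j = k then pi else 0)" by simp
  ultimately show "((\<lambda>\<theta>. cos (real j * \<theta>) * cos (real k * \<theta>)) has_integral (if j = k then pi else 0)) period"
    by (simp only:)
  have "((\<lambda>\<theta>. (1/2) * (?c (int j - int k) \<theta> - ?c (int j + int k) \<theta>)) has_integral (1/2) * ((if j = k then 2 * pi else 0) - 0)) period"
    by (intro has_integral_mult_right has_integral_diff cd ca)
  moreover have "(1/2) * (?c (int j - int k) \<theta> - ?c (int j + int k) \<theta>) = sin (real j * \<theta>) * sin (real k * \<theta>)" for \<theta>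
    by (simp add: cos_add cos_diff left_diff_distrib distrib_right)
  moreover have "(1/2) * ((if j = k then 2 * pi else 0) - 0) = (if j = k then pi else 0)" by simp
  ultimately show "((\<lambda>\<theta>. sin (real j * \<theta>) * sin (real k * \<theta>)) has_integral (if j = k then pi else 0)) period"
    by (simp only:)
  have "((\<lambda>\<theta>. (1/2) * (?s (int j + int k) \<theta> + ?s (int j - int k) \<theta>)) has_integral (1/2) * (0 + 0)) period"
    by (intro has_integral_mult_right has_integral_add has_integral_sin_int)
  moreover have "(1/2) * (?s (int j + int k) \<theta> + ?s (int j - int k) \<theta>) = sin (real j * \<theta>) * cos (real k * \<theta>)" for \<theta>
    by (simp add: sin_add sin_diff left_diff_distrib distrib_right)
  ultimately show "((\<lambda>\<theta>. sin (real j * \<theta>) * cos (real k * \<theta>)) has_integral 0) period"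
    by simp
qed

lemma parseval_trig_poly:
  fixes a b :: "nat \<Rightarrow> 'a::euclidean_space"
  assumes "a 0 = 0"
  shows "((\<lambda>\<theta>. (norm (trig_poly N a b \<theta>))\<^sup>2) has_integral pi * (\<Sum>j=1..N. (norm (a j))\<^sup>2 + (norm (b j))\<^sup>2)) period"
proof -
  let ?c = "\<lambda>j \<theta>. cos (real j * \<theta>)" and ?s = "\<lambda>j \<theta>. sin (real j * \<theta>)"
  have eq: "trig_poly N a b \<theta> = (\<Sum>j=1..N. ?c j \<theta> *\<^sub>R a j + ?s j \<theta> *\<^sub>R b j)" for \<theta>
    unfolding trig_poly_def using assms
    by (intro sum.mono_neutral_right) (auto simp: Suc_le_eq)
  have expand: "(norm (trig_poly N a b \<theta>))\<^sup>2 = (\<Sum>j=1..N. \<Sum>k=1..N.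
      (?c j \<theta> * ?c k \<theta>) * (a j \<bullet> a k) + (?s k \<theta> * ?c j \<theta>) * (a j \<bullet> b k) +
      (?s j \<theta> * ?c k \<theta>) * (b j \<bullet> a k) + (?s j \<theta> * ?s k \<theta>) * (b j \<bullet> b k))" for \<theta>
    unfolding power2_norm_eq_inner eq inner_sum_left inner_sum_right
    by (subst sum.swap, intro sum.cong refl) (simp add: inner_add_left inner_add_right algebra_simps)
  have "((\<lambda>\<theta>. \<Sum>j=1..N. \<Sum>k=1..N.
      (?c j \<theta> * ?c k \<theta>) * (a j \<bullet> a k) + (?s k \<theta> * ?c j \<theta>) * (a j \<bullet> b k) +
      (?s j \<theta> * ?c k \<theta>) * (b j \<bullet> a k) + (?s j \<theta> * ?s k \<theta>) * (b j \<bullet> b k)) has_integral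
      (\<Sum>j=1..N. \<Sum>k=1..N. (if j = k then pi else 0) * (a j \<bullet> a k) + 0 * (a j \<bullet> b k) + 0 * (b j \<bullet> a k)
        + (if j = k then pi else 0) * (b j \<bullet> b k))) period"
    by (intro has_integral_sum finite_atLeastAtMost has_integral_add has_integral_mult_left has_integral_products) auto
  also have "(\<Sum>j=1..N. \<Sum>k=1..N. (if j = k then pi else 0) * (a j \<bullet> a k) + 0 * (a j \<bullet> b k) + 0 * (b j \<bullet> a k)
        + (if j = k then pi else 0) * (b j \<bullet> b k)) =
      (\<Sum>j=1..N. \<Sum>k=1..N. if j = k then pi * ((norm (a j))\<^sup>2 + (norm (b j))\<^sup>2) else 0)"
    by (intro sum.cong refl) (auto simp: power2_norm_eq_inner algebra_simps)
  also have "\<dots> = pi * (\<Sum>j=1..N. (norm (a j))\<^sup>2 + (norm (b j))\<^sup>2)"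
    unfolding sum_distrib_left by (intro sum.cong refl) simp
  finally show ?thesis unfolding expand .
qed

text \<open>The Cauchy-Schwarz inequality with the constant function, from the nonnegativity of the
  variance.\<close>

lemma integral_power2_le:
  fixes f :: "real \<Rightarrow> real"
  assumes "continuous_on {a..b} f" "a < b"
  shows "(integral {a..b} f)\<^sup>2 \<le> (b - a) * integral {a..b} (\<lambda>x. (f x)\<^sup>2)"
proof -
  define m where "m = integral {a..b} f / (b - a)"
  have i1: "f integrable_on {a..b}" and i2: "(\<lambda>x. (f x)\<^sup>2) integrable_on {a..b}"
    using assms(1) by (auto intro!: integrable_continuous_interval continuous_intros)
  have "0 \<le> integral {a..b} (\<lambda>x. (f x - m)\<^sup>2)"
    using assms(1) by (intro integral_nonneg integrable_continuous_interval continuous_intros) auto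
  also have "(\<lambda>x. (f x - m)\<^sup>2) = (\<lambda>x. (f x)\<^sup>2 - 2 * m * f x + m\<^sup>2)"
    by (auto simp: power2_eq_square algebra_simps)
  also have "integral {a..b} \<dots> = integral {a..b} (\<lambda>x. (f x)\<^sup>2) - 2 * m * integral {a..b} f + (b - a) * m\<^sup>2"
  proof (rule integral_unique)
    have c: "((\<lambda>x. m\<^sup>2) has_integral (b - a) * m\<^sup>2) {a..b}"
      using has_integral_const_real[of "m\<^sup>2" a b] assms(2) by simp
    show "((\<lambda>x. (f x)\<^sup>2 - 2 * m * f x + m\<^sup>2) has_integral
        integral {a..b} (\<lambda>x. (f x)\<^sup>2) - 2 * m * integral {a..b} f + (b - a) * m\<^sup>2) {a..b}"
      by (intro has_integral_add has_integral_diff has_integral_mult_right integrable_integral i1 i2 c)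
  qed
  finally have "0 \<le> (b - a) * (integral {a..b} (\<lambda>x. (f x)\<^sup>2) - 2 * m * integral {a..b} f + (b - a) * m\<^sup>2)"
    using assms(2) by simp
  also have "\<dots> = (b - a) * integral {a..b} (\<lambda>x. (f x)\<^sup>2) - (integral {a..b} f)\<^sup>2"
  proof -
    have I: "integral {a..b} f = m * (b - a)" using assms(2) by (simp add: m_def)
    show ?thesis unfolding I by (simp add: power2_eq_square algebra_simps)
  qed
  finally show ?thesis by simp
qed

definition trig_length :: "nat \<Rightarrow> (nat \<Rightarrow> 'a::euclidean_space) \<Rightarrow> (nat \<Rightarrow> 'a) \<Rightarrow> real" where
  "trig_length N a b = integral period
     (\<lambda>\<theta>. norm (trig_poly N (\<lambda>j. real j *\<^sub>R b j) (\<lambda>j. - (real j *\<^sub>R a j)) \<theta>))"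

definition trig_energy :: "nat \<Rightarrow> (nat \<Rightarrow> 'a::euclidean_space) \<Rightarrow> (nat \<Rightarrow> 'a) \<Rightarrow> real" where
  "trig_energy N a b = pi * (\<Sum>j=1..N. (real j)\<^sup>2 * ((norm (a j))\<^sup>2 + (norm (b j))\<^sup>2))"

lemma continuous_trig_poly: "continuous_on S (trig_poly N a b)"
  unfolding trig_poly_def by (intro continuous_intros)

lemma has_integral_trig_energy:
  fixes a b :: "nat \<Rightarrow> 'a::euclidean_space"
  shows "((\<lambda>\<theta>. (norm (trig_poly N (\<lambda>j. real j *\<^sub>R b j) (\<lambda>j. - (real j *\<^sub>R a j)) \<theta>))\<^sup>2) has_integral trig_energy N a b) period"
  using parseval_trig_poly[of "\<lambda>j. real j *\<^sub>R b j" N "\<lambda>j. - (real j *\<^sub>R a j)"]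
  by (simp add: trig_energy_def power_mult_distrib distrib_left add.commute)

lemma trig_length_le:
  "trig_length N a b \<le> sqrt (2 * pi * trig_energy N a b)"
proof (rule real_le_rsqrt)
  let ?d = "\<lambda>\<theta>. norm (trig_poly N (\<lambda>j. real j *\<^sub>R b j) (\<lambda>j. - (real j *\<^sub>R a j)) \<theta>)"
  have "(integral period ?d)\<^sup>2 \<le> (2 * pi - 0) * integral period (\<lambda>\<theta>. (?d \<theta>)\<^sup>2)"
    by (intro integral_power2_le continuous_intros continuous_trig_poly) simp
  also have "integral period (\<lambda>\<theta>. (?d \<theta>)\<^sup>2) = trig_energy N a b"
    by (rule integral_unique[OF has_integral_trig_energy])
  finally show "(trig_length N a b)\<^sup>2 \<le> 2 * pi * trig_energy N a b" unfolding trig_length_def by simp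
qed

text \<open>Every frequency that contributes to the energy decays at least as fast as the frequency 1.  This
  is Wirtinger's inequality in terms of Fourier coefficients.\<close>

lemma trig_energy_heat:
  fixes a b :: "nat \<Rightarrow> 'a::euclidean_space"
  assumes "\<tau> \<ge> 0"
  shows "trig_energy N (\<lambda>j. exp (- ((real j)\<^sup>2 * \<tau>)) *\<^sub>R a j) (\<lambda>j. exp (- ((real j)\<^sup>2 * \<tau>)) *\<^sub>R b j)
    \<le> exp (- (2 * \<tau>)) * trig_energy N a b"
proof -
  have "(real j)\<^sup>2 * ((norm (exp (- ((real j)\<^sup>2 * \<tau>)) *\<^sub>R a j))\<^sup>2 + (norm (exp (- ((real j)\<^sup>2 * \<tau>)) *\<^sub>R b j))\<^sup>2)
      \<le> exp (- (2 * \<tau>)) * ((real j)\<^sup>2 * ((norm (a j))\<^sup>2 + (norm (b j))\<^sup>2))" if "j \<ge> 1" for j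
  proof -
    have "(exp (- ((real j)\<^sup>2 * \<tau>)))\<^sup>2 = exp (- (2 * ((real j)\<^sup>2 * \<tau>)))"
      by (simp add: power2_eq_square exp_add[symmetric])
    also have "\<dots> \<le> exp (- (2 * \<tau>))"
    proof -
      have "1 \<le> (real j)\<^sup>2" using that by (simp add: one_le_power)
      hence "1 * \<tau> \<le> (real j)\<^sup>2 * \<tau>" using assms by (rule mult_right_mono)
      thus ?thesis by simp
    qed
    finally have "(exp (- ((real j)\<^sup>2 * \<tau>)))\<^sup>2 * ((real j)\<^sup>2 * ((norm (a j))\<^sup>2 + (norm (b j))\<^sup>2))
       \<le> exp (- (2 * \<tau>)) * ((real j)\<^sup>2 * ((norm (a j))\<^sup>2 + (norm (b j))\<^sup>2))"
      by (rule mult_right_mono) simp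
    thus ?thesis by (simp add: power_mult_distrib algebra_simps)
  qed
  hence "(\<Sum>j=1..N. (real j)\<^sup>2 * ((norm (exp (- ((real j)\<^sup>2 * \<tau>)) *\<^sub>R a j))\<^sup>2 + (norm (exp (- ((real j)\<^sup>2 * \<tau>)) *\<^sub>R b j))\<^sup>2))
    \<le> (\<Sum>j=1..N. exp (- (2 * \<tau>)) * ((real j)\<^sup>2 * ((norm (a j))\<^sup>2 + (norm (b j))\<^sup>2)))"
    by (intro sum_mono) auto
  hence "pi * (\<Sum>j=1..N. (real j)\<^sup>2 * ((norm (exp (- ((real j)\<^sup>2 * \<tau>)) *\<^sub>R a j))\<^sup>2 + (norm (exp (- ((real j)\<^sup>2 * \<tau>)) *\<^sub>R b j))\<^sup>2))
    \<le> pi * (exp (- (2 * \<tau>)) * (\<Sum>j=1..N. (real j)\<^sup>2 * ((norm (a j))\<^sup>2 + (norm (b j))\<^sup>2)))"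
    unfolding sum_distrib_left[symmetric] by (rule mult_left_mono) simp
  thus ?thesis unfolding trig_energy_def by (simp add: mult.left_commute)
qed

lemma trig_energy_lipschitz:
  fixes a b :: "nat \<Rightarrow> 'a::euclidean_space"
  assumes "lipschitz_curve l (trig_poly N a b)"
  shows "trig_energy N a b \<le> 2 * pi * l\<^sup>2"
proof -
  let ?d = "\<lambda>\<theta>. norm (trig_poly N (\<lambda>j. real j *\<^sub>R b j) (\<lambda>j. - (real j *\<^sub>R a j)) \<theta>)"
  have "?d \<theta> \<le> l" for \<theta> by (rule lipschitz_curve_derivative[OF assms trig_poly_derivative])
  hence "(?d \<theta>)\<^sup>2 \<le> l\<^sup>2" for \<theta> by (intro power_mono) auto
  moreover have "((\<lambda>\<theta>. l\<^sup>2) has_integral 2 * pi * l\<^sup>2) period"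
    using has_integral_const_real[of "l\<^sup>2" 0 "2 * pi"] by simp
  ultimately show ?thesis using has_integral_le[OF has_integral_trig_energy[where N=N and a=a and b=b]] by blast
qed

section \<open>Smoothing with a positive trigonometric kernel\<close>

lemma integral_periodic_shift:
  fixes f :: "real \<Rightarrow> 'b::euclidean_space"
  assumes per: "periodic f" and cont: "continuous_on UNIV f"
  shows "integral {c - 2 * pi..c} f = integral period f"
proof -
  have int: "f integrable_on {a..b}" for a b
    using cont by (intro integrable_continuous_interval continuous_on_subset[OF cont]) auto
  \<comment> \<open>the integral over any period, as a function of its left end point, has derivative zero\<close>
  \<comment> \<open>The base point is far enough to the left for \<open>\<Phi>\<close> to be differentiable at all points used below.\<close>
  define \<Phi> where "\<Phi> x = integral {c - 100 - \<bar>c\<bar>..x} f" for x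
  have d\<Phi>: "(\<Phi> has_vector_derivative f x) (at x)" if "x > c - 100 - \<bar>c\<bar>" for x
  proof -
    have "(\<Phi> has_vector_derivative f x) (at x within {c - 100 - \<bar>c\<bar>..x + 1})"
      unfolding \<Phi>_def by (rule integral_has_vector_derivative) (use that in \<open>auto intro: continuous_on_subset[OF cont]\<close>)
    moreover have "x \<in> interior {c - 100 - \<bar>c\<bar>..x + 1}" using that by simp
    ultimately show ?thesis using at_within_interior by metis
  qed
  have pi4: "pi < 4" by (rule pi_less_4)
  define h where "h x = \<Phi> (x + 2 * pi) - \<Phi> x" for x
  have "(h has_vector_derivative 0) (at x within {c - 20 - \<bar>c\<bar>..20 + \<bar>c\<bar>})" if "x \<in> {c - 20 - \<bar>c\<bar>..20 + \<bar>c\<bar>}" for x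
  proof -
    have "((\<lambda>x. x + 2 * pi) has_vector_derivative 1) (at x)" by (auto intro!: derivative_eq_intros)
    moreover have "(\<Phi> has_vector_derivative f (x + 2 * pi)) (at (x + 2 * pi))"
    proof (rule d\<Phi>)
      show "c - 100 - \<bar>c\<bar> < x + 2 * pi" using that pi_gt_zero unfolding atLeastAtMost_iff by linarith
    qed
    ultimately have "((\<Phi> \<circ> (\<lambda>x. x + 2 * pi)) has_vector_derivative 1 *\<^sub>R f (x + 2 * pi)) (at x)"
      by (rule vector_diff_chain_at)
    moreover have "(\<Phi> has_vector_derivative f x) (at x)" using that by (intro d\<Phi>) auto
    ultimately have "(h has_vector_derivative 1 *\<^sub>R f (x + 2 * pi) - f x) (at x)"
      unfolding h_def[abs_def] o_def by (rule has_vector_derivative_diff)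
    thus ?thesis using per unfolding periodic_def by (simp add: has_vector_derivative_at_within)
  qed
  from has_vector_derivative_zero_constant[OF convex_real_interval(5) this]
  obtain k where k: "\<And>x. x \<in> {c - 20 - \<bar>c\<bar>..20 + \<bar>c\<bar>} \<Longrightarrow> h x = k" by metis
  have "c - 2 * pi \<in> {c - 20 - \<bar>c\<bar>..20 + \<bar>c\<bar>}" "0 \<in> {c - 20 - \<bar>c\<bar>..20 + \<bar>c\<bar>}"
    using pi4 pi_gt_zero unfolding atLeastAtMost_iff by linarith+
  hence "h (c - 2 * pi) = h 0" using k by metis
  moreover have hi: "h x = integral {x..x + 2 * pi} f" if x: "x \<ge> c - 100 - \<bar>c\<bar>" for x
  proof -
    have "integral {c - 100 - \<bar>c\<bar>..x} f + integral {x..x + 2 * pi} f = integral {c - 100 - \<bar>c\<bar>..x + 2 * pi} f"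
      by (rule Henstock_Kurzweil_Integration.integral_combine[OF x _ int]) simp
    thus ?thesis unfolding h_def \<Phi>_def by (simp add: algebra_simps)
  qed
  have "h (c - 2 * pi) = integral {c - 2 * pi..c} f" using hi[of "c - 2 * pi"] pi4 by simp
  moreover have "h 0 = integral period f" using hi[of 0] by simp
  ultimately show ?thesis by simp
qed

lemma integral_periodic_reflect:
  fixes f :: "real \<Rightarrow> 'b::euclidean_space"
  assumes per: "periodic f" and cont: "continuous_on UNIV f"
  shows "integral period (\<lambda>y. f (c - y)) = integral period f"
proof -
  have int: "f integrable_on {a..b}" for a b
    using cont by (intro integrable_continuous_interval continuous_on_subset[OF cont]) auto
  have "(f has_integral integral {c - 2 * pi..c} f) {c - 2 * pi..c}" by (rule integrable_integral[OF int])
  hence "((\<lambda>y. f (-1 * y + c)) has_integral (1 / \<bar>-1\<bar>) *\<^sub>R integral {c - 2 * pi..c} f) ((\<lambda>x. (1 / -1) * x + - ((1 / -1) * c)) ` {c - 2 * pi..c})"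
    using has_integral_affinity[of f _ "c - 2 * pi" c "-1" c] by (simp add: cbox_interval)
  moreover have "((\<lambda>x. (1 / -1) * x + - ((1 / -1) * c)) ` {c - 2 * pi..c}) = period"
  proof -
    have "(\<lambda>x. (1 / -1) * x + - ((1 / -1) * c)) = (\<lambda>x. c - x)" by auto
    thus ?thesis by simp
  qed
  ultimately have "((\<lambda>y. f (c - y)) has_integral integral {c - 2 * pi..c} f) period" by simp
  thus ?thesis using integral_periodic_shift[OF assms] by (simp add: integral_unique)
qed

definition cos_poly :: "nat \<Rightarrow> (real \<Rightarrow> real) \<Rightarrow> bool" where
  "cos_poly N f \<longleftrightarrow> (\<exists>w. \<forall>y. f y = (\<Sum>j\<le>N. w j * cos (real j * y)))"

lemma cos_poly_cos: "j \<le> N \<Longrightarrow> cos_poly N (\<lambda>y. cos (real j * y))"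
proof -
  assume "j \<le> N"
  have "cos (real j * y) = (\<Sum>i\<le>N. (if i = j then 1 else 0) * cos (real i * y))" for y
  proof -
    have "(\<Sum>i\<le>N. (if i = j then 1 else 0) * cos (real i * y)) = (\<Sum>i\<le>N. if i = j then cos (real j * y) else 0)"
      by (intro sum.cong) auto
    thus ?thesis using \<open>j \<le> N\<close> by simp
  qed
  thus ?thesis unfolding cos_poly_def by (intro exI[of _ "\<lambda>i. if i = j then 1 else 0"]) blast
qed

lemma cos_poly_add: "cos_poly N f \<Longrightarrow> cos_poly N g \<Longrightarrow> cos_poly N (\<lambda>y. f y + g y)"
  unfolding cos_poly_def
proof (elim exE)
  fix v w assume "\<forall>y. f y = (\<Sum>j\<le>N. v j * cos (real j * y))" "\<forall>y. g y = (\<Sum>j\<le>N. w j * cos (real j * y))"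
  hence "\<forall>y. f y + g y = (\<Sum>j\<le>N. (v j + w j) * cos (real j * y))" by (simp add: sum.distrib distrib_right)
  thus "\<exists>w. \<forall>y. f y + g y = (\<Sum>j\<le>N. w j * cos (real j * y))"
    by (rule exI[of _ "\<lambda>j. v j + w j"])
qed

lemma cos_poly_scale: "cos_poly N f \<Longrightarrow> cos_poly N (\<lambda>y. c * f y)"
  unfolding cos_poly_def
proof (elim exE)
  fix w assume "\<forall>y. f y = (\<Sum>j\<le>N. w j * cos (real j * y))"
  hence "\<forall>y. c * f y = (\<Sum>j\<le>N. (c * w j) * cos (real j * y))" by (simp add: sum_distrib_left mult.assoc)
  thus "\<exists>w. \<forall>y. c * f y = (\<Sum>j\<le>N. w j * cos (real j * y))"
    by (rule exI[of _ "\<lambda>j. c * w j"])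
qed

lemma cos_poly_sum: "finite A \<Longrightarrow> (\<And>i. i \<in> A \<Longrightarrow> cos_poly N (f i)) \<Longrightarrow> cos_poly N (\<lambda>y. \<Sum>i\<in>A. f i y)"
proof (induction A rule: finite_induct)
  case empty
  show ?case using cos_poly_scale[OF cos_poly_cos[of 0 N], of 0] by simp
next
  case (insert a A)
  have "cos_poly N (\<lambda>y. f a y + (\<Sum>i\<in>A. f i y))" by (rule cos_poly_add) (use insert in auto)
  thus ?case using insert by simp
qed

text \<open>The de la Vallee-Poussin kernel, up to normalization: a nonnegative trigonometric polynomial that
  concentrates at the multiples of \<open>2 \<pi>\<close> as \<open>N\<close> grows.\<close>

definition bump :: "nat \<Rightarrow> real \<Rightarrow> real" where
  "bump N y = ((1 + cos y) / 2) ^ N"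

lemma cos_poly_bump: "cos_poly N (bump N)"
proof (induction N)
  case 0 show ?case using cos_poly_cos[of 0 0] by (simp add: bump_def)
next
  case (Suc N)
  then obtain w where w: "\<And>y. bump N y = (\<Sum>j\<le>N. w j * cos (real j * y))" unfolding cos_poly_def by blast
  have c: "cos_poly (Suc N) (\<lambda>y. cos y * cos (real j * y))" if "j \<le> N" for j
  proof (cases j)
    case 0 thus ?thesis using cos_poly_cos[of 1 "Suc N"] by simp
  next
    case (Suc i)
    have eq: "cos y * cos (real j * y) = 1/2 * (cos (real (Suc j) * y) + cos (real i * y))" for y
    proof -
      have "cos (real (Suc j) * y) = cos (real j * y + y)" "cos (real i * y) = cos (real j * y - y)"
        using Suc by (auto simp: algebra_simps intro: arg_cong[where f = cos])
      thus ?thesis by (simp add: cos_add cos_diff)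
    qed
    show ?thesis unfolding eq by (intro cos_poly_scale cos_poly_add cos_poly_cos) (use that Suc in auto)
  qed
  have "cos_poly (Suc N) (\<lambda>y. \<Sum>j\<le>N. w j * (1/2 * (cos (real j * y) + cos y * cos (real j * y))))"
    by (intro cos_poly_sum cos_poly_scale cos_poly_add cos_poly_cos c) auto
  moreover have "bump (Suc N) y = (\<Sum>j\<le>N. w j * (1/2 * (cos (real j * y) + cos y * cos (real j * y))))" for y
  proof -
    have "bump (Suc N) y = (1 + cos y) / 2 * bump N y" by (simp add: bump_def)
    also have "\<dots> = (\<Sum>j\<le>N. (1 + cos y) / 2 * (w j * cos (real j * y)))" unfolding w by (rule sum_distrib_left)
    also have "\<dots> = (\<Sum>j\<le>N. w j * (1/2 * (cos (real j * y) + cos y * cos (real j * y))))"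
      by (intro sum.cong refl) (simp add: algebra_simps)
    finally show ?thesis .
  qed
  ultimately show ?case unfolding cos_poly_def by metis
qed

lemma continuous_bump [continuous_intros]: "continuous_on S (\<lambda>x. bump N x)"
  unfolding bump_def by (intro continuous_intros) auto

lemma bump_nonneg: "bump N y \<ge> 0"
proof -
  have "1 + cos y \<ge> 0" using cos_ge_minus_one[of y] by linarith
  thus ?thesis unfolding bump_def by simp
qed

definition bump_mass :: "nat \<Rightarrow> real" where "bump_mass N = integral period (bump N)"

lemma bump_mass_pos: "bump_mass N > 0"
proof -
  have "bump_mass N \<ge> 0" unfolding bump_mass_def
    by (intro integral_nonneg integrable_continuous_interval continuous_bump[of _ N] bump_nonneg)
  moreover have "bump_mass N \<noteq> 0"
  proof
    assume "bump_mass N = 0"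
    moreover have "bump N integrable_on period"
      by (intro integrable_continuous_interval continuous_bump[of _ N])
    ultimately have "(bump N has_integral 0) (cbox 0 (2 * pi))"
      unfolding bump_mass_def using integrable_integral[of "bump N" "period"] by simp
    hence "bump N 0 = 0"
    proof (rule has_integral_0_cbox_imp_0[rotated 2])
      show "continuous_on (cbox 0 (2 * pi)) (bump N)" by (rule continuous_bump)
      show "box 0 (2 * pi) \<noteq> {}" by (simp add: box_real not_le)
    qed (use bump_nonneg in auto)
    thus False by (simp add: bump_def)
  qed
  ultimately show ?thesis by simp
qed

lemma bump_integrable: "(\<lambda>y. bump N y * cos (real j * y)) integrable_on period" "bump N integrable_on period"
  by (intro integrable_continuous_interval continuous_intros continuous_bump[of _ N])+

text \<open>The integral over a period of the derivative of \<open>sin y ((1 + cos y) / 2) ^ N\<close> vanishes.\<close>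

lemma bump_mass_Suc: "(2 * real N + 2) * bump_mass (Suc N) = (2 * real N + 1) * bump_mass N"
proof -
  have d: "((\<lambda>y. sin y * bump N y) has_real_derivative (2 * real N + 2) * bump (Suc N) y - (2 * real N + 1) * bump N y) (at y)" for y
  proof (cases N)
    case 0
    thus ?thesis by (auto intro!: derivative_eq_intros simp: bump_def field_simps)
  next
    case (Suc n)
    have "((\<lambda>y. (1 + cos y) / 2) has_real_derivative - sin y / 2) (at y)"
      by (auto intro!: derivative_eq_intros)
    from DERIV_mult[OF DERIV_sin DERIV_power[OF this, of N]]
    have "((\<lambda>y. sin y * bump N y) has_real_derivative
      cos y * ((1 + cos y) / 2) ^ N + sin y * (real N * ((1 + cos y) / 2) ^ n * (- sin y / 2))) (at y)"
      unfolding bump_def by (rule DERIV_cong) (simp add: Suc)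
    note d = this
    have "sin y * sin y = (1 - cos y) * (1 + cos y)"
      using sin_squared_eq[of y] by (simp add: power2_eq_square algebra_simps)
    hence "cos y * ((1 + cos y) / 2) ^ N + sin y * (real N * ((1 + cos y) / 2) ^ n * (- sin y / 2))
       = cos y * ((1 + cos y) / 2) ^ N - real N * ((1 + cos y) / 2) ^ n * ((1 - cos y) * (1 + cos y) / 2)"
    proof -
      have "sin y * (real N * A * (- sin y / 2)) = - (real N * A * (sin y * sin y / 2))" for A by simp
      thus ?thesis unfolding \<open>sin y * sin y = (1 - cos y) * (1 + cos y)\<close>
        by (simp only: add_uminus_conv_diff)
    qed
    also have "\<dots> = cos y * ((1 + cos y) / 2) ^ N - real N * (1 - cos y) * ((1 + cos y) / 2) ^ N"
    proof -
      have eq: "r * A * ((1 - x) * (1 + x) / 2) = r * (1 - x) * ((1 + x) / 2 * A)" for r A x :: real by simp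
      show ?thesis unfolding Suc power_Suc eq ..
    qed
    also have "\<dots> = (2 * real N + 2) * bump (Suc N) y - (2 * real N + 1) * bump N y"
    proof -
      have eq: "x * A - r * (1 - x) * A = (2 * r + 2) * ((1 + x) / 2 * A) - (2 * r + 1) * A" for r A x :: real
        by (simp add: field_simps)
      show ?thesis unfolding bump_def power_Suc[of _ N] by (rule eq)
    qed
    finally show ?thesis using d by (simp only:)
  qed
  have "((\<lambda>y. (2 * real N + 2) * bump (Suc N) y - (2 * real N + 1) * bump N y) has_integral
      (sin (2 * pi) * bump N (2 * pi) - sin 0 * bump N 0)) period"
    by (rule fundamental_theorem_of_calculus)
      (auto simp: has_real_derivative_iff_has_vector_derivative[symmetric] intro: DERIV_subset[OF d])
  moreover have "((\<lambda>y. (2 * real N + 2) * bump (Suc N) y - (2 * real N + 1) * bump N y) has_integral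
      (2 * real N + 2) * bump_mass (Suc N) - (2 * real N + 1) * bump_mass N) period"
    unfolding bump_mass_def
    by (intro has_integral_diff has_integral_mult_right integrable_integral bump_integrable(2))
  ultimately have "sin (2 * pi) * bump N (2 * pi) - sin 0 * bump N 0 =
      (2 * real N + 2) * bump_mass (Suc N) - (2 * real N + 1) * bump_mass N"
    by (rule has_integral_unique)
  thus ?thesis by simp
qed

text \<open>The distance to the multiples of \<open>2 \<pi>\<close> is measured by \<open>1 - cos y\<close>, since its mean under the
  kernel follows from the recursion for the mass.\<close>

lemma bump_concentrates:
  "((\<lambda>y. bump N y * (1 - cos y)) has_integral bump_mass N / (real N + 1)) period"
proof -
  have "((\<lambda>y. 2 * (bump N y - bump (Suc N) y)) has_integral 2 * (bump_mass N - bump_mass (Suc N))) period"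
    unfolding bump_mass_def
    by (intro has_integral_diff has_integral_mult_right integrable_integral bump_integrable(2))
  moreover have "2 * (bump N y - bump (Suc N) y) = bump N y * (1 - cos y)" for y
    by (simp add: bump_def algebra_simps)
  moreover have "2 * (bump_mass N - bump_mass (Suc N)) = bump_mass N / (real N + 1)"
  proof -
    have "(2 * real N + 2) * (bump_mass N - bump_mass (Suc N)) = bump_mass N"
      using bump_mass_Suc[of N] by (simp add: algebra_simps)
    thus ?thesis by (simp add: field_simps)
  qed
  ultimately show ?thesis by simp
qed

definition bump_coeff :: "nat \<Rightarrow> nat \<Rightarrow> real" where
  "bump_coeff N = (SOME w. \<forall>y. bump N y / bump_mass N = (\<Sum>j\<le>N. w j * cos (real j * y)))"

lemma bump_expansion: "bump N y / bump_mass N = (\<Sum>j\<le>N. bump_coeff N j * cos (real j * y))"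
proof -
  have "\<exists>w. \<forall>y. bump N y / bump_mass N = (\<Sum>j\<le>N. w j * cos (real j * y))"
    using cos_poly_scale[OF cos_poly_bump[of N], of "1 / bump_mass N"] unfolding cos_poly_def by simp
  from someI_ex[OF this] show ?thesis unfolding bump_coeff_def by blast
qed

lemma bump_coeff_bound:
  assumes "j \<in> {1..N}" shows "\<bar>pi * bump_coeff N j\<bar> \<le> 1"
proof -
  let ?k = "\<lambda>y. bump N y / bump_mass N"
  have "((\<lambda>y. \<Sum>i\<le>N. bump_coeff N i * (cos (real i * y) * cos (real j * y))) has_integral
     (\<Sum>i\<le>N. bump_coeff N i * (if i = j then pi else 0))) period"
  proof (intro has_integral_sum finite_atMost has_integral_mult_right)
    fix i show "((\<lambda>y. cos (real i * y) * cos (real j * y)) has_integral (if i = j then pi else 0)) period"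
    proof (cases "i = 0")
      case True
      thus ?thesis using has_integral_cos_int[of "int j"] assms by simp
    next
      case False thus ?thesis using has_integral_products(1)[of i j] assms by simp
    qed
  qed
  moreover have "(\<Sum>i\<le>N. bump_coeff N i * (if i = j then pi else 0)) = pi * bump_coeff N j"
    using assms by (simp add: if_distrib sum.delta cong: if_cong)
  moreover have "(\<Sum>i\<le>N. bump_coeff N i * (cos (real i * y) * cos (real j * y))) = ?k y * cos (real j * y)" for y
    unfolding bump_expansion sum_distrib_right by (simp add: mult.assoc)
  ultimately have 1: "((\<lambda>y. ?k y * cos (real j * y)) has_integral pi * bump_coeff N j) period" by simp
  have 2: "(?k has_integral 1) period"
    using has_integral_divide[OF integrable_integral[OF bump_integrable(2)], of N "bump_mass N"] bump_mass_pos[of N]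
    by (simp add: bump_mass_def)
  have le: "\<bar>?k y * cos (real j * y)\<bar> \<le> ?k y" for y
  proof -
    have k: "?k y \<ge> 0" using bump_nonneg[of N y] bump_mass_pos[of N] by simp
    have "\<bar>?k y * cos (real j * y)\<bar> = ?k y * \<bar>cos (real j * y)\<bar>"
      by (simp only: abs_mult abs_of_nonneg[OF k])
    also have "\<dots> \<le> ?k y * 1" using k by (intro mult_left_mono) auto
    finally show ?thesis by simp
  qed
  have "pi * bump_coeff N j \<le> 1"
    by (rule has_integral_le[OF 1 2]) (rule order_trans[OF abs_ge_self le])
  moreover have "- (pi * bump_coeff N j) \<le> 1"
    by (rule has_integral_le[OF has_integral_neg[OF 1] 2]) (rule order_trans[OF abs_ge_minus_self le])
  ultimately show ?thesis by linarith
qed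

text \<open>The Fourier coefficients of the convolution of \<open>\<gamma>\<close> with the normalized kernel.\<close>

definition smooth_cos :: "nat \<Rightarrow> (real \<Rightarrow> 'a::euclidean_space) \<Rightarrow> nat \<Rightarrow> 'a" where
  "smooth_cos N \<gamma> j = bump_coeff N j *\<^sub>R integral period (\<lambda>y. cos (real j * y) *\<^sub>R \<gamma> y)"
definition smooth_sin :: "nat \<Rightarrow> (real \<Rightarrow> 'a::euclidean_space) \<Rightarrow> nat \<Rightarrow> 'a" where
  "smooth_sin N \<gamma> j = bump_coeff N j *\<^sub>R integral period (\<lambda>y. sin (real j * y) *\<^sub>R \<gamma> y)"
definition smoothing :: "nat \<Rightarrow> (real \<Rightarrow> 'a::euclidean_space) \<Rightarrow> real \<Rightarrow> 'a" where
  "smoothing N \<gamma> = trig_poly N (smooth_cos N \<gamma>) (smooth_sin N \<gamma>)"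

lemma bump_reflect_periodic: "periodic (\<lambda>y. bump N (c - y))"
  unfolding periodic_def
proof
  fix \<theta>
  have "cos (c - (\<theta> + 2 * pi)) = cos ((c - (\<theta> + 2 * pi)) + 2 * pi)" by (rule cos_periodic[symmetric])
  also have "(c - (\<theta> + 2 * pi)) + 2 * pi = c - \<theta>" by simp
  finally show "bump N (c - (\<theta> + 2 * pi)) = bump N (c - \<theta>)" by (simp add: bump_def)
qed

text \<open>By periodicity, the convolution is also an average of translates of \<open>\<gamma>\<close>.  In this form it
  inherits Lipschitz bounds and is close to \<open>\<gamma>\<close>.\<close>

lemma has_integral_smoothing:
  fixes \<gamma> :: "real \<Rightarrow> 'a::euclidean_space"
  assumes per: "periodic \<gamma>" and cont: "continuous_on UNIV \<gamma>"
  shows "((\<lambda>y. (bump N y / bump_mass N) *\<^sub>R \<gamma> (\<theta> - y)) has_integral smoothing N \<gamma> \<theta>) period"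
proof -
  let ?k = "\<lambda>y. bump N y / bump_mass N"
  have c: "continuous_on S \<gamma>" for S using cont continuous_on_subset by blast
  have ci: "(\<lambda>y. cos (real j * y) *\<^sub>R \<gamma> y) integrable_on period"
    and si: "(\<lambda>y. sin (real j * y) *\<^sub>R \<gamma> y) integrable_on period" for j
    by (intro integrable_continuous_interval continuous_intros c)+
  have "((\<lambda>y. \<Sum>j\<le>N. cos (real j * \<theta>) *\<^sub>R bump_coeff N j *\<^sub>R (cos (real j * y) *\<^sub>R \<gamma> y) +
       sin (real j * \<theta>) *\<^sub>R bump_coeff N j *\<^sub>R (sin (real j * y) *\<^sub>R \<gamma> y)) has_integral smoothing N \<gamma> \<theta>) period"
    unfolding smoothing_def trig_poly_def smooth_cos_def smooth_sin_def
    by (intro has_integral_sum finite_atMost has_integral_add has_integral_cmul integrable_integral ci si)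
  moreover have "(\<Sum>j\<le>N. cos (real j * \<theta>) *\<^sub>R bump_coeff N j *\<^sub>R (cos (real j * y) *\<^sub>R \<gamma> y) +
       sin (real j * \<theta>) *\<^sub>R bump_coeff N j *\<^sub>R (sin (real j * y) *\<^sub>R \<gamma> y)) = ?k (\<theta> - y) *\<^sub>R \<gamma> y" for y
    unfolding bump_expansion scaleR_sum_left
    by (intro sum.cong refl) (simp add: cos_diff right_diff_distrib scaleR_add_left[symmetric] algebra_simps del: scaleR_add_left)
  ultimately have 1: "((\<lambda>y. ?k (\<theta> - y) *\<^sub>R \<gamma> y) has_integral smoothing N \<gamma> \<theta>) period" by simp
  define f where "f y = ?k (\<theta> - y) *\<^sub>R \<gamma> y" for y
  have pf: "periodic f"
    using per bump_reflect_periodic[of N \<theta>] unfolding periodic_def f_def by simp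
  have cf: "continuous_on S f" for S
    unfolding f_def using bump_mass_pos[of N]
    by (intro continuous_intros c continuous_on_compose2[OF continuous_bump[of UNIV N]]) auto
  have "smoothing N \<gamma> \<theta> = integral period f" using 1 unfolding f_def by (simp add: integral_unique)
  also have "\<dots> = integral period (\<lambda>y. f (\<theta> - y))" using integral_periodic_reflect[OF pf cf] by simp
  also have "(\<lambda>y. f (\<theta> - y)) = (\<lambda>y. ?k y *\<^sub>R \<gamma> (\<theta> - y))" by (auto simp: f_def)
  finally have eq: "smoothing N \<gamma> \<theta> = integral period (\<lambda>y. ?k y *\<^sub>R \<gamma> (\<theta> - y))" .
  have "(\<lambda>y. ?k y *\<^sub>R \<gamma> (\<theta> - y)) integrable_on period"
    using bump_mass_pos[of N]
    by (intro integrable_continuous_interval continuous_intros continuous_on_compose2[OF c[of UNIV]]) auto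
  thus ?thesis unfolding eq by (rule integrable_integral)
qed

lemma bump_normalized: "((\<lambda>y. bump N y / bump_mass N) has_integral 1) period"
  using has_integral_divide[OF integrable_integral[OF bump_integrable(2)], of N "bump_mass N"] bump_mass_pos[of N]
  by (simp add: bump_mass_def)

lemma lipschitz_curve_smoothing:
  fixes \<gamma> :: "real \<Rightarrow> 'a::euclidean_space"
  assumes "periodic \<gamma>" "continuous_on UNIV \<gamma>" "lipschitz_curve l \<gamma>"
  shows "lipschitz_curve l (smoothing N \<gamma>)"
  unfolding lipschitz_curve_def
proof (intro allI)
  fix \<theta> \<phi>
  let ?k = "\<lambda>y. bump N y / bump_mass N"
  have 1: "((\<lambda>y. ?k y *\<^sub>R \<gamma> (\<theta> - y) - ?k y *\<^sub>R \<gamma> (\<phi> - y)) has_integral smoothing N \<gamma> \<theta> - smoothing N \<gamma> \<phi>) period"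
    by (intro has_integral_diff has_integral_smoothing assms)
  have 2: "((\<lambda>y. ?k y * (l * \<bar>\<theta> - \<phi>\<bar>)) has_integral 1 * (l * \<bar>\<theta> - \<phi>\<bar>)) period"
    by (intro has_integral_mult_left bump_normalized)
  have "norm (integral period (\<lambda>y. ?k y *\<^sub>R \<gamma> (\<theta> - y) - ?k y *\<^sub>R \<gamma> (\<phi> - y))) \<le> integral period (\<lambda>y. ?k y * (l * \<bar>\<theta> - \<phi>\<bar>))"
  proof (rule integral_norm_bound_integral)
    fix y
    have "norm (\<gamma> (\<theta> - y) - \<gamma> (\<phi> - y)) \<le> l * \<bar>\<theta> - \<phi>\<bar>"
      using assms(3)[unfolded lipschitz_curve_def, rule_format, of "\<theta> - y" "\<phi> - y"] by simp
    hence "?k y * norm (\<gamma> (\<theta> - y) - \<gamma> (\<phi> - y)) \<le> ?k y * (l * \<bar>\<theta> - \<phi>\<bar>)"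
      using bump_nonneg[of N y] bump_mass_pos[of N] by (intro mult_left_mono) auto
    thus "norm (?k y *\<^sub>R \<gamma> (\<theta> - y) - ?k y *\<^sub>R \<gamma> (\<phi> - y)) \<le> ?k y * (l * \<bar>\<theta> - \<phi>\<bar>)"
      using bump_nonneg[of N y] bump_mass_pos[of N] by (simp add: scaleR_diff_right[symmetric] del: scaleR_diff_right)
  qed (rule has_integral_integrable[OF 1] has_integral_integrable[OF 2])+
  thus "norm (smoothing N \<gamma> \<theta> - smoothing N \<gamma> \<phi>) \<le> l * \<bar>\<theta> - \<phi>\<bar>"
    unfolding integral_unique[OF 1] integral_unique[OF 2] by simp
qed

lemma smoothing_error:
  fixes \<gamma> :: "real \<Rightarrow> 'a::euclidean_space"
  assumes "periodic \<gamma>" "continuous_on UNIV \<gamma>"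
    and mod: "\<And>y. norm (\<gamma> (\<theta> - y) - \<gamma> \<theta>) \<le> e + C * (1 - cos y)"
  shows "norm (smoothing N \<gamma> \<theta> - \<gamma> \<theta>) \<le> e + C / (real N + 1)"
proof -
  let ?k = "\<lambda>y. bump N y / bump_mass N"
  have k0: "?k y \<ge> 0" for y using bump_nonneg[of N y] bump_mass_pos[of N] by simp
  have 0: "((\<lambda>y. ?k y *\<^sub>R \<gamma> \<theta>) has_integral 1 *\<^sub>R \<gamma> \<theta>) period"
    using has_integral_linear[OF bump_normalized bounded_linear_scaleR_left[of "\<gamma> \<theta>"]] by (simp add: o_def)
  have 1: "((\<lambda>y. ?k y *\<^sub>R \<gamma> (\<theta> - y) - ?k y *\<^sub>R \<gamma> \<theta>) has_integral smoothing N \<gamma> \<theta> - 1 *\<^sub>R \<gamma> \<theta>) period"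
    by (intro has_integral_diff has_integral_smoothing assms 0)
  have "((\<lambda>y. bump N y * (1 - cos y) / bump_mass N) has_integral bump_mass N / (real N + 1) / bump_mass N) period"
    by (intro has_integral_divide bump_concentrates)
  hence "((\<lambda>y. ?k y * (1 - cos y)) has_integral 1 / (real N + 1)) period" using bump_mass_pos[of N] by simp
  hence 2: "((\<lambda>y. ?k y * e + C * (?k y * (1 - cos y))) has_integral 1 * e + C * (1 / (real N + 1))) period"
    by (intro has_integral_add has_integral_mult_left has_integral_mult_right bump_normalized)
  have "norm (integral period (\<lambda>y. ?k y *\<^sub>R \<gamma> (\<theta> - y) - ?k y *\<^sub>R \<gamma> \<theta>)) \<le> integral period (\<lambda>y. ?k y * e + C * (?k y * (1 - cos y)))"
  proof (rule integral_norm_bound_integral)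
    fix y
    have "norm (?k y *\<^sub>R \<gamma> (\<theta> - y) - ?k y *\<^sub>R \<gamma> \<theta>) = ?k y * norm (\<gamma> (\<theta> - y) - \<gamma> \<theta>)"
      using k0[of y] by (simp only: scaleR_diff_right[symmetric] norm_scaleR abs_of_nonneg)
    also have "\<dots> \<le> ?k y * (e + C * (1 - cos y))" using k0 mod by (rule mult_left_mono[rotated])
    also have "\<dots> = ?k y * e + C * (?k y * (1 - cos y))" by (simp only: distrib_left mult.left_commute)
    finally show "norm (?k y *\<^sub>R \<gamma> (\<theta> - y) - ?k y *\<^sub>R \<gamma> \<theta>) \<le> ?k y * e + C * (?k y * (1 - cos y))" .
  qed (rule has_integral_integrable[OF 1] has_integral_integrable[OF 2])+
  thus ?thesis unfolding integral_unique[OF 1] integral_unique[OF 2] by simp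
qed

section \<open>Reparametrization to bounded speed\<close>

definition signed_integral :: "(real \<Rightarrow> real) \<Rightarrow> real \<Rightarrow> real" where
  "signed_integral g x = (if x \<ge> 0 then integral {0..x} g else - integral {x..0} g)"

lemma signed_integral_diff:
  assumes "continuous_on UNIV g" "x \<le> y"
  shows "signed_integral g y - signed_integral g x = integral {x..y} g"
proof -
  have int: "g integrable_on {a..b}" for a b
    by (intro integrable_continuous_interval continuous_on_subset[OF assms(1)]) auto
  consider "x \<ge> 0" | "x < 0" "y \<ge> 0" | "y < 0" using assms(2) by linarith
  thus ?thesis
  proof cases
    case 1
    thus ?thesis
      using Henstock_Kurzweil_Integration.integral_combine[OF 1 assms(2) int] assms(2) by (simp add: signed_integral_def)
  next
    case 2
    have "integral {x..0} g + integral {0..y} g = integral {x..y} g"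
      by (rule Henstock_Kurzweil_Integration.integral_combine[OF _ _ int]) (use 2 in auto)
    thus ?thesis using 2 by (simp add: signed_integral_def)
  next
    case 3
    have "integral {x..y} g + integral {y..0} g = integral {x..0} g"
      by (rule Henstock_Kurzweil_Integration.integral_combine[OF _ _ int]) (use 3 assms(2) in auto)
    thus ?thesis using 3 assms(2) by (simp add: signed_integral_def)
  qed
qed

lemma continuous_signed_integral:
  assumes "continuous_on UNIV g" shows "continuous_on UNIV (signed_integral g)"
proof -
  have "isCont (signed_integral g) x" for x
  proof -
    have "((\<lambda>y. signed_integral g (x - 1) + integral {x - 1..y} g) has_vector_derivative g x) (at x within {x - 1..x + 1})"
      using integral_has_vector_derivative[of "x - 1" "x + 1" g x] continuous_on_subset[OF assms]
      by (auto intro!: derivative_eq_intros)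
    hence "continuous (at x within {x - 1..x + 1}) (\<lambda>y. signed_integral g (x - 1) + integral {x - 1..y} g)"
      by (rule has_vector_derivative_continuous)
    moreover have "x \<in> interior {x - 1..x + 1}" by simp
    ultimately have c: "isCont (\<lambda>y. signed_integral g (x - 1) + integral {x - 1..y} g) x"
      by (metis at_within_interior)
    have "\<forall>\<^sub>F y in nhds x. y \<in> {x - 1<..}" by (intro eventually_nhds_in_open) auto
    hence "\<forall>\<^sub>F y in nhds x. signed_integral g (x - 1) + integral {x - 1..y} g = signed_integral g y"
    proof eventually_elim
      case (elim y)
      hence "x - 1 \<le> y" by simp
      from signed_integral_diff[OF assms this] show ?case by linarith
    qed
    from isCont_cong[OF this] c show ?thesis by (rule iffD1)
  qed
  thus ?thesis by (simp add: continuous_at_imp_continuous_on)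
qed

lemma norm_diff_le_integral_speed:
  fixes Q :: "real \<Rightarrow> 'a::euclidean_space"
  assumes "x \<le> y" "\<And>\<theta>. (Q has_vector_derivative dQ \<theta>) (at \<theta>)" "continuous_on UNIV dQ"
  shows "norm (Q y - Q x) \<le> integral {x..y} (\<lambda>\<theta>. norm (dQ \<theta>))"
proof -
  have 1: "(dQ has_integral Q y - Q x) {x..y}"
    by (rule fundamental_theorem_of_calculus) (use assms has_vector_derivative_at_within in blast)+
  have "norm (integral {x..y} dQ) \<le> integral {x..y} (\<lambda>\<theta>. norm (dQ \<theta>))"
    by (intro integral_norm_bound_integral integrable_continuous_interval continuous_intros
        continuous_on_subset[OF assms(3)]) auto
  thus ?thesis using 1 by (simp add: integral_unique)
qed

text \<open>The parameter is changed by a function \<open>\<phi>\<close> with derivative \<open>|Q'| / R\<close> plus a constant, where the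
  constant is chosen such that \<open>\<phi>\<close> grows by \<open>2 \<pi>\<close> over a period.  It is positive because the curves
  are shorter than \<open>2 \<pi> R\<close>.  So \<open>\<phi>\<close> has an inverse that depends continuously on \<open>s\<close>, even where a
  curve stands still, and \<open>|Q'| \<le> R \<phi>'\<close> bounds the speed of the reparametrized curve.\<close>

lemma reparametrize:
  fixes Q dQ :: "'p::metric_space \<Rightarrow> real \<Rightarrow> 'a::euclidean_space"
  assumes cont: "continuous_on (S \<times> UNIV) (\<lambda>(s, \<theta>). dQ s \<theta>)"
    and deriv: "\<And>s \<theta>. s \<in> S \<Longrightarrow> (Q s has_vector_derivative dQ s \<theta>) (at \<theta>)"
    and per: "\<And>s. s \<in> S \<Longrightarrow> periodic (dQ s)"
    and len: "\<And>s. s \<in> S \<Longrightarrow> integral period (\<lambda>\<theta>. norm (dQ s \<theta>)) \<le> L"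
    and L: "L < 2 * pi * R" and R: "R > 0"
  obtains \<psi> where "continuous_on (S \<times> UNIV) (\<lambda>(s, \<theta>). \<psi> s \<theta>)"
    "\<And>s \<theta>. s \<in> S \<Longrightarrow> \<psi> s (\<theta> + 2 * pi) = \<psi> s \<theta> + 2 * pi"
    "\<And>s. s \<in> S \<Longrightarrow> lipschitz_curve R (\<lambda>\<theta>. Q s (\<psi> s \<theta>))"
proof -
  define len where "len s = integral period (\<lambda>\<theta>. norm (dQ s \<theta>))" for s
  \<comment> \<open>A lower bound, uniform in \<open>s\<close>, for the constant in the derivative of \<open>\<phi>\<close>.\<close>
  define m where "m = 1 - L / (2 * pi * R)"
  define g where "g s \<theta> = norm (dQ s \<theta>) / R + (1 - len s / (2 * pi * R))" for s \<theta>
  define \<phi> where "\<phi> s = signed_integral (g s)" for s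
  have m: "m > 0" using L R by (simp add: m_def)
  have cdQ: "continuous_on UNIV (dQ s)" if "s \<in> S" for s
  proof -
    have "continuous_on UNIV (\<lambda>\<theta>. (\<lambda>(s, \<theta>). dQ s \<theta>) (s, \<theta>))"
      by (rule continuous_on_compose2[OF cont]) (use that in \<open>auto intro!: continuous_intros\<close>)
    thus ?thesis by simp
  qed
  have clen: "continuous_on S len"
    unfolding len_def cbox_interval[symmetric]
  proof (rule integral_continuous_on_param)
    have "continuous_on (S \<times> UNIV) (\<lambda>x. norm ((\<lambda>(s, \<theta>). dQ s \<theta>) x))" by (intro continuous_intros cont)
    thus "continuous_on (S \<times> cbox 0 (2 * pi)) (\<lambda>(s, \<theta>). norm (dQ s \<theta>))"
      by (auto simp: split_beta intro: continuous_on_subset)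
  qed
  have cg2: "continuous_on (S \<times> UNIV) (\<lambda>(s, \<theta>). g s \<theta>)"
  proof -
    have "continuous_on (S \<times> (UNIV::real set)) (\<lambda>x. len (fst x))"
      by (rule continuous_on_compose2[OF clen]) (auto intro!: continuous_intros)
    hence "continuous_on (S \<times> UNIV) (\<lambda>x. norm ((\<lambda>(s, \<theta>). dQ s \<theta>) x) / R + (1 - len (fst x) / (2 * pi * R)))"
      using R by (intro continuous_intros cont) auto
    thus ?thesis by (simp add: g_def split_beta)
  qed
  have cg: "continuous_on UNIV (g s)" if "s \<in> S" for s
    unfolding g_def using R by (intro continuous_intros cdQ that) auto
  have gm: "g s \<theta> \<ge> m + norm (dQ s \<theta>) / R" if "s \<in> S" for s \<theta>
    using len[OF that] R unfolding g_def m_def len_def[symmetric] by (simp add: divide_right_mono)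
  hence gm': "g s \<theta> \<ge> m" if "s \<in> S" for s \<theta> using that R by (smt (verit) divide_nonneg_pos norm_ge_zero)
  have int: "g s integrable_on {a..b}" if "s \<in> S" for s a b
    by (intro integrable_continuous_interval continuous_on_subset[OF cg[OF that]]) auto
  have \<phi>_diff: "\<phi> s y - \<phi> s x = integral {x..y} (g s)" if "s \<in> S" "x \<le> y" for s x y
    unfolding \<phi>_def by (rule signed_integral_diff[OF cg[OF that(1)] that(2)])
  have \<phi>_mono: "m * (y - x) \<le> \<phi> s y - \<phi> s x" if "s \<in> S" "x \<le> y" for s x y
  proof -
    have "((\<lambda>_. m) has_integral m * (y - x)) {x..y}" using has_integral_const_real[of m x y] that(2) by (simp add: mult.commute)
    from has_integral_le[OF this integrable_integral[OF int[OF that(1)]]] show ?thesis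
      unfolding \<phi>_diff[OF that] using gm'[OF that(1)] by blast
  qed
  have \<phi>_abs: "m * \<bar>y - x\<bar> \<le> \<bar>\<phi> s y - \<phi> s x\<bar>" if "s \<in> S" for s x y
    using \<phi>_mono[OF that, of x y] \<phi>_mono[OF that, of y x] by (cases "x \<le> y") auto
  have \<phi>_per: "\<phi> s (\<theta> + 2 * pi) = \<phi> s \<theta> + 2 * pi" if s: "s \<in> S" for s \<theta>
  proof -
    have pg: "periodic (g s)" using per[OF s] unfolding periodic_def g_def by simp
    have "\<phi> s (\<theta> + 2 * pi) - \<phi> s \<theta> = integral {\<theta>..\<theta> + 2 * pi} (g s)" by (rule \<phi>_diff[OF s]) simp
    also have "\<dots> = integral period (g s)" using integral_periodic_shift[OF pg cg[OF s], of "\<theta> + 2 * pi"] by simp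
    also have "\<dots> = 2 * pi"
    proof (rule integral_unique)
      have "(\<lambda>\<theta>. norm (dQ s \<theta>)) integrable_on period"
        by (intro integrable_continuous_interval continuous_intros continuous_on_subset[OF cdQ[OF s]]) auto
      hence "((\<lambda>\<theta>. norm (dQ s \<theta>) / R) has_integral len s / R) period"
        unfolding len_def by (intro has_integral_divide integrable_integral)
      moreover have "((\<lambda>\<theta>. 1 - len s / (2 * pi * R)) has_integral 2 * pi * (1 - len s / (2 * pi * R))) period"
        using has_integral_const_real[of "1 - len s / (2 * pi * R)" 0 "2 * pi"] by simp
      ultimately have "(g s has_integral len s / R + 2 * pi * (1 - len s / (2 * pi * R))) period"
        unfolding g_def by (rule has_integral_add)
      moreover have "len s / R + 2 * pi * (1 - len s / (2 * pi * R)) = 2 * pi" using R by (simp add: field_simps)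
      ultimately show "(g s has_integral 2 * pi) period" by simp
    qed
    finally show ?thesis by simp
  qed
  have \<phi>0: "\<phi> s 0 = 0" for s by (simp add: \<phi>_def signed_integral_def)
  have surj: "\<exists>y. \<phi> s y = w" if s: "s \<in> S" for s w
  proof -
    define b where "b = \<bar>w\<bar> / m"
    have b: "b \<ge> 0" "m * b = \<bar>w\<bar>" using m by (auto simp: b_def)
    have "\<exists>y\<ge>-b. y \<le> b \<and> \<phi> s y = w"
    proof (rule IVT')
      show "\<phi> s (-b) \<le> w" using \<phi>_mono[OF s, of "-b" 0] b \<phi>0[of s] by simp
      show "w \<le> \<phi> s b" using \<phi>_mono[OF s, of 0 b] b \<phi>0[of s] by simp
      show "continuous_on {-b..b} (\<phi> s)"
        unfolding \<phi>_def by (rule continuous_on_subset[OF continuous_signed_integral[OF cg[OF s]]]) simp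
    qed (use b in auto)
    thus ?thesis by blast
  qed
  define \<psi> where "\<psi> s w = (SOME y. \<phi> s y = w)" for s w
  have \<phi>\<psi>: "\<phi> s (\<psi> s w) = w" if "s \<in> S" for s w
    unfolding \<psi>_def by (rule someI_ex[OF surj[OF that]])
  have inj: "x = y" if "s \<in> S" "\<phi> s x = \<phi> s y" for s x y
    using \<phi>_abs[OF that(1), of y x] that(2) m by (simp add: mult_le_0_iff)
  show thesis
  proof (rule that)
    show "\<psi> s (\<theta> + 2 * pi) = \<psi> s \<theta> + 2 * pi" if "s \<in> S" for s \<theta>
      by (rule inj[OF that]) (simp add: \<phi>_per \<phi>\<psi> that)
    show "lipschitz_curve R (\<lambda>\<theta>. Q s (\<psi> s \<theta>))" if s: "s \<in> S" for s
    proof -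
      have le: "norm (Q s (\<psi> s b) - Q s (\<psi> s a)) \<le> R * (b - a)" if ab: "a \<le> b" for a b
      proof -
        have p: "\<psi> s a \<le> \<psi> s b"
        proof (rule ccontr)
          assume "\<not> \<psi> s a \<le> \<psi> s b"
          hence "m * (\<psi> s a - \<psi> s b) \<le> a - b" "\<psi> s a - \<psi> s b > 0" using \<phi>_mono[OF s, of "\<psi> s b" "\<psi> s a"] \<phi>\<psi>[OF s] by auto
          thus False using ab m mult_pos_pos[of m "\<psi> s a - \<psi> s b"] by linarith
        qed
        have "norm (Q s (\<psi> s b) - Q s (\<psi> s a)) \<le> integral {\<psi> s a..\<psi> s b} (\<lambda>\<theta>. norm (dQ s \<theta>))"
          by (rule norm_diff_le_integral_speed[OF p deriv[OF s] cdQ[OF s]])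
        also have "\<dots> \<le> integral {\<psi> s a..\<psi> s b} (\<lambda>\<theta>. R * g s \<theta>)"
        proof (rule integral_le)
          show "(\<lambda>\<theta>. norm (dQ s \<theta>)) integrable_on {\<psi> s a..\<psi> s b}"
            by (intro integrable_continuous_interval continuous_intros continuous_on_subset[OF cdQ[OF s]]) auto
          show "(\<lambda>\<theta>. R * g s \<theta>) integrable_on {\<psi> s a..\<psi> s b}"
            by (intro integrable_continuous_interval continuous_intros continuous_on_subset[OF cg[OF s]]) auto
          fix \<theta>
          have "norm (dQ s \<theta>) / R \<le> g s \<theta>" using gm[OF s, of \<theta>] m by linarith
          thus "norm (dQ s \<theta>) \<le> R * g s \<theta>" using R by (simp add: field_simps)
        qed
        also have "\<dots> = R * (\<phi> s (\<psi> s b) - \<phi> s (\<psi> s a))" unfolding \<phi>_diff[OF s p] by (rule integral_mult_right)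
        also have "\<dots> = R * (b - a)" using \<phi>\<psi>[OF s] by simp
        finally show ?thesis .
      qed
      show ?thesis unfolding lipschitz_curve_def
      proof (intro allI)
        fix a b show "norm (Q s (\<psi> s a) - Q s (\<psi> s b)) \<le> R * \<bar>a - b\<bar>"
          using le[of a b] le[of b a] by (cases "a \<le> b") (auto simp: norm_minus_commute)
      qed
    qed
    show "continuous_on (S \<times> UNIV) (\<lambda>(s, \<theta>). \<psi> s \<theta>)"
      unfolding continuous_on_def
    proof
      fix x assume x: "x \<in> S \<times> (UNIV :: real set)"
      obtain s0 \<theta>0 where x0: "x = (s0, \<theta>0)" "s0 \<in> S" using x by auto
      let ?y = "\<psi> s0 \<theta>0" and ?F = "at x within (S \<times> UNIV)"
      have c\<phi>: "continuous_on S (\<lambda>s. \<phi> s ?y)"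
      proof -
        have c: "continuous_on S (\<lambda>s. integral (cbox a b) (g s))" for a b
          by (rule integral_continuous_on_param) (rule continuous_on_subset[OF cg2], auto)
        show ?thesis unfolding \<phi>_def signed_integral_def
          using c[of 0 ?y] c[of ?y 0] by (cases "?y \<ge> 0") (auto intro!: continuous_intros)
      qed
      have "continuous_on (S \<times> (UNIV :: real set)) (\<lambda>x. \<phi> (fst x) ?y)"
        by (rule continuous_on_compose2[OF c\<phi>]) (auto intro!: continuous_intros)
      hence t1: "((\<lambda>x. \<phi> (fst x) ?y) \<longlongrightarrow> \<theta>0) ?F"
        unfolding continuous_on_def using x x0 \<phi>\<psi>[OF x0(2), of \<theta>0] by (metis fst_conv)
      have t2: "((\<lambda>x. snd x) \<longlongrightarrow> \<theta>0) ?F" using x0 by (auto intro!: tendsto_eq_intros)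
      have t3: "((\<lambda>x. \<bar>\<phi> (fst x) ?y - snd x\<bar> / m) \<longlongrightarrow> \<bar>\<theta>0 - \<theta>0\<bar> / m) ?F"
        using m by (intro tendsto_intros t1 t2) auto
      have "((\<lambda>x. \<psi> (fst x) (snd x) - ?y) \<longlongrightarrow> 0) ?F"
      proof (rule Lim_null_comparison)
        show "((\<lambda>x. \<bar>\<phi> (fst x) ?y - snd x\<bar> / m) \<longlongrightarrow> 0) ?F" using t3 by simp
        have "norm (\<psi> (fst x) (snd x) - ?y) \<le> \<bar>\<phi> (fst x) ?y - snd x\<bar> / m" if "x \<in> S \<times> UNIV" for x
        proof -
          have s: "fst x \<in> S" using that by auto
          have "m * \<bar>\<psi> (fst x) (snd x) - ?y\<bar> \<le> \<bar>snd x - \<phi> (fst x) ?y\<bar>"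
            using \<phi>_abs[OF s, of "\<psi> (fst x) (snd x)" ?y] \<phi>\<psi>[OF s] by simp
          thus ?thesis using m by (simp add: field_simps abs_minus_commute)
        qed
        thus "\<forall>\<^sub>F x in ?F. norm (\<psi> (fst x) (snd x) - ?y) \<le> \<bar>\<phi> (fst x) ?y - snd x\<bar> / m"
          unfolding eventually_at_filter by (auto intro!: always_eventually)
      qed
      hence "((\<lambda>x. \<psi> (fst x) (snd x) - ?y + ?y) \<longlongrightarrow> 0 + ?y) ?F" by (intro tendsto_add tendsto_const)
      thus "((\<lambda>(s, \<theta>). \<psi> s \<theta>) \<longlongrightarrow> (\<lambda>(s, \<theta>). \<psi> s \<theta>) x) ?F" using x0 by (simp add: case_prod_unfold)
    qed
  qed
qed

section \<open>Families of loops\<close>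

text \<open>A continuous map from a compact space onto a Hausdorff space is closed, hence a quotient map.\<close>

lemma continuous_on_compact_quotient:
  fixes q :: "'a::metric_space \<Rightarrow> 'b::metric_space" and f :: "'b \<Rightarrow> 'c::topological_space"
  assumes "compact A" "continuous_on A q" "continuous_on A (\<lambda>x. f (q x))"
  shows "continuous_on (q ` A) f"
  unfolding continuous_on_closed_invariant
proof (intro allI impI)
  fix B :: "'c set" assume B: "closed B"
  have "closedin (top_of_set A) (A \<inter> (\<lambda>x. f (q x)) -` B)"
    using assms(3) B by (simp add: continuous_closedin_preimage)
  hence "compact (A \<inter> (\<lambda>x. f (q x)) -` B)" using assms(1) closedin_compact by blast
  hence "compact (q ` (A \<inter> (\<lambda>x. f (q x)) -` B))"
    by (rule compact_continuous_image[OF continuous_on_subset[OF assms(2)], rotated]) blast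
  hence "closed (q ` (A \<inter> (\<lambda>x. f (q x)) -` B))" by (rule compact_imp_closed)
  moreover have "q ` (A \<inter> (\<lambda>x. f (q x)) -` B) \<inter> q ` A = f -` B \<inter> q ` A" by auto
  ultimately show "\<exists>A'. closed A' \<and> A' \<inter> q ` A = f -` B \<inter> q ` A" by blast
qed

text \<open>A sweepout seen through the covering of the circle by the line, with values anywhere in the
  ambient space; \<open>on_circle\<close> leads back to maps on the cylinder.\<close>

definition loop_family :: "('p::euclidean_space \<Rightarrow> real \<Rightarrow> 'a::euclidean_space) \<Rightarrow> bool" where
  "loop_family \<gamma> \<longleftrightarrow> continuous_on (cball 0 1 \<times> UNIV) (\<lambda>(s, \<theta>). \<gamma> s \<theta>) \<and>
     (\<forall>s\<in>cball 0 1. periodic (\<gamma> s)) \<and> (\<forall>s\<in>sphere 0 1. \<forall>\<theta>. \<gamma> s \<theta> = \<gamma> s 0)"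

definition on_circle :: "('p \<Rightarrow> real \<Rightarrow> 'a) \<Rightarrow> complex \<times> 'p \<Rightarrow> 'a" where
  "on_circle \<gamma> = (\<lambda>(z, s). \<gamma> s (Arg z))"

text \<open>The condition under which a map on the cylinder induces a map on the sphere.\<close>

definition collapsed :: "(complex \<times> 'p::euclidean_space \<Rightarrow> 'a) \<Rightarrow> bool" where
  "collapsed \<sigma> \<longleftrightarrow> (\<forall>s\<in>sphere 0 1. \<exists>c. \<forall>z\<in>sphere 0 1. \<sigma> (z, s) = c)"

abbreviation cylinder :: "(complex \<times> 'p::euclidean_space) set" where
  "cylinder \<equiv> sphere 0 1 \<times> cball 0 1"

abbreviation homotopic_avoiding ::
    "'a::euclidean_space \<Rightarrow> (complex \<times> 'p::euclidean_space \<Rightarrow> 'a) \<Rightarrow> (complex \<times> 'p \<Rightarrow> 'a) \<Rightarrow> bool" where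
  "homotopic_avoiding p \<equiv> homotopic_with_canon collapsed cylinder (- {p})"

lemma periodic_Arg_cis: "periodic f \<Longrightarrow> f (Arg (cis \<theta>)) = f \<theta>"
proof -
  assume per: "periodic f"
  obtain k :: int where k: "\<theta> + 2 * pi * of_int k \<in> {- pi..<- pi + 2 * pi}" by (rule periodic_representative)
  define \<phi> where "\<phi> = (if \<theta> + 2 * pi * of_int k = - pi then pi else \<theta> + 2 * pi * of_int k)"
  have "cis (\<theta> + 2 * pi * of_int k) = cis \<theta>"
    using cos_int_2pin[of k] sin_int_2pin[of k]
    by (auto simp: complex_eq_iff cos_add sin_add mult.commute mult.left_commute)
  moreover have "cis (- pi) = cis pi" by (simp add: complex_eq_iff)
  ultimately have "cis \<phi> = cis \<theta>" unfolding \<phi>_def by (metis (full_types))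
  moreover have "- pi < \<phi>" "\<phi> \<le> pi" using k by (auto simp: \<phi>_def)
  ultimately have "Arg (cis \<theta>) = \<phi>" using Arg_unique[of 1 \<phi> "cis \<theta>"] by (simp add: cis_conv_exp)
  moreover have "f \<phi> = f \<theta>"
  proof (cases "\<theta> + 2 * pi * of_int k = - pi")
    case True
    have "f pi = f (- pi + 2 * pi)" by simp
    also have "\<dots> = f (- pi)" using per unfolding periodic_def by blast
    also have "\<dots> = f \<theta>" using periodic_int[OF per, of \<theta> k] True by simp
    finally show ?thesis using True by (simp add: \<phi>_def)
  next
    case False thus ?thesis using periodic_int[OF per, of \<theta> k] by (simp add: \<phi>_def)
  qed
  ultimately show ?thesis by simp
qed

lemma cis_image: "cis ` period = sphere 0 1"
proof
  show "cis ` period \<subseteq> sphere 0 1" by auto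
  show "sphere 0 1 \<subseteq> cis ` period"
  proof
    fix z :: complex assume "z \<in> sphere 0 1"
    hence z: "cis (Arg z) = z" by (simp add: cis_Arg_unique complex_eq_iff) (metis cis_Arg norm_zero sgn_eq zero_neq_one div_by_1 of_real_1 complex_eq_iff cis.sel)
    obtain k :: int where k: "Arg z + 2 * pi * of_int k \<in> {0..<0 + 2 * pi}" by (rule periodic_representative)
    have "cis (Arg z + 2 * pi * of_int k) = cis (Arg z)"
      using cos_int_2pin[of k] sin_int_2pin[of k]
      by (auto simp: complex_eq_iff cos_add sin_add mult.commute mult.left_commute)
    thus "z \<in> cis ` period" using k z by (intro image_eqI[of _ _ "Arg z + 2 * pi * of_int k"]) auto
  qed
qed

text \<open>The cylinder is a quotient of the product of a period with the ball.\<close>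

lemma loop_family_homotopy:
  fixes h :: "real \<Rightarrow> 'p::euclidean_space \<Rightarrow> real \<Rightarrow> 'a::euclidean_space"
  assumes cont: "continuous_on ({0..1} \<times> cball 0 1 \<times> UNIV) (\<lambda>(u, s, \<theta>). h u s \<theta>)"
    and per: "\<And>u s. u \<in> {0..1} \<Longrightarrow> s \<in> cball 0 1 \<Longrightarrow> periodic (h u s)"
    and const: "\<And>u s \<theta>. u \<in> {0..1} \<Longrightarrow> s \<in> sphere 0 1 \<Longrightarrow> h u s \<theta> = h u s 0"
    and Y: "\<And>u s \<theta>. u \<in> {0..1} \<Longrightarrow> s \<in> cball 0 1 \<Longrightarrow> h u s \<theta> \<in> Y"
  shows "homotopic_with_canon collapsed cylinder Y (on_circle (h 0)) (on_circle (h 1))"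
proof -
  define g where "g = (\<lambda>(u, z, s). h u s (Arg z))"
  define q where "q = (\<lambda>(u :: real, \<theta>, s :: 'p). (u, cis \<theta>, s))"
  let ?A = "{0..1 :: real} \<times> period \<times> cball (0 :: 'p) 1"
  have "continuous_on (q ` ?A) g"
  proof (rule continuous_on_compact_quotient)
    show "compact ?A" by (intro compact_Times compact_Icc compact_cball)
    show "continuous_on ?A q" unfolding q_def case_prod_unfold by (intro continuous_intros continuous_on_cis)
    have "continuous_on ?A (\<lambda>x. (\<lambda>(u, s, \<theta>). h u s \<theta>) (fst x, snd (snd x), fst (snd x)))"
      by (rule continuous_on_compose2[OF cont]) (auto intro!: continuous_intros)
    moreover have "(\<lambda>(u, s, \<theta>). h u s \<theta>) (fst x, snd (snd x), fst (snd x)) = g (q x)" if xA: "x \<in> ?A" for x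
    proof -
      obtain u \<theta> s where x: "x = (u, \<theta>, s)" "u \<in> {0..1}" "s \<in> cball 0 1" using xA by auto
      show ?thesis using periodic_Arg_cis[OF per[OF x(2,3)], of \<theta>] by (simp add: x(1) g_def q_def)
    qed
    ultimately show "continuous_on ?A (\<lambda>x. g (q x))" by (rule continuous_on_eq)
  qed
  moreover have "q ` ?A = {0..1} \<times> cylinder"
  proof -
    have "q ` ?A = {0..1} \<times> (cis ` period) \<times> cball 0 1" by (auto simp: q_def image_def)
    thus ?thesis by (simp only: cis_image)
  qed
  ultimately have "continuous_on ({0..1} \<times> cylinder) g" by simp
  moreover have "g \<in> {0..1} \<times> cylinder \<rightarrow> Y"
  proof
    fix x :: "real \<times> complex \<times> 'p" assume "x \<in> {0..1} \<times> cylinder"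
    hence "fst x \<in> {0..1}" "snd (snd x) \<in> cball 0 1" by (simp_all add: mem_Times_iff)
    from Y[OF this] show "g x \<in> Y" by (simp add: g_def case_prod_unfold)
  qed
  moreover have "collapsed (\<lambda>x. g (u, x))" if "u \<in> {0..1}" for u
    unfolding collapsed_def
  proof
    fix s :: 'p assume s: "s \<in> sphere 0 1"
    have "g (u, z, s) = h u s 0" for z unfolding g_def prod.case by (rule const[OF that s])
    thus "\<exists>c. \<forall>z\<in>sphere 0 1. g (u, z, s) = c" by blast
  qed
  moreover have "prod_topology (top_of_set {0..1::real}) (top_of_set cylinder) =
      top_of_set ({0..1::real} \<times> (cylinder :: (complex \<times> 'p) set))"
    by (rule prod_topology_subtopology_eu)
  moreover have "g (u, x) = on_circle (h u) x" for u x by (simp add: g_def on_circle_def case_prod_unfold)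
  ultimately show ?thesis
    unfolding homotopic_with_def by (intro exI[of _ g]) simp
qed

text \<open>A modulus of continuity, uniform in \<open>s\<close>, in a form that can be integrated against the smoothing
  kernel: for \<open>y\<close> close to a multiple of \<open>2 \<pi>\<close> the term \<open>e\<close> suffices by uniform continuity, and
  elsewhere \<open>C (1 - cos y)\<close> exceeds the diameter of the image.\<close>

lemma loop_family_modulus:
  fixes \<gamma> :: "'p::euclidean_space \<Rightarrow> real \<Rightarrow> 'a::euclidean_space"
  assumes lf: "loop_family \<gamma>" and e: "e > 0"
  obtains C where "\<And>s \<theta> y. s \<in> cball 0 1 \<Longrightarrow> norm (\<gamma> s (\<theta> - y) - \<gamma> s \<theta>) \<le> e + C * (1 - cos y)"
proof -
  \<comment> \<open>The interval contains all differences of a number in \<open>[0, 2 \<pi>]\<close> and one in \<open>[- \<pi>, \<pi>]\<close>.\<close>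
  let ?S = "cball (0::'p) 1 \<times> {-10..20::real}"
  have c: "continuous_on ?S (\<lambda>(s, \<theta>). \<gamma> s \<theta>)"
    using lf unfolding loop_family_def by (auto intro: continuous_on_subset)
  have comp: "compact ?S" by (intro compact_Times) auto
  from compact_uniformly_continuous[OF c comp] obtain d where d: "d > 0"
    "\<And>x y. x \<in> ?S \<Longrightarrow> y \<in> ?S \<Longrightarrow> dist y x < d \<Longrightarrow> dist ((\<lambda>(s, \<theta>). \<gamma> s \<theta>) y) ((\<lambda>(s, \<theta>). \<gamma> s \<theta>) x) < e"
    unfolding uniformly_continuous_on_def using e by metis
  have "bounded ((\<lambda>(s, \<theta>). \<gamma> s \<theta>) ` ?S)" by (rule compact_imp_bounded[OF compact_continuous_image[OF c comp]])
  then obtain b where b: "b > 0" "\<And>x. x \<in> ?S \<Longrightarrow> norm ((\<lambda>(s, \<theta>). \<gamma> s \<theta>) x) \<le> b"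
    unfolding bounded_pos by auto
  define \<eta> where "\<eta> = min (d / 2) 1"
  have \<eta>: "0 < \<eta>" "\<eta> < d" "\<eta> \<le> 1" using d(1) by (auto simp: \<eta>_def)
  have pi4: "3 < pi" "pi < 4" using pi_gt3 pi_less_4 by auto
  have cn: "1 - cos \<eta> > 0"
  proof -
    have "cos \<eta> < cos 0" by (rule cos_monotone_0_pi) (use \<eta> pi4 in auto)
    thus ?thesis by simp
  qed
  define C where "C = 2 * b / (1 - cos \<eta>)"
  have C: "C > 0" using b(1) cn by (simp add: C_def)
  show ?thesis
  proof (rule that)
    fix s \<theta> y assume s: "s \<in> cball (0::'p) 1"
    have per: "periodic (\<gamma> s)" using lf s unfolding loop_family_def by blast
    obtain k :: int where k: "\<theta> + 2 * pi * of_int k \<in> {0..<0 + 2 * pi}" by (rule periodic_representative)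
    obtain m :: int where m: "y + 2 * pi * of_int m \<in> {- pi..<- pi + 2 * pi}" by (rule periodic_representative)
    define \<theta>' where "\<theta>' = \<theta> + 2 * pi * of_int k"
    define y' where "y' = y + 2 * pi * of_int m"
    have \<theta>': "0 \<le> \<theta>'" "\<theta>' \<le> 2 * pi" "\<gamma> s \<theta>' = \<gamma> s \<theta>" using k periodic_int[OF per] by (auto simp: \<theta>'_def)
    have y': "- pi \<le> y'" "y' \<le> pi" using m by (auto simp: y'_def)
    have "\<gamma> s (\<theta>' - y') = \<gamma> s ((\<theta> - y) + 2 * pi * of_int (k - m))" by (simp add: \<theta>'_def y'_def algebra_simps)
    hence e1: "\<gamma> s (\<theta>' - y') = \<gamma> s (\<theta> - y)" by (simp only: periodic_int[OF per])
    have e2: "cos y' = cos y" using cos_int_2pin[of m] sin_int_2pin[of m]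
      by (simp add: y'_def cos_add mult.commute mult.left_commute)
    have in1: "(s, \<theta>') \<in> ?S" "(s, \<theta>' - y') \<in> ?S" using s \<theta>' y' pi4 by auto
    have "norm (\<gamma> s (\<theta>' - y') - \<gamma> s \<theta>') \<le> e + C * (1 - cos y')"
    proof (cases "\<bar>y'\<bar> < d")
      case True
      hence "dist (s, \<theta>' - y') (s, \<theta>') < d" by (simp add: dist_Pair_Pair dist_real_def)
      from d(2)[OF in1(1,2) this] have "norm (\<gamma> s (\<theta>' - y') - \<gamma> s \<theta>') < e" by (simp add: dist_norm)
      moreover have "C * (1 - cos y') \<ge> 0" using C by simp
      ultimately show ?thesis by linarith
    next
      case False
      have "cos y' = cos \<bar>y'\<bar>" by simp
      also have "\<dots> \<le> cos \<eta>" by (rule cos_monotone_0_pi_le) (use \<eta> y' False in auto)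
      finally have "C * (1 - cos \<eta>) \<le> C * (1 - cos y')" using C by (intro mult_left_mono) auto
      moreover have "C * (1 - cos \<eta>) = 2 * b" using cn by (simp add: C_def)
      moreover have "norm (\<gamma> s (\<theta>' - y') - \<gamma> s \<theta>') \<le> b + b"
        using b(2)[OF in1(1)] b(2)[OF in1(2)] norm_triangle_ineq4[of "\<gamma> s (\<theta>' - y')" "\<gamma> s \<theta>'"] by simp
      ultimately show ?thesis using e by linarith
    qed
    thus "norm (\<gamma> s (\<theta> - y) - \<gamma> s \<theta>) \<le> e + C * (1 - cos y)" using e1 e2 \<theta>'(3) by simp
  qed
qed

lemma loop_family_curve:
  assumes "loop_family \<gamma>" "s \<in> cball 0 1"
  shows "periodic (\<gamma> s)" "continuous_on UNIV (\<gamma> s)"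
proof -
  show "periodic (\<gamma> s)" using assms unfolding loop_family_def by blast
  have "continuous_on UNIV (\<lambda>\<theta>. (\<lambda>(s, \<theta>). \<gamma> s \<theta>) (s, \<theta>))"
    by (rule continuous_on_compose2[where t = "cball 0 1 \<times> UNIV"])
      (use assms in \<open>auto simp: loop_family_def intro!: continuous_intros\<close>)
  thus "continuous_on UNIV (\<gamma> s)" by simp
qed

lemma continuous_smooth_coeffs:
  assumes "loop_family \<gamma>"
  shows "continuous_on (cball 0 1) (\<lambda>s. smooth_cos N (\<gamma> s) j)" "continuous_on (cball 0 1) (\<lambda>s. smooth_sin N (\<gamma> s) j)"
proof -
  have c: "continuous_on (cball 0 1 \<times> cbox 0 (2 * pi)) (\<lambda>x. (\<lambda>(s, \<theta>). \<gamma> s \<theta>) x)"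
    using assms unfolding loop_family_def by (auto intro: continuous_on_subset)
  have "continuous_on (cball 0 1 \<times> cbox 0 (2 * pi)) (\<lambda>x. cos (real j * snd x) *\<^sub>R (\<lambda>(s, \<theta>). \<gamma> s \<theta>) x)"
    "continuous_on (cball 0 1 \<times> cbox 0 (2 * pi)) (\<lambda>x. sin (real j * snd x) *\<^sub>R (\<lambda>(s, \<theta>). \<gamma> s \<theta>) x)"
    by (intro continuous_on_scaleR c, (auto intro!: continuous_intros)[1])+
  hence "continuous_on (cball 0 1) (\<lambda>s. integral (cbox 0 (2 * pi)) (\<lambda>y. cos (real j * y) *\<^sub>R \<gamma> s y))"
    "continuous_on (cball 0 1) (\<lambda>s. integral (cbox 0 (2 * pi)) (\<lambda>y. sin (real j * y) *\<^sub>R \<gamma> s y))"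
    by (intro integral_continuous_on_param, simp add: case_prod_unfold)+
  thus "continuous_on (cball 0 1) (\<lambda>s. smooth_cos N (\<gamma> s) j)" "continuous_on (cball 0 1) (\<lambda>s. smooth_sin N (\<gamma> s) j)"
    unfolding smooth_cos_def smooth_sin_def cbox_interval[symmetric] by (auto intro!: continuous_intros)
qed

lemma heat_family_continuous:
  fixes a b :: "'p::euclidean_space \<Rightarrow> nat \<Rightarrow> 'a::real_normed_vector"
  assumes "\<And>j. continuous_on S (\<lambda>s. a s j)" "\<And>j. continuous_on S (\<lambda>s. b s j)"
  shows "continuous_on (UNIV \<times> S \<times> UNIV) (\<lambda>(\<tau>, s, \<theta>). heat N (a s) (b s) \<tau> \<theta>)"
proof -
  have a: "continuous_on (UNIV \<times> S \<times> UNIV) (\<lambda>x. a (fst (snd x)) j)"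
    and b: "continuous_on (UNIV \<times> S \<times> UNIV) (\<lambda>x. b (fst (snd x)) j)" for j
    by (rule continuous_on_compose2[OF assms(1)], auto intro!: continuous_intros)
      (rule continuous_on_compose2[OF assms(2)], auto intro!: continuous_intros)
  show ?thesis unfolding heat_def trig_poly_def case_prod_unfold
    by (intro continuous_on_sum continuous_on_add continuous_on_scaleR a b) (auto intro!: continuous_intros)
qed

lemma smoothing_lipschitz_const:
  assumes "loop_family \<gamma>" "s \<in> sphere 0 1"
  shows "lipschitz_curve 0 (smoothing N (\<gamma> s))"
proof (rule lipschitz_curve_smoothing)
  have s: "s \<in> cball 0 1" using assms(2) by auto
  show "periodic (\<gamma> s)" "continuous_on UNIV (\<gamma> s)" by (rule loop_family_curve[OF assms(1) s])+
  have c: "\<gamma> s \<theta> = \<gamma> s 0" for \<theta> using assms unfolding loop_family_def by blast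
  have "norm (\<gamma> s \<theta> - \<gamma> s \<phi>) \<le> 0 * \<bar>\<theta> - \<phi>\<bar>" for \<theta> \<phi> unfolding c[of \<theta>] c[of \<phi>] by simp
  thus "lipschitz_curve 0 (\<gamma> s)" unfolding lipschitz_curve_def by blast
qed

lemma periodic_heat: "periodic (heat N a b \<tau>)"
  unfolding periodic_def heat_def using trig_poly_periodic by blast

lemma lipschitz_curve_0_const: "lipschitz_curve 0 f \<Longrightarrow> f \<theta> = f \<phi>"
  unfolding lipschitz_curve_def by simp

section \<open>Shortening a family of loops outside the flow\<close>

lemma trig_poly_second_derivative:
  "(trig_poly N (\<lambda>j. real j *\<^sub>R b j) (\<lambda>j. - (real j *\<^sub>R a j)) has_vector_derivative
    trig_poly N (\<lambda>j. - ((real j)\<^sup>2 *\<^sub>R a j)) (\<lambda>j. - ((real j)\<^sup>2 *\<^sub>R b j)) \<theta>) (at \<theta>)"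
  using trig_poly_derivative[of N "\<lambda>j. real j *\<^sub>R b j" "\<lambda>j. - (real j *\<^sub>R a j)" \<theta>]
  by (simp add: power2_eq_square)

lemma trig_family_continuous:
  fixes a b :: "'p::euclidean_space \<Rightarrow> nat \<Rightarrow> 'a::real_normed_vector"
  assumes "\<And>j. continuous_on S (\<lambda>s. a s j)" "\<And>j. continuous_on S (\<lambda>s. b s j)"
  shows "continuous_on (S \<times> UNIV) (\<lambda>(s, \<theta>). trig_poly N (a s) (b s) \<theta>)"
proof -
  have "continuous_on (S \<times> UNIV) (\<lambda>x. (\<lambda>(\<tau>, s, \<theta>). heat N (a s) (b s) \<tau> \<theta>) (0, fst x, snd x))"
    by (rule continuous_on_compose2[OF heat_family_continuous[OF assms]]) (auto intro!: continuous_intros)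
  thus ?thesis by (simp add: case_prod_unfold heat_0)
qed

context convex_flow
begin

text \<open>A sufficiently accurate smoothing is closer to the curves than the curves are to the compact body,
  so the linear homotopy does not meet the body.\<close>

lemma smoothing_homotopy:
  fixes \<gamma> :: "'p::euclidean_space \<Rightarrow> real \<Rightarrow> 'a"
  assumes t: "t \<in> I" and lf: "loop_family \<gamma>" and out: "\<And>s \<theta>. s \<in> cball 0 1 \<Longrightarrow> \<gamma> s \<theta> \<notin> K t" and p: "p \<in> K t"
  obtains N where "\<And>s \<theta>. s \<in> cball 0 1 \<Longrightarrow> smoothing N (\<gamma> s) \<theta> \<notin> K t"
    "homotopic_avoiding p (on_circle \<gamma>) (on_circle (\<lambda>s. smoothing N (\<gamma> s)))"
proof -
  note curve = loop_family_curve[OF lf]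
  let ?\<gamma> = "\<lambda>(s, \<theta>). \<gamma> s \<theta>"
  have cont: "continuous_on (cball 0 1 \<times> UNIV) ?\<gamma>" using lf unfolding loop_family_def by blast
  have "compact (cball (0::'p) 1 \<times> period)" by (intro compact_Times compact_cball compact_Icc)
  hence "compact (?\<gamma> ` (cball 0 1 \<times> period))"
    by (rule compact_continuous_image[OF continuous_on_subset[OF cont], rotated]) auto
  moreover have "closed (K t)" using K_facts(1)[OF t] compact_imp_closed by blast
  moreover have "?\<gamma> ` (cball 0 1 \<times> period) \<inter> K t = {}" using out by auto
  ultimately obtain d where d: "d > 0" "\<And>x y. x \<in> ?\<gamma> ` (cball 0 1 \<times> period) \<Longrightarrow> y \<in> K t \<Longrightarrow> d \<le> dist x y"
    using separate_compact_closed by metis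
  have far: "d \<le> dist (\<gamma> s \<theta>) y" if s: "s \<in> cball 0 1" and y: "y \<in> K t" for s \<theta> y
  proof -
    obtain k :: int where k: "\<theta> + 2 * pi * of_int k \<in> {0..<0 + 2 * pi}" by (rule periodic_representative)
    have "\<gamma> s (\<theta> + 2 * pi * of_int k) \<in> ?\<gamma> ` (cball 0 1 \<times> period)"
      using k s by (intro image_eqI[of _ _ "(s, \<theta> + 2 * pi * of_int k)"]) auto
    from d(2)[OF this y] show ?thesis unfolding periodic_int[OF curve(1)[OF s]] .
  qed
  obtain C where C: "\<And>s \<theta> y. s \<in> cball 0 1 \<Longrightarrow> norm (\<gamma> s (\<theta> - y) - \<gamma> s \<theta>) \<le> d / 2 + C * (1 - cos y)"
    using loop_family_modulus[OF lf, of "d / 2"] d(1) by auto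
  obtain N where N: "2 * C / d < real N" using reals_Archimedean2 by blast
  have "C / (real N + 1) < d / 2"
  proof -
    have "2 * C < d * (real N + 1)" using N d(1) by (simp add: field_simps)
    thus ?thesis by (simp add: field_simps)
  qed
  hence close: "norm (smoothing N (\<gamma> s) \<theta> - \<gamma> s \<theta>) < d" if "s \<in> cball 0 1" for s \<theta>
    using smoothing_error[OF curve[OF that] C[OF that], of N \<theta>] by linarith
  define h where "h u s \<theta> = \<gamma> s \<theta> + u *\<^sub>R (smoothing N (\<gamma> s) \<theta> - \<gamma> s \<theta>)" for u s \<theta>
  have h_out: "h u s \<theta> \<notin> K t" if "u \<in> {0..1}" and s: "s \<in> cball 0 1" for u s \<theta>
  proof
    assume "h u s \<theta> \<in> K t"
    hence "d \<le> dist (\<gamma> s \<theta>) (h u s \<theta>)" by (rule far[OF s])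
    also have "\<dots> = u * norm (smoothing N (\<gamma> s) \<theta> - \<gamma> s \<theta>)" using that(1) by (simp add: h_def dist_norm)
    also have "\<dots> \<le> 1 * norm (smoothing N (\<gamma> s) \<theta> - \<gamma> s \<theta>)" using that(1) by (intro mult_right_mono) auto
    finally show False using close[OF s, of \<theta>] by simp
  qed
  have conts: "continuous_on (cball 0 1 \<times> UNIV) (\<lambda>(s, \<theta>). smoothing N (\<gamma> s) \<theta>)"
    unfolding smoothing_def by (intro trig_family_continuous continuous_smooth_coeffs lf)
  have "homotopic_avoiding p (on_circle (h 0)) (on_circle (h 1))"
  proof (rule loop_family_homotopy)
    have c1: "continuous_on ({0..1} \<times> cball 0 1 \<times> UNIV) (\<lambda>x. ?\<gamma> (snd x))"
      by (rule continuous_on_compose2[OF cont]) (auto intro!: continuous_intros)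
    have c2: "continuous_on ({0..1} \<times> cball 0 1 \<times> UNIV) (\<lambda>x. (\<lambda>(s, \<theta>). smoothing N (\<gamma> s) \<theta>) (snd x))"
      by (rule continuous_on_compose2[OF conts]) (auto intro!: continuous_intros)
    have "continuous_on ({0..1} \<times> cball 0 1 \<times> UNIV)
       (\<lambda>x. ?\<gamma> (snd x) + fst x *\<^sub>R ((\<lambda>(s, \<theta>). smoothing N (\<gamma> s) \<theta>) (snd x) - ?\<gamma> (snd x)))"
      by (intro continuous_on_add continuous_on_scaleR continuous_on_diff c1 c2 continuous_on_fst continuous_on_id)
    thus "continuous_on ({0..1} \<times> cball 0 1 \<times> UNIV) (\<lambda>(u, s, \<theta>). h u s \<theta>)"
      by (simp add: h_def case_prod_unfold)
    show "periodic (h u s)" if "s \<in> cball 0 1" for u s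
      using curve(1)[OF that] unfolding periodic_def h_def smoothing_def trig_poly_periodic by simp
    show "h u s \<theta> = h u s 0" if "s \<in> sphere 0 1" for u s \<theta>
    proof -
      have "\<gamma> s \<theta> = \<gamma> s 0" using lf that unfolding loop_family_def by blast
      moreover have "smoothing N (\<gamma> s) \<theta> = smoothing N (\<gamma> s) 0"
        by (rule lipschitz_curve_0_const[OF smoothing_lipschitz_const[OF lf that]])
      ultimately show ?thesis by (simp only: h_def)
    qed
    show "h u s \<theta> \<in> - {p}" if "u \<in> {0..1}" "s \<in> cball 0 1" for u s \<theta> using h_out[OF that, of \<theta>] p by auto
  qed
  moreover have "h 0 = \<gamma>" "h 1 = (\<lambda>s. smoothing N (\<gamma> s))" by (auto simp: h_def fun_eq_iff)
  ultimately have hom: "homotopic_avoiding p (on_circle \<gamma>) (on_circle (\<lambda>s. smoothing N (\<gamma> s)))"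
    by (simp only:)
  have "smoothing N (\<gamma> s) \<theta> \<notin> K t" if "s \<in> cball 0 1" for s \<theta>
    using h_out[of 1, OF _ that, of \<theta>] by (simp add: h_def)
  from that[OF this hom] show ?thesis .
qed

text \<open>The heat flow preserves the bound \<open>l\<close> on the speed that the avoidance principle needs at all
  times.\<close>

lemma heat_avoids:
  fixes a b :: "nat \<Rightarrow> 'a"
  assumes t: "0 \<le> t" "t \<le> t1" "t1 \<in> I" and lip: "lipschitz_curve l (trig_poly N a b)" and c: "c \<ge> 0" "c * l\<^sup>2 < 1"
    and out: "\<And>\<theta>. trig_poly N a b \<theta> \<notin> K t" and r: "r \<in> {t..t1}"
  shows "heat N a b (c * (r - t)) \<theta> \<notin> K r"
proof -
  let ?e = "\<lambda>r j. exp (- ((real j)\<^sup>2 * (c * (r - t))))"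
  define \<gamma> where "\<gamma> r = heat N a b (c * (r - t))" for r
  define \<gamma>1 where "\<gamma>1 r = trig_poly N (\<lambda>j. real j *\<^sub>R ?e r j *\<^sub>R b j) (\<lambda>j. - (real j *\<^sub>R ?e r j *\<^sub>R a j))" for r
  define \<gamma>2 where "\<gamma>2 r = trig_poly N (\<lambda>j. - ((real j)\<^sup>2 *\<^sub>R ?e r j *\<^sub>R a j)) (\<lambda>j. - ((real j)\<^sup>2 *\<^sub>R ?e r j *\<^sub>R b j))" for r
  have d1: "(\<gamma> r has_vector_derivative \<gamma>1 r \<theta>) (at \<theta>)" for r \<theta>
    unfolding \<gamma>_def \<gamma>1_def heat_def by (rule trig_poly_derivative)
  have "\<gamma> r \<theta> \<notin> K r"
  proof (rule avoidance_principle[OF t, of \<gamma> \<gamma>1 \<gamma>2 c, OF _ _ d1 _ _ c(1) _ _ r])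
    have "continuous_on ({t..t1} \<times> UNIV) (\<lambda>x. (\<lambda>(\<tau>, s :: 'a, \<theta>). heat N a b \<tau> \<theta>) (c * (fst x - t), 0, snd x))"
      by (rule continuous_on_compose2[OF heat_family_continuous[of "UNIV :: 'a set"]]) (auto intro!: continuous_intros)
    thus "continuous_on ({t..t1} \<times> UNIV) (\<lambda>(t, \<theta>). \<gamma> t \<theta>)" by (simp add: \<gamma>_def case_prod_unfold)
    show "periodic (\<gamma> r)" for r unfolding \<gamma>_def by (rule periodic_heat)
    show "(\<gamma>1 r has_vector_derivative \<gamma>2 r \<theta>) (at \<theta>)" for r \<theta>
      unfolding \<gamma>1_def \<gamma>2_def by (rule trig_poly_second_derivative)
    show "((\<lambda>s. \<gamma> s \<theta>) has_vector_derivative c *\<^sub>R \<gamma>2 r \<theta>) (at r within {t..r})" for r \<theta>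
    proof (rule has_vector_derivative_at_within)
      have "((\<lambda>r. c * (r - t)) has_vector_derivative c) (at r)"
        unfolding has_real_derivative_iff_has_vector_derivative[symmetric] by (auto intro!: derivative_eq_intros)
      from vector_diff_chain_at[OF this heat_equation]
      show "((\<lambda>s. \<gamma> s \<theta>) has_vector_derivative c *\<^sub>R \<gamma>2 r \<theta>) (at r)" unfolding \<gamma>_def \<gamma>2_def o_def .
    qed
    show "c * (norm (\<gamma>1 r \<theta>))\<^sup>2 < 1" if "r \<in> {t<..t1}" for r \<theta>
    proof -
      have "c * (r - t) \<ge> 0" using c(1) that by simp
      hence "lipschitz_curve l (\<gamma> r)" unfolding \<gamma>_def by (rule lipschitz_curve_heat[OF lip])
      hence "norm (\<gamma>1 r \<theta>) \<le> l" using d1 by (rule lipschitz_curve_derivative)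
      hence "c * (norm (\<gamma>1 r \<theta>))\<^sup>2 \<le> c * l\<^sup>2" using c(1) by (intro mult_left_mono power_mono) auto
      thus ?thesis using c(2) by simp
    qed
    show "\<gamma> t \<theta> \<notin> K t" for \<theta> using out by (simp add: \<gamma>_def heat_0)
  qed
  thus ?thesis by (simp add: \<gamma>_def)
qed

lemma heat_homotopy:
  fixes a b :: "'p::euclidean_space \<Rightarrow> nat \<Rightarrow> 'a"
  assumes t: "0 \<le> t" "t \<le> t1" "t1 \<in> I"
    and ca: "\<And>j. continuous_on (cball 0 1) (\<lambda>s. a s j)" and cb: "\<And>j. continuous_on (cball 0 1) (\<lambda>s. b s j)"
    and lip: "\<And>s. s \<in> cball 0 1 \<Longrightarrow> lipschitz_curve l (trig_poly N (a s) (b s))"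
    and lip0: "\<And>s. s \<in> sphere 0 1 \<Longrightarrow> lipschitz_curve 0 (trig_poly N (a s) (b s))"
    and c: "c \<ge> 0" "c * l\<^sup>2 < 1"
    and out: "\<And>s \<theta>. s \<in> cball 0 1 \<Longrightarrow> trig_poly N (a s) (b s) \<theta> \<notin> K t" and p: "p \<in> K t1"
  shows "homotopic_avoiding p
    (on_circle (\<lambda>s. trig_poly N (a s) (b s))) (on_circle (\<lambda>s. heat N (a s) (b s) (c * (t1 - t))))"
proof -
  define h where "h u s = heat N (a s) (b s) (c * (t + u * (t1 - t) - t))" for u s
  have "homotopic_avoiding p (on_circle (h 0)) (on_circle (h 1))"
  proof (rule loop_family_homotopy)
    have "continuous_on ({0..1} \<times> cball 0 1 \<times> UNIV)
        (\<lambda>x. (\<lambda>(\<tau>, s, \<theta>). heat N (a s) (b s) \<tau> \<theta>) (c * (t + fst x * (t1 - t) - t), fst (snd x), snd (snd x)))"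
      by (rule continuous_on_compose2[OF heat_family_continuous[OF ca cb]]) (auto intro!: continuous_intros)
    thus "continuous_on ({0..1} \<times> cball 0 1 \<times> UNIV) (\<lambda>(u, s, \<theta>). h u s \<theta>)"
      by (simp add: h_def case_prod_unfold)
    show "periodic (h u s)" for u s unfolding h_def by (rule periodic_heat)
    show "h u s \<theta> = h u s 0" if "u \<in> {0..1}" "s \<in> sphere 0 1" for u s \<theta>
    proof (rule lipschitz_curve_0_const)
      show "lipschitz_curve 0 (h u s)"
        unfolding h_def using that(1) c(1) t(2) by (intro lipschitz_curve_heat lip0[OF that(2)]) auto
    qed
    show "h u s \<theta> \<in> - {p}" if "u \<in> {0..1}" "s \<in> cball 0 1" for u s \<theta>
    proof -
      have "u * (t1 - t) \<le> 1 * (t1 - t)" using that(1) t(2) by (intro mult_right_mono) auto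
      hence r: "t + u * (t1 - t) \<in> {t..t1}" using that(1) t(2) by auto
      have "h u s \<theta> \<notin> K (t + u * (t1 - t))" unfolding h_def
        by (rule heat_avoids[OF t lip[OF that(2)] c out[OF that(2)] r])
      moreover have "p \<in> K (t + u * (t1 - t))" using K_antimono[of "t + u * (t1 - t)" t1] r t p by auto
      ultimately show ?thesis by auto
    qed
  qed
  moreover have "h 0 = (\<lambda>s. trig_poly N (a s) (b s))" "h 1 = (\<lambda>s. heat N (a s) (b s) (c * (t1 - t)))"
    by (auto simp: h_def fun_eq_iff heat_0)
  ultimately show ?thesis by simp
qed

lemma reparametrization_homotopy:
  fixes a b :: "'p::euclidean_space \<Rightarrow> nat \<Rightarrow> 'a"
  assumes ca: "\<And>j. continuous_on (cball 0 1) (\<lambda>s. a s j)" and cb: "\<And>j. continuous_on (cball 0 1) (\<lambda>s. b s j)"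
    and lip0: "\<And>s. s \<in> sphere 0 1 \<Longrightarrow> lipschitz_curve 0 (trig_poly N (a s) (b s))"
    and len: "\<And>s. s \<in> cball 0 1 \<Longrightarrow> trig_length N (a s) (b s) \<le> L" and R: "L < 2 * pi * R" "R > 0"
    and out: "\<And>s \<theta>. s \<in> cball 0 1 \<Longrightarrow> trig_poly N (a s) (b s) \<theta> \<notin> K t" and p: "p \<in> K t"
  obtains \<delta> where "loop_family \<delta>" "\<And>s. s \<in> cball 0 1 \<Longrightarrow> lipschitz_curve R (\<delta> s)"
    "\<And>s \<theta>. s \<in> cball 0 1 \<Longrightarrow> \<delta> s \<theta> \<notin> K t"
    "homotopic_avoiding p (on_circle (\<lambda>s. trig_poly N (a s) (b s))) (on_circle \<delta>)"
proof -
  let ?Q = "\<lambda>s. trig_poly N (a s) (b s)"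
  let ?dQ = "\<lambda>s. trig_poly N (\<lambda>j. real j *\<^sub>R b s j) (\<lambda>j. - (real j *\<^sub>R a s j))"
  have contQ: "continuous_on (cball 0 1 \<times> UNIV) (\<lambda>(s, \<theta>). ?Q s \<theta>)" by (rule trig_family_continuous[OF ca cb])
  have contdQ: "continuous_on (cball 0 1 \<times> UNIV) (\<lambda>(s, \<theta>). ?dQ s \<theta>)"
    by (rule trig_family_continuous) (intro continuous_intros ca cb)+
  have perQ: "periodic (?Q s)" "periodic (?dQ s)" for s unfolding periodic_def by (simp_all add: trig_poly_periodic)
  obtain \<psi> where \<psi>: "continuous_on (cball 0 1 \<times> UNIV) (\<lambda>(s, \<theta>). \<psi> s \<theta>)"
    "\<And>s \<theta>. s \<in> cball 0 1 \<Longrightarrow> \<psi> s (\<theta> + 2 * pi) = \<psi> s \<theta> + 2 * pi"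
    "\<And>s. s \<in> cball 0 1 \<Longrightarrow> lipschitz_curve R (\<lambda>\<theta>. ?Q s (\<psi> s \<theta>))"
    by (rule reparametrize[OF contdQ trig_poly_derivative perQ(2) len[unfolded trig_length_def] R])
      (assumption | rule that)+
  define h where "h u s \<theta> = ?Q s (\<theta> + u * (\<psi> s \<theta> - \<theta>))" for u s \<theta>
  have cont: "continuous_on ({0..1} \<times> cball 0 1 \<times> UNIV) (\<lambda>(u, s, \<theta>). h u s \<theta>)"
  proof -
    have "continuous_on ({0..1} \<times> cball 0 1 \<times> UNIV) (\<lambda>x. (\<lambda>(s, \<theta>). \<psi> s \<theta>) (snd x))"
      by (rule continuous_on_compose2[OF \<psi>(1)]) (auto intro!: continuous_intros)
    hence c: "continuous_on ({0..1} \<times> cball 0 1 \<times> UNIV)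
        (\<lambda>x. (fst (snd x), snd (snd x) + fst x * ((\<lambda>(s, \<theta>). \<psi> s \<theta>) (snd x) - snd (snd x))))"
      by (intro continuous_on_Pair continuous_on_add continuous_on_mult continuous_on_diff continuous_on_fst continuous_on_snd continuous_on_id)
    have "continuous_on ({0..1} \<times> cball 0 1 \<times> UNIV)
        (\<lambda>x. (\<lambda>(s, \<theta>). ?Q s \<theta>) (fst (snd x), snd (snd x) + fst x * ((\<lambda>(s, \<theta>). \<psi> s \<theta>) (snd x) - snd (snd x))))"
      by (rule continuous_on_compose2[OF contQ c]) auto
    thus ?thesis by (simp add: h_def case_prod_unfold)
  qed
  have per: "periodic (h u s)" if s: "s \<in> cball 0 1" for u s
    unfolding periodic_def
  proof
    fix \<theta>
    have "h u s (\<theta> + 2 * pi) = ?Q s ((\<theta> + u * (\<psi> s \<theta> - \<theta>)) + 2 * pi)"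
      unfolding h_def \<psi>(2)[OF s] by (simp add: algebra_simps)
    thus "h u s (\<theta> + 2 * pi) = h u s \<theta>" unfolding h_def trig_poly_periodic .
  qed
  have const: "h u s \<theta> = h u s 0" if "s \<in> sphere 0 1" for u s \<theta>
    unfolding h_def by (rule lipschitz_curve_0_const[OF lip0[OF that]])
  have "homotopic_avoiding p (on_circle (h 0)) (on_circle (h 1))"
  proof (rule loop_family_homotopy[OF cont per const])
    show "h u s \<theta> \<in> - {p}" if "s \<in> cball 0 1" for u s \<theta>
    proof -
      have "h u s \<theta> \<notin> K t" unfolding h_def by (rule out[OF that])
      thus ?thesis using p by auto
    qed
  qed
  moreover have "h 0 = ?Q" by (simp add: h_def fun_eq_iff)
  ultimately have hom: "homotopic_avoiding p (on_circle ?Q) (on_circle (h 1))" by (simp only:)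
  have lf: "loop_family (h 1)"
    unfolding loop_family_def
  proof (intro conjI ballI allI)
    have "continuous_on (cball 0 1 \<times> UNIV) (\<lambda>x. (\<lambda>(u, s, \<theta>). h u s \<theta>) (1, fst x, snd x))"
      by (rule continuous_on_compose2[OF cont]) (auto intro!: continuous_intros)
    thus "continuous_on (cball 0 1 \<times> UNIV) (\<lambda>(s, \<theta>). h 1 s \<theta>)" by (simp add: case_prod_unfold)
  qed (rule per const, assumption)+
  have lip: "lipschitz_curve R (h 1 s)" if "s \<in> cball 0 1" for s
    using \<psi>(3)[OF that] by (simp add: h_def[abs_def])
  have "h 1 s \<theta> \<notin> K t" if "s \<in> cball 0 1" for s \<theta> unfolding h_def by (rule out[OF that])
  from that[OF lf lip this hom] show ?thesis .
qed

text \<open>The curves are smoothed, moved by the heat flow with speed \<open>\<kappa> / l\<^sup>2\<close>, and reparametrized.  An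
  \<open>l\<close>-Lipschitz closed curve has energy at most \<open>2 \<pi> l\<^sup>2\<close>; the heat flow lowers this by the factor
  \<open>exp (- 2 \<kappa> (t1 - t) / l\<^sup>2)\<close>, and the Cauchy-Schwarz inequality bounds the length.\<close>

lemma shortening_step:
  fixes \<gamma> :: "'p::euclidean_space \<Rightarrow> real \<Rightarrow> 'a"
  assumes t: "0 \<le> t" "t \<le> t1" "t1 \<in> I" and lf: "loop_family \<gamma>"
    and lip: "\<And>s. s \<in> cball 0 1 \<Longrightarrow> lipschitz_curve l (\<gamma> s)" and l: "l > 0"
    and out: "\<And>s \<theta>. s \<in> cball 0 1 \<Longrightarrow> \<gamma> s \<theta> \<notin> K t" and p: "p \<in> K t1"
    and \<kappa>: "0 \<le> \<kappa>" "\<kappa> < 1" and R: "l * exp (- (\<kappa> * (t1 - t) / l\<^sup>2)) < R"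
  obtains \<delta> where "loop_family \<delta>" "\<And>s. s \<in> cball 0 1 \<Longrightarrow> lipschitz_curve R (\<delta> s)"
    "\<And>s \<theta>. s \<in> cball 0 1 \<Longrightarrow> \<delta> s \<theta> \<notin> K t1"
    "homotopic_avoiding p (on_circle \<gamma>) (on_circle \<delta>)"
proof -
  have tI: "t \<in> I" using I_mono[OF t(3,1,2)] .
  have pt: "p \<in> K t" using K_antimono[OF t] p by blast
  obtain N where N: "\<And>s \<theta>. s \<in> cball 0 1 \<Longrightarrow> smoothing N (\<gamma> s) \<theta> \<notin> K t"
    "homotopic_avoiding p (on_circle \<gamma>) (on_circle (\<lambda>s. smoothing N (\<gamma> s)))"
    by (rule smoothing_homotopy[OF tI lf out pt]) (assumption | rule that)+
  define a where "a s = smooth_cos N (\<gamma> s)" for s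
  define b where "b s = smooth_sin N (\<gamma> s)" for s
  have ca: "continuous_on (cball 0 1) (\<lambda>s. a s j)" and cb: "continuous_on (cball 0 1) (\<lambda>s. b s j)" for j
    unfolding a_def b_def by (rule continuous_smooth_coeffs[OF lf])+
  have sm: "smoothing N (\<gamma> s) = trig_poly N (a s) (b s)" for s by (simp add: smoothing_def a_def b_def)
  have lips: "lipschitz_curve l (trig_poly N (a s) (b s))" if "s \<in> cball 0 1" for s
    unfolding sm[symmetric] by (rule lipschitz_curve_smoothing[OF loop_family_curve[OF lf that] lip[OF that]])
  have lip0: "lipschitz_curve 0 (trig_poly N (a s) (b s))" if "s \<in> sphere 0 1" for s
    unfolding sm[symmetric] by (rule smoothing_lipschitz_const[OF lf that])
  define c where "c = \<kappa> / l\<^sup>2"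
  have c: "c \<ge> 0" "c * l\<^sup>2 < 1" using \<kappa> l by (auto simp: c_def)
  define \<tau> where "\<tau> = c * (t1 - t)"
  have \<tau>: "\<tau> \<ge> 0" using c(1) t(2) by (simp add: \<tau>_def)
  note hh = heat_homotopy[OF t ca cb lips lip0 c N(1)[unfolded sm] p]
  define a' where "a' s j = exp (- ((real j)\<^sup>2 * \<tau>)) *\<^sub>R a s j" for s j
  define b' where "b' s j = exp (- ((real j)\<^sup>2 * \<tau>)) *\<^sub>R b s j" for s j
  have ht: "heat N (a s) (b s) \<tau> = trig_poly N (a' s) (b' s)" for s by (simp add: heat_def a'_def[abs_def] b'_def[abs_def])
  have ca': "continuous_on (cball 0 1) (\<lambda>s. a' s j)" and cb': "continuous_on (cball 0 1) (\<lambda>s. b' s j)" for j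
    unfolding a'_def b'_def by (intro continuous_intros ca cb)+
  have lip0': "lipschitz_curve 0 (trig_poly N (a' s) (b' s))" if "s \<in> sphere 0 1" for s
    unfolding ht[symmetric] by (rule lipschitz_curve_heat[OF lip0[OF that] \<tau>])
  have out': "trig_poly N (a' s) (b' s) \<theta> \<notin> K t1" if "s \<in> cball 0 1" for s \<theta>
    unfolding ht[symmetric] \<tau>_def
    by (rule heat_avoids[OF t lips[OF that] c N(1)[OF that, unfolded sm]]) (use t in auto)
  have len: "trig_length N (a' s) (b' s) \<le> 2 * pi * (l * exp (- \<tau>))" if "s \<in> cball 0 1" for s
  proof -
    have "trig_length N (a' s) (b' s) \<le> sqrt (2 * pi * trig_energy N (a' s) (b' s))" by (rule trig_length_le)
    also have "\<dots> \<le> sqrt (2 * pi * (exp (- (2 * \<tau>)) * (2 * pi * l\<^sup>2)))"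
    proof (intro real_sqrt_le_mono mult_left_mono)
      have "trig_energy N (a' s) (b' s) \<le> exp (- (2 * \<tau>)) * trig_energy N (a s) (b s)"
        unfolding a'_def[abs_def] b'_def[abs_def] by (rule trig_energy_heat[OF \<tau>])
      also have "\<dots> \<le> exp (- (2 * \<tau>)) * (2 * pi * l\<^sup>2)"
        by (intro mult_left_mono trig_energy_lipschitz lips that) simp
      finally show "trig_energy N (a' s) (b' s) \<le> exp (- (2 * \<tau>)) * (2 * pi * l\<^sup>2)" .
    qed simp
    also have "2 * pi * (exp (- (2 * \<tau>)) * (2 * pi * l\<^sup>2)) = (2 * pi * (l * exp (- \<tau>)))\<^sup>2"
    proof -
      have "exp (- (2 * \<tau>)) = (exp (- \<tau>))\<^sup>2" by (simp add: power2_eq_square exp_add[symmetric])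
      thus ?thesis by (simp add: power2_eq_square)
    qed
    also have "sqrt \<dots> = 2 * pi * (l * exp (- \<tau>))" using l by (simp add: real_sqrt_abs abs_of_nonneg)
    finally show ?thesis .
  qed
  have "l * exp (- \<tau>) < R" using R by (simp add: \<tau>_def c_def)
  hence R': "2 * pi * (l * exp (- \<tau>)) < 2 * pi * R" by simp
  have "0 < l * exp (- \<tau>)" using l by simp
  with \<open>l * exp (- \<tau>) < R\<close> have R0: "R > 0" by linarith
  obtain \<delta> where \<delta>: "loop_family \<delta>" "\<And>s. s \<in> cball 0 1 \<Longrightarrow> lipschitz_curve R (\<delta> s)"
    "\<And>s \<theta>. s \<in> cball 0 1 \<Longrightarrow> \<delta> s \<theta> \<notin> K t1"
    "homotopic_avoiding p (on_circle (\<lambda>s. trig_poly N (a' s) (b' s))) (on_circle \<delta>)"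
    by (rule reparametrization_homotopy[OF ca' cb' lip0' len R' R0 out' p]) (assumption | rule that)+
  have "homotopic_avoiding p (on_circle \<gamma>) (on_circle \<delta>)"
    using homotopic_with_trans[OF N(2)[unfolded sm] homotopic_with_trans[OF hh[folded \<tau>_def, unfolded ht] \<delta>(4)]] .
  thus ?thesis using that[of \<delta>] \<delta>(1-3) by blast
qed


text \<open>The time steps are proportional to the square of the Lipschitz constant, so that each step lowers
  the Lipschitz constant by the same factor \<open>q\<close>.  The steps form a geometric series whose sum is
  the available time \<open>T'\<close>.\<close>

lemma shortening_iteration:
  fixes \<gamma> :: "'p::euclidean_space \<Rightarrow> real \<Rightarrow> 'a"
  assumes lf: "loop_family \<gamma>" and lip: "\<And>s. s \<in> cball 0 1 \<Longrightarrow> lipschitz_curve l (\<gamma> s)" and l: "l > 0"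
    and out: "\<And>s \<theta>. s \<in> cball 0 1 \<Longrightarrow> \<gamma> s \<theta> \<notin> K 0" and T: "T' \<in> I" "T' > 0" and p: "p \<in> K T'"
    and \<kappa>: "0 \<le> \<kappa>" "\<kappa> < 1" and q: "0 < q" "q < 1" "exp (- (\<kappa> * \<mu>)) < q" and \<mu>: "\<mu> > 0" "\<mu> * l\<^sup>2 \<le> (1 - q\<^sup>2) * T'"
  shows "\<exists>\<delta>. loop_family \<delta> \<and> (\<forall>s\<in>cball 0 1. lipschitz_curve (q ^ k * l) (\<delta> s)) \<and>
    (\<forall>s\<in>cball 0 1. \<forall>\<theta>. \<delta> s \<theta> \<notin> K ((1 - q ^ (2 * k)) * T')) \<and>
    homotopic_avoiding p (on_circle \<gamma>) (on_circle \<delta>)"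
proof (induction k)
  case 0
  have "continuous_on cylinder (on_circle \<gamma>) \<and> on_circle \<gamma> \<in> cylinder \<rightarrow> - {p}"
    and "homotopic_avoiding p (on_circle \<gamma>) (on_circle \<gamma>)"
  proof -
    have c: "continuous_on (cball 0 1 \<times> UNIV) (\<lambda>(s, \<theta>). \<gamma> s \<theta>)" using lf unfolding loop_family_def by blast
    show h: "homotopic_avoiding p (on_circle \<gamma>) (on_circle \<gamma>)"
    proof (rule loop_family_homotopy[of "\<lambda>_. \<gamma>"])
      have "continuous_on ({0..1} \<times> cball 0 1 \<times> UNIV) (\<lambda>x :: real \<times> _. (\<lambda>(s, \<theta>). \<gamma> s \<theta>) (snd x))"
        by (rule continuous_on_compose2[OF c]) (auto intro!: continuous_intros)
      thus "continuous_on ({0..1} \<times> cball 0 1 \<times> UNIV) (\<lambda>(u :: real, s, \<theta>). \<gamma> s \<theta>)" by (simp add: case_prod_unfold)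
      show "periodic (\<gamma> s)" if "s \<in> cball 0 1" for s using lf that unfolding loop_family_def by blast
      show "\<gamma> s \<theta> = \<gamma> s 0" if "s \<in> sphere 0 1" for s \<theta> using lf that unfolding loop_family_def by blast
      have "p \<in> K 0" using K_antimono[OF _ less_imp_le[OF T(2)] T(1)] p by auto
      thus "\<gamma> s \<theta> \<in> - {p}" if "s \<in> cball 0 1" for s \<theta> using out[OF that, of \<theta>] by auto
    qed
    from homotopic_with_imp_continuous_maps[OF h]
    show "continuous_on cylinder (on_circle \<gamma>) \<and> on_circle \<gamma> \<in> cylinder \<rightarrow> - {p}" by simp
  qed
  thus ?case using lf lip out by (intro exI[of _ \<gamma>]) auto
next
  case (Suc k)
  then obtain \<delta> where \<delta>: "loop_family \<delta>" "\<forall>s\<in>cball 0 1. lipschitz_curve (q ^ k * l) (\<delta> s)"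
    "\<forall>s\<in>cball 0 1. \<forall>\<theta>. \<delta> s \<theta> \<notin> K ((1 - q ^ (2 * k)) * T')"
    "homotopic_avoiding p (on_circle \<gamma>) (on_circle \<delta>)" by blast
  define t where "t = (1 - q ^ (2 * k)) * T'"
  define t1 where "t1 = (1 - q ^ (2 * Suc k)) * T'"
  define lk where "lk = q ^ k * l"
  have lk: "lk > 0" using q l by (simp add: lk_def)
  have q2: "q ^ (2 * k) \<le> 1" "q ^ (2 * Suc k) \<ge> 0" using q by (auto intro!: power_le_one)
  have q3: "q ^ (2 * Suc k) \<le> q ^ (2 * k)" using q by (intro power_decreasing) auto
  have t: "0 \<le> t" "t \<le> t1" "t1 \<le> T'"
  proof -
    show "0 \<le> t" using q2 T(2) by (simp add: t_def)
    show "t \<le> t1" unfolding t_def t1_def using q3 T(2) by (intro mult_right_mono) auto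
    have "(1 - q ^ (2 * Suc k)) * T' \<le> 1 * T'" using q2 T(2) by (intro mult_right_mono) auto
    thus "t1 \<le> T'" by (simp add: t1_def)
  qed
  have t1I: "t1 \<in> I" using I_mono[OF T(1), of t1] t by simp
  have pt1: "p \<in> K t1" using K_antimono[of t1 T'] t T(1) p by auto
  have R: "lk * exp (- (\<kappa> * (t1 - t) / lk\<^sup>2)) < q ^ Suc k * l"
  proof -
    have "\<mu> * lk\<^sup>2 = q ^ (2 * k) * (\<mu> * l\<^sup>2)" by (simp add: lk_def power_mult_distrib power_mult[symmetric] mult.commute)
    also have "\<dots> \<le> q ^ (2 * k) * ((1 - q\<^sup>2) * T')" using \<mu>(2) q by (intro mult_left_mono) auto
    also have "\<dots> = t1 - t" by (simp add: t1_def t_def power_add[symmetric] algebra_simps power2_eq_square)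
    finally have "\<mu> \<le> (t1 - t) / lk\<^sup>2" using lk by (simp add: pos_le_divide_eq)
    hence "\<kappa> * \<mu> \<le> \<kappa> * (t1 - t) / lk\<^sup>2" using \<kappa>(1) mult_left_mono by fastforce
    hence "exp (- (\<kappa> * (t1 - t) / lk\<^sup>2)) \<le> exp (- (\<kappa> * \<mu>))" by simp
    also have "\<dots> < q" by (rule q(3))
    finally have "lk * exp (- (\<kappa> * (t1 - t) / lk\<^sup>2)) < lk * q" using lk by (rule mult_strict_left_mono)
    thus ?thesis by (simp add: lk_def mult_ac)
  qed
  obtain \<epsilon> where \<epsilon>: "loop_family \<epsilon>" "\<And>s. s \<in> cball 0 1 \<Longrightarrow> lipschitz_curve (q ^ Suc k * l) (\<epsilon> s)"
    "\<And>s \<theta>. s \<in> cball 0 1 \<Longrightarrow> \<epsilon> s \<theta> \<notin> K t1"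
    "homotopic_avoiding p (on_circle \<delta>) (on_circle \<epsilon>)"
    by (rule shortening_step[OF t(1,2) t1I \<delta>(1) bspec[OF \<delta>(2)[folded lk_def]] lk
          spec[OF bspec[OF \<delta>(3)[folded t_def]]] pt1 \<kappa> R]) (assumption | rule that)+
  have "homotopic_avoiding p (on_circle \<gamma>) (on_circle \<epsilon>)"
    by (rule homotopic_with_trans[OF \<delta>(4) \<epsilon>(4)])
  thus ?case using \<epsilon>(1-3) unfolding t1_def by (intro exI[of _ \<epsilon>]) simp
qed

text \<open>Each curve is contracted linearly to one of its points, which moves no point by \<open>r\<close> or more.
  Afterwards the ball of parameters is contracted to its center.\<close>

lemma short_family_contractible:
  fixes \<gamma> :: "'p::euclidean_space \<Rightarrow> real \<Rightarrow> 'a"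
  assumes lf: "loop_family \<gamma>" and lip: "\<And>s. s \<in> cball 0 1 \<Longrightarrow> lipschitz_curve l (\<gamma> s)"
    and far: "\<And>s \<theta>. s \<in> cball 0 1 \<Longrightarrow> r \<le> dist p (\<gamma> s \<theta>)" and l: "2 * pi * l < r" "l \<ge> 0"
  shows "homotopic_avoiding p (on_circle \<gamma>) (\<lambda>_. \<gamma> 0 0)"
proof -
  have c: "continuous_on (cball 0 1 \<times> UNIV) (\<lambda>(s, \<theta>). \<gamma> s \<theta>)" using lf unfolding loop_family_def by blast
  have per: "periodic (\<gamma> s)" if "s \<in> cball 0 1" for s using lf that unfolding loop_family_def by blast
  have const: "\<gamma> s \<theta> = \<gamma> s 0" if "s \<in> sphere 0 1" for s \<theta> using lf that unfolding loop_family_def by blast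
  have r: "r > 0"
  proof -
    have "0 \<le> 2 * pi * l" using l(2) by simp
    thus ?thesis using l(1) by linarith
  qed
  have close: "norm (\<gamma> s 0 - \<gamma> s \<theta>) < r" if s: "s \<in> cball 0 1" for s \<theta>
  proof -
    obtain k :: int where k: "\<theta> + 2 * pi * of_int k \<in> {0..<0 + 2 * pi}" by (rule periodic_representative)
    have "norm (\<gamma> s 0 - \<gamma> s (\<theta> + 2 * pi * of_int k)) \<le> l * \<bar>0 - (\<theta> + 2 * pi * of_int k)\<bar>"
      using lip[OF s] unfolding lipschitz_curve_def by blast
    also have "\<dots> \<le> l * (2 * pi)" using k l(2) by (intro mult_left_mono) auto
    also have "\<dots> < r" using l(1) by (simp add: mult.commute)
    finally show ?thesis unfolding periodic_int[OF per[OF s]] .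
  qed
  define h where "h u s \<theta> = \<gamma> s \<theta> + u *\<^sub>R (\<gamma> s 0 - \<gamma> s \<theta>)" for u s \<theta>
  have 1: "homotopic_avoiding p (on_circle (h 0)) (on_circle (h 1))"
  proof (rule loop_family_homotopy)
    have c1: "continuous_on ({0..1} \<times> cball 0 1 \<times> UNIV) (\<lambda>x :: real \<times> _. (\<lambda>(s, \<theta>). \<gamma> s \<theta>) (snd x))"
      by (rule continuous_on_compose2[OF c]) (auto intro!: continuous_intros)
    have c2: "continuous_on ({0..1} \<times> cball 0 1 \<times> UNIV) (\<lambda>x :: real \<times> 'p \<times> real. (\<lambda>(s, \<theta>). \<gamma> s \<theta>) (fst (snd x), 0))"
      by (rule continuous_on_compose2[OF c]) (auto intro!: continuous_intros)
    have "continuous_on ({0..1} \<times> cball 0 1 \<times> UNIV) (\<lambda>x :: real \<times> 'p \<times> real.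
        (\<lambda>(s, \<theta>). \<gamma> s \<theta>) (snd x) + fst x *\<^sub>R ((\<lambda>(s, \<theta>). \<gamma> s \<theta>) (fst (snd x), 0) - (\<lambda>(s, \<theta>). \<gamma> s \<theta>) (snd x)))"
      by (intro continuous_on_add continuous_on_scaleR continuous_on_diff c1 c2 continuous_on_fst continuous_on_id)
    thus "continuous_on ({0..1} \<times> cball 0 1 \<times> UNIV) (\<lambda>(u, s, \<theta>). h u s \<theta>)"
      by (simp add: h_def case_prod_unfold)
    show "periodic (h u s)" if "s \<in> cball 0 1" for u s using per[OF that] unfolding periodic_def h_def by simp
    show "h u s \<theta> = h u s 0" if "s \<in> sphere 0 1" for u s \<theta> unfolding h_def const[OF that, of \<theta>] ..
    show "h u s \<theta> \<in> - {p}" if "u \<in> {0..1}" "s \<in> cball 0 1" for u s \<theta>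
    proof -
      have "dist (h u s \<theta>) (\<gamma> s \<theta>) = u * norm (\<gamma> s 0 - \<gamma> s \<theta>)" using that(1) by (simp add: h_def dist_norm)
      also have "\<dots> \<le> 1 * norm (\<gamma> s 0 - \<gamma> s \<theta>)" using that(1) by (intro mult_right_mono) auto
      finally have "dist (h u s \<theta>) (\<gamma> s \<theta>) < r" using close[OF that(2), of \<theta>] by simp
      thus ?thesis using far[OF that(2), of \<theta>] by auto
    qed
  qed
  define g where "g u s (\<theta>::real) = \<gamma> ((1 - u) *\<^sub>R s) 0" for u s \<theta>
  have 2: "homotopic_avoiding p (on_circle (g 0)) (on_circle (g 1))"
  proof (rule loop_family_homotopy)
    have in1: "(1 - u) *\<^sub>R s \<in> cball (0::'p) 1" if "u \<in> {0..1}" "s \<in> cball 0 1" for u s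
      using mult_mono[of "1 - u" 1 "norm s" 1] that by simp
    have "continuous_on ({0..1} \<times> cball 0 1 \<times> UNIV) (\<lambda>x :: real \<times> 'p \<times> real. (\<lambda>(s, \<theta>). \<gamma> s \<theta>) ((1 - fst x) *\<^sub>R fst (snd x), 0))"
    proof (rule continuous_on_compose2[OF c])
      show "(\<lambda>x :: real \<times> 'p \<times> real. ((1 - fst x) *\<^sub>R fst (snd x), 0)) ` ({0..1} \<times> cball 0 1 \<times> UNIV) \<subseteq> cball 0 1 \<times> UNIV"
      proof (rule image_subsetI)
        fix x :: "real \<times> 'p \<times> real" assume "x \<in> {0..1} \<times> cball 0 1 \<times> UNIV"
        hence "fst x \<in> {0..1}" "fst (snd x) \<in> cball 0 1" by (simp_all add: mem_Times_iff)
        from in1[OF this] show "((1 - fst x) *\<^sub>R fst (snd x), 0) \<in> cball 0 1 \<times> UNIV" by (simp only: mem_Times_iff fst_conv UNIV_I simp_thms)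
      qed
    qed (auto intro!: continuous_intros)
    thus "continuous_on ({0..1} \<times> cball 0 1 \<times> UNIV) (\<lambda>(u, s, \<theta>). g u s \<theta>)" by (simp add: g_def case_prod_unfold)
    show "periodic (g u s)" for u s by (simp add: g_def periodic_def)
    show "g u s \<theta> = g u s 0" for u s \<theta> by (simp add: g_def)
    show "g u s \<theta> \<in> - {p}" if "u \<in> {0..1}" "s \<in> cball 0 1" for u s \<theta>
      using far[OF in1[OF that], of 0] r by (auto simp: g_def)
  qed
  have "h 0 = \<gamma>" "h 1 = g 0" "on_circle (g 1) = (\<lambda>_. \<gamma> 0 0)" by (auto simp: h_def g_def on_circle_def fun_eq_iff)
  thus ?thesis using homotopic_with_trans[OF 1] 2 by simp
qed

text \<open>The factor \<open>q\<close> must satisfy \<open>exp (- 2 \<kappa> \<mu>) < q\<^sup>2 = 1 - \<mu> \<beta>\<close>.  For small \<open>\<mu>\<close> this is possible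
  because \<open>\<beta> < 2 \<kappa>\<close>.\<close>

lemma shortening_parameters:
  fixes \<beta> :: real
  assumes "0 < \<beta>" "\<beta> < 2"
  obtains \<kappa> \<mu> q where "0 \<le> \<kappa>" "\<kappa> < 1" "0 < q" "q < 1" "exp (- (\<kappa> * \<mu>)) < q" "\<mu> > 0" "\<mu> * \<beta> = 1 - q\<^sup>2"
proof -
  define \<kappa> where "\<kappa> = (\<beta> / 2 + 1) / 2"
  have \<kappa>: "0 < \<kappa>" "\<kappa> < 1" "\<beta> < 2 * \<kappa>" using assms by (auto simp: \<kappa>_def)
  \<comment> \<open>Half of the largest value for which \<open>1 < (1 + 2 \<kappa> \<mu>) (1 - \<mu> \<beta>)\<close>; compare with \<open>1 + x \<le> exp x\<close>.\<close>
  define \<mu> where "\<mu> = (2 * \<kappa> - \<beta>) / (4 * \<kappa> * \<beta>)"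
  have \<mu>: "\<mu> > 0" using \<kappa> assms by (simp add: \<mu>_def)
  have \<mu>\<beta>: "\<mu> * \<beta> = (2 * \<kappa> - \<beta>) / (4 * \<kappa>)" using \<kappa> assms by (simp add: \<mu>_def)
  have half: "\<mu> * \<beta> < 1 / 2" unfolding \<mu>\<beta> using \<kappa> assms by (simp add: field_simps)
  have pos: "\<mu> * \<beta> > 0" using \<mu> assms by simp
  define q where "q = sqrt (1 - \<mu> * \<beta>)"
  have q: "0 < q" "q < 1" "q\<^sup>2 = 1 - \<mu> * \<beta>" using half pos by (auto simp: q_def)
  have "exp (- (\<kappa> * \<mu>)) < q"
  proof -
    have "1 < (1 + 2 * \<kappa> * \<mu>) * (1 - \<mu> * \<beta>)"
    proof -
      have "2 * \<kappa> * (\<mu> * \<beta>) = (2 * \<kappa> - \<beta>) / 2" unfolding \<mu>\<beta> using \<kappa> by (simp add: field_simps)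
      moreover have "(1 + 2 * \<kappa> * \<mu>) * (1 - \<mu> * \<beta>) = 1 + \<mu> * (2 * \<kappa> - \<beta> - 2 * \<kappa> * (\<mu> * \<beta>))"
        by (simp add: algebra_simps)
      ultimately have "(1 + 2 * \<kappa> * \<mu>) * (1 - \<mu> * \<beta>) = 1 + \<mu> * (2 * \<kappa> - \<beta> - (2 * \<kappa> - \<beta>) / 2)"
        by (simp only:)
      moreover have "\<mu> * (2 * \<kappa> - \<beta> - (2 * \<kappa> - \<beta>) / 2) > 0" using \<mu> \<kappa> by (intro mult_pos_pos) auto
      ultimately show ?thesis by linarith
    qed
    also have "\<dots> \<le> exp (2 * \<kappa> * \<mu>) * (1 - \<mu> * \<beta>)"
      using exp_ge_add_one_self[of "2 * \<kappa> * \<mu>"] half by (intro mult_right_mono) auto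
    also have "\<dots> = (exp (\<kappa> * \<mu>) * q)\<^sup>2" unfolding power_mult_distrib q(3) by (simp add: power2_eq_square exp_add[symmetric])
    finally have "1 < exp (\<kappa> * \<mu>) * q" using q(1) by (simp add: power2_eq_square) (smt (verit) exp_gt_zero mult_le_one mult_nonneg_nonneg)
    thus ?thesis by (simp add: exp_minus field_simps)
  qed
  thus ?thesis using that[of \<kappa> q \<mu>] \<kappa> \<mu> q by simp
qed

text \<open>After the first smoothing, curves of energy at most \<open>E\<close> can be parametrized with Lipschitz constant
  \<open>l\<close> for any \<open>l\<^sup>2 > E / (2 \<pi>)\<close>.  They become arbitrarily short within any time that exceeds
  \<open>l\<^sup>2 / 2\<close>, hence within \<open>T'\<close>, and they stay away from a ball in \<open>K T'\<close>.\<close>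

lemma bounded_energy_family_contractible:
  fixes \<gamma> :: "'p::euclidean_space \<Rightarrow> real \<Rightarrow> 'a"
  assumes lf: "loop_family \<gamma>" and out: "\<And>s \<theta>. s \<in> cball 0 1 \<Longrightarrow> \<gamma> s \<theta> \<notin> K 0"
    and en: "\<And>s N. s \<in> cball 0 1 \<Longrightarrow> trig_energy N (smooth_cos N (\<gamma> s)) (smooth_sin N (\<gamma> s)) \<le> E"
    and T: "T' \<in> I" "E < 4 * pi * T'" and p: "p \<in> interior (K T')"
  obtains x where "homotopic_avoiding p (on_circle \<gamma>) (\<lambda>_. x)"
proof -
  obtain r where r: "r > 0" "ball p r \<subseteq> K T'" using p mem_interior by blast
  have pK: "p \<in> K T'" using p interior_subset by blast
  have E0: "E \<ge> 0"
  proof -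
    have "0 \<le> trig_energy 0 (smooth_cos 0 (\<gamma> 0)) (smooth_sin 0 (\<gamma> 0))" by (simp add: trig_energy_def)
    thus ?thesis using en[of 0 0] by simp
  qed
  have T0: "T' > 0" using T(2) E0 by (smt (verit) mult_nonneg_nonpos pi_gt_zero)
  have "p \<in> K 0" using K_antimono[OF _ less_imp_le[OF T0] T(1)] pK by auto
  obtain N where N: "\<And>s \<theta>. s \<in> cball 0 1 \<Longrightarrow> smoothing N (\<gamma> s) \<theta> \<notin> K 0"
    "homotopic_avoiding p (on_circle \<gamma>) (on_circle (\<lambda>s. smoothing N (\<gamma> s)))"
    by (rule smoothing_homotopy[OF I_0 lf out \<open>p \<in> K 0\<close>]) (assumption | rule that)+
  obtain e where e: "E / (2 * pi) < e" "e < 2 * T'"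
  proof -
    have "E / (2 * pi) < 2 * T'" using T(2) by (simp add: field_simps)
    thus ?thesis using that dense by blast
  qed
  have e0: "e > 0" using e(1) E0 by (smt (verit) divide_nonneg_pos pi_gt_zero)
  define l where "l = sqrt e"
  have l: "l > 0" "l\<^sup>2 = e" using e0 by (auto simp: l_def)
  obtain \<delta> where \<delta>: "loop_family \<delta>" "\<And>s. s \<in> cball 0 1 \<Longrightarrow> lipschitz_curve l (\<delta> s)"
    "\<And>s \<theta>. s \<in> cball 0 1 \<Longrightarrow> \<delta> s \<theta> \<notin> K 0"
    "homotopic_avoiding p (on_circle (\<lambda>s. trig_poly N (smooth_cos N (\<gamma> s)) (smooth_sin N (\<gamma> s)))) (on_circle \<delta>)"
  proof (rule reparametrization_homotopy[where a = "\<lambda>s. smooth_cos N (\<gamma> s)" and b = "\<lambda>s. smooth_sin N (\<gamma> s)" and N = N and L = "sqrt (2 * pi * E)" and R = l and t = 0 and p = p])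
    show "continuous_on (cball 0 1) (\<lambda>s. smooth_cos N (\<gamma> s) j)" "continuous_on (cball 0 1) (\<lambda>s. smooth_sin N (\<gamma> s) j)" for j
      by (rule continuous_smooth_coeffs[OF lf])+
    show "lipschitz_curve 0 (trig_poly N (smooth_cos N (\<gamma> s)) (smooth_sin N (\<gamma> s)))" if "s \<in> sphere 0 1" for s
      using smoothing_lipschitz_const[OF lf that, of N] unfolding smoothing_def .
    show "trig_length N (smooth_cos N (\<gamma> s)) (smooth_sin N (\<gamma> s)) \<le> sqrt (2 * pi * E)" if "s \<in> cball 0 1" for s
      using en[OF that, of N] by (intro order_trans[OF trig_length_le] real_sqrt_le_mono mult_left_mono) auto
    have "2 * pi * E < (2 * pi * l)\<^sup>2"
    proof -
      have "E < 2 * pi * l\<^sup>2" using e(1) l(2) by (simp add: field_simps)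
      hence "2 * pi * E < 2 * pi * (2 * pi * l\<^sup>2)" by simp
      thus ?thesis by (simp add: power2_eq_square)
    qed
    thus "sqrt (2 * pi * E) < 2 * pi * l" using l(1) by (intro real_less_lsqrt) auto
    show "trig_poly N (smooth_cos N (\<gamma> s)) (smooth_sin N (\<gamma> s)) \<theta> \<notin> K 0" if "s \<in> cball 0 1" for s \<theta>
      using N(1)[OF that, of \<theta>] unfolding smoothing_def .
  qed (assumption | rule that l \<open>p \<in> K 0\<close>)+
  obtain \<kappa> \<mu> q where q: "0 \<le> \<kappa>" "\<kappa> < 1" "0 < q" "q < 1" "exp (- (\<kappa> * \<mu>)) < q" "\<mu> > 0" "\<mu> * (e / T') = 1 - q\<^sup>2"
  proof (rule shortening_parameters)
    show "0 < e / T'" "e / T' < 2" using e e0 T0 by (auto simp: field_simps)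
  qed (assumption | rule that)+
  have "\<mu> * l\<^sup>2 \<le> (1 - q\<^sup>2) * T'" unfolding q(7)[symmetric] l(2) using T0 by simp
  note iter = shortening_iteration[OF \<delta>(1,2) l(1) \<delta>(3) T(1) T0 pK q(1-6) this]
  have "(\<lambda>k. q ^ k * (2 * pi * l)) \<longlonglongrightarrow> 0 * (2 * pi * l)"
    by (intro tendsto_mult tendsto_const LIMSEQ_power_zero) (use q in auto)
  hence "\<forall>\<^sub>F k in sequentially. q ^ k * (2 * pi * l) < r" using r(1) by (intro order_tendstoD(2)) auto
  then obtain k where k: "q ^ k * (2 * pi * l) < r" by (meson eventually_sequentially order_refl)
  obtain \<epsilon> where \<epsilon>: "loop_family \<epsilon>" "\<forall>s\<in>cball 0 1. lipschitz_curve (q ^ k * l) (\<epsilon> s)"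
    "\<forall>s\<in>cball 0 1. \<forall>\<theta>. \<epsilon> s \<theta> \<notin> K ((1 - q ^ (2 * k)) * T')"
    "homotopic_avoiding p (on_circle \<delta>) (on_circle \<epsilon>)"
    using iter[of k] by blast
  have "homotopic_avoiding p (on_circle \<epsilon>) (\<lambda>_. \<epsilon> 0 0)"
  proof (rule short_family_contractible[OF \<epsilon>(1) bspec[OF \<epsilon>(2)]])
    have q2: "0 \<le> q ^ (2 * k)" "q ^ (2 * k) \<le> 1" using q by (auto intro: power_le_one)
    have "(1 - q ^ (2 * k)) * T' \<le> 1 * T'" using q2 T0 by (intro mult_right_mono) auto
    hence "K T' \<subseteq> K ((1 - q ^ (2 * k)) * T')" using q2 T0 T(1) by (intro K_antimono) auto
    thus "r \<le> dist p (\<epsilon> s \<theta>)" if "s \<in> cball 0 1" for s \<theta>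
      using \<epsilon>(3) that r(2) by (meson in_mono mem_ball not_le)
    show "2 * pi * (q ^ k * l) < r" using k by (simp add: mult_ac)
    show "0 \<le> q ^ k * l" using q l by simp
  qed
  from homotopic_with_trans[OF N(2)[unfolded smoothing_def] homotopic_with_trans[OF \<delta>(4) homotopic_with_trans[OF \<epsilon>(4) this]]]
  show ?thesis by (rule that)
qed

end

section \<open>Weak derivatives on the circle\<close>

lemma C_k_on_trig: "C_k_on k (\<lambda>\<theta>::real. A * cos (c * \<theta>) + B * sin (c * \<theta>)) UNIV"
proof (induction k arbitrary: A B)
  case 0 show ?case by (auto intro!: continuous_intros)
next
  case (Suc k)
  have d: "((\<lambda>\<theta>. A * cos (c * \<theta>) + B * sin (c * \<theta>)) has_derivative
      (\<lambda>v. (v * (B * c)) * cos (c * x) + (v * (- A * c)) * sin (c * x))) (at x)" for x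
    by (auto intro!: derivative_eq_intros simp: algebra_simps)
  have fd: "frechet_derivative (\<lambda>\<theta>. A * cos (c * \<theta>) + B * sin (c * \<theta>)) (at x) =
      (\<lambda>v. (v * (B * c)) * cos (c * x) + (v * (- A * c)) * sin (c * x))" for x
    by (rule frechet_derivative_at[OF d, symmetric])
  show ?case unfolding C_k_on.simps fd
  proof (intro conjI ballI allI)
    show "(\<lambda>\<theta>. A * cos (c * \<theta>) + B * sin (c * \<theta>)) differentiable (at x)" for x
      unfolding differentiable_def by (rule exI) (rule d)
  qed (rule Suc)
qed

lemma circle_test_function_trig:
  "circle_test_function (\<lambda>\<theta>. A * cos (real j * \<theta>) + B * sin (real j * \<theta>))"
proof -
  have "smooth_on UNIV (\<lambda>\<theta>. A * cos (real j * \<theta>) + B * sin (real j * \<theta>))"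
    unfolding smooth_on_def using C_k_on_trig[of _ A "real j" B]
    by (intro ballI exI[of _ UNIV] exI[of _ "\<lambda>\<theta>. A * cos (real j * \<theta>) + B * sin (real j * \<theta>)"]) auto
  moreover have "cos (real j * (\<theta> + 2 * pi)) = cos (real j * \<theta>)" "sin (real j * (\<theta> + 2 * pi)) = sin (real j * \<theta>)" for \<theta>
    using cos_int_2pin[of "int j"] sin_int_2pin[of "int j"]
    by (simp_all add: distrib_left cos_add sin_add mult.commute mult.left_commute)
  ultimately show ?thesis unfolding circle_test_function_def by simp
qed

lemma circle_test_function_continuous:
  assumes "circle_test_function \<phi>"
  shows "continuous_on UNIV \<phi>" "continuous_on UNIV (deriv \<phi>)"
proof -
  have sm: "smooth_on UNIV \<phi>" using assms unfolding circle_test_function_def by blast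
  show "continuous_on UNIV \<phi>" by (rule smooth_on_imp_continuous_on[OF sm])
  have "isCont (deriv \<phi>) x" for x
  proof -
    from bspec[OF sm[unfolded smooth_on_def] UNIV_I[of x]]
    obtain U g where U: "open U" "x \<in> U" "\<forall>k. C_k_on k g U" "\<forall>y\<in>UNIV \<inter> U. g y = \<phi> y" by (elim exE conjE)
    have C1: "C_k_on (Suc 0) g U" using U(3) by blast
    hence d: "(g has_derivative frechet_derivative g (at y)) (at y)" if "y \<in> U" for y
      using that by (auto simp: frechet_derivative_works[symmetric])
    have "deriv \<phi> y = frechet_derivative g (at y) 1" if y: "y \<in> U" for y
    proof (rule DERIV_imp_deriv)
      have lin: "linear (frechet_derivative g (at y))" using d[OF y] has_derivative_linear by blast
      have "frechet_derivative g (at y) = (*) (frechet_derivative g (at y) 1)"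
      proof
        fix v show "frechet_derivative g (at y) v = frechet_derivative g (at y) 1 * v"
          using linear_cmul[OF lin, of v 1] by simp
      qed
      hence "(g has_real_derivative frechet_derivative g (at y) 1) (at y)"
        using d[OF y] unfolding has_field_derivative_def by metis
      thus "(\<phi> has_real_derivative frechet_derivative g (at y) 1) (at y)"
        by (rule DERIV_cong_ev[THEN iffD1, rotated -1, OF _ refl _ refl])
           (use U y in \<open>auto simp: eventually_nhds\<close>)
    qed
    moreover have "continuous_on U (\<lambda>y. frechet_derivative g (at y) 1)" using C1 by auto
    ultimately have "continuous_on U (deriv \<phi>)" by (simp cong: continuous_on_cong)
    thus ?thesis using U by (simp add: continuous_on_eq_continuous_at)
  qed
  thus "continuous_on UNIV (deriv \<phi>)" by (simp add: continuous_at_imp_continuous_on)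
qed

lemma continuous_set_integrable_period:
  fixes f :: "real \<Rightarrow> 'b::euclidean_space"
  assumes "continuous_on UNIV f" shows "set_integrable lborel period f"
  by (rule borel_integrable_atLeastAtMost'[OF continuous_on_subset[OF assms]]) simp

lemma circle_L2_times_continuous:
  fixes g :: "real \<Rightarrow> 'a::euclidean_space"
  assumes g: "circle_L2 g" and c: "continuous_on UNIV (c :: real \<Rightarrow> real)"
  shows "set_integrable lborel period (\<lambda>\<theta>. c \<theta> *\<^sub>R g \<theta>)"
proof -
  have i: "set_integrable lborel period (\<lambda>\<theta>. (c \<theta>)\<^sup>2 + (norm (g \<theta>))\<^sup>2)"
    using g unfolding circle_L2_def
    by (intro set_integral_add(1) continuous_set_integrable_period[of "\<lambda>\<theta>. (c \<theta>)\<^sup>2"] continuous_intros c) auto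
  have m: "g \<in> borel_measurable borel" "c \<in> borel_measurable borel"
    using g borel_measurable_continuous_onI[OF c] unfolding circle_L2_def by blast+
  show ?thesis
  proof (rule set_integrable_bound[OF i])
    show "set_borel_measurable lborel period (\<lambda>\<theta>. c \<theta> *\<^sub>R g \<theta>)"
      unfolding set_borel_measurable_def using m by simp
    have "norm (c \<theta> *\<^sub>R g \<theta>) \<le> norm ((c \<theta>)\<^sup>2 + (norm (g \<theta>))\<^sup>2)" for \<theta>
    proof -
      have "2 * (\<bar>c \<theta>\<bar> * norm (g \<theta>)) \<le> (c \<theta>)\<^sup>2 + (norm (g \<theta>))\<^sup>2"
        using sum_squares_bound[of "\<bar>c \<theta>\<bar>" "norm (g \<theta>)"] by simp
      moreover have "0 \<le> \<bar>c \<theta>\<bar> * norm (g \<theta>)" by simp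
      ultimately have "\<bar>c \<theta>\<bar> * norm (g \<theta>) \<le> (c \<theta>)\<^sup>2 + (norm (g \<theta>))\<^sup>2" by linarith
      thus ?thesis by simp
    qed
    thus "AE \<theta> in lborel. \<theta> \<in> period \<longrightarrow> norm (c \<theta> *\<^sub>R g \<theta>) \<le> norm ((c \<theta>)\<^sup>2 + (norm (g \<theta>))\<^sup>2)" by simp
  qed
qed

lemma circle_L2_diff:
  fixes g h :: "real \<Rightarrow> 'a::euclidean_space"
  assumes g: "circle_L2 g" and h: "circle_L2 h"
  shows "circle_L2 (\<lambda>\<theta>. g \<theta> - h \<theta>)"
proof -
  have m: "g \<in> borel_measurable borel" "h \<in> borel_measurable borel"
    using g h unfolding circle_L2_def by auto
  have i: "set_integrable lborel period (\<lambda>\<theta>. 2 * (norm (g \<theta>))\<^sup>2 + 2 * (norm (h \<theta>))\<^sup>2)"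
    using g h unfolding circle_L2_def by (intro set_integral_add set_integrable_mult_right) auto
  have "set_integrable lborel period (\<lambda>\<theta>. (norm (g \<theta> - h \<theta>))\<^sup>2)"
  proof (rule set_integrable_bound[OF i])
    show "set_borel_measurable lborel period (\<lambda>\<theta>. (norm (g \<theta> - h \<theta>))\<^sup>2)"
      unfolding set_borel_measurable_def using m by simp
    have "norm ((norm (g \<theta> - h \<theta>))\<^sup>2) \<le> norm (2 * (norm (g \<theta>))\<^sup>2 + 2 * (norm (h \<theta>))\<^sup>2)" for \<theta>
    proof -
      have "(norm (g \<theta> - h \<theta>))\<^sup>2 \<le> (norm (g \<theta>) + norm (h \<theta>))\<^sup>2" by (intro power_mono norm_triangle_ineq4) auto
      also have "\<dots> \<le> 2 * (norm (g \<theta>))\<^sup>2 + 2 * (norm (h \<theta>))\<^sup>2"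
        using sum_squares_bound[of "norm (g \<theta>)" "norm (h \<theta>)"] by (simp add: power2_sum)
      finally show ?thesis by simp
    qed
    thus "AE \<theta> in lborel. \<theta> \<in> period \<longrightarrow> norm ((norm (g \<theta> - h \<theta>))\<^sup>2) \<le> norm (2 * (norm (g \<theta>))\<^sup>2 + 2 * (norm (h \<theta>))\<^sup>2)" by simp
  qed
  thus ?thesis using m unfolding circle_L2_def by simp
qed

lemma is_weak_derivative_diff:
  fixes \<gamma> \<delta> g h :: "real \<Rightarrow> 'a::euclidean_space"
  assumes g: "is_weak_derivative \<gamma> g" and h: "is_weak_derivative \<delta> h"
    and c: "continuous_on UNIV \<gamma>" "continuous_on UNIV \<delta>"
  shows "is_weak_derivative (\<lambda>\<theta>. \<gamma> \<theta> - \<delta> \<theta>) (\<lambda>\<theta>. g \<theta> - h \<theta>)"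
  unfolding is_weak_derivative_def
proof (intro conjI allI impI)
  have L2: "circle_L2 g" "circle_L2 h" using g h unfolding is_weak_derivative_def by auto
  show "circle_L2 (\<lambda>\<theta>. g \<theta> - h \<theta>)" by (rule circle_L2_diff[OF L2])
  fix \<phi> assume \<phi>: "circle_test_function \<phi>"
  note c\<phi> = circle_test_function_continuous[OF \<phi>]
  have i1: "set_integrable lborel period (\<lambda>\<theta>. deriv \<phi> \<theta> *\<^sub>R \<gamma> \<theta>)" "set_integrable lborel period (\<lambda>\<theta>. deriv \<phi> \<theta> *\<^sub>R \<delta> \<theta>)"
    by (intro continuous_set_integrable_period continuous_on_scaleR c\<phi>(2) c)+
  have i2: "set_integrable lborel period (\<lambda>\<theta>. \<phi> \<theta> *\<^sub>R g \<theta>)" "set_integrable lborel period (\<lambda>\<theta>. \<phi> \<theta> *\<^sub>R h \<theta>)"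
    by (rule circle_L2_times_continuous[OF L2(1) c\<phi>(1)], rule circle_L2_times_continuous[OF L2(2) c\<phi>(1)])
  have e: "(LINT \<theta>:period|lborel. deriv \<phi> \<theta> *\<^sub>R \<gamma> \<theta>) = - (LINT \<theta>:period|lborel. \<phi> \<theta> *\<^sub>R g \<theta>)"
    "(LINT \<theta>:period|lborel. deriv \<phi> \<theta> *\<^sub>R \<delta> \<theta>) = - (LINT \<theta>:period|lborel. \<phi> \<theta> *\<^sub>R h \<theta>)"
    using g h \<phi> unfolding is_weak_derivative_def by blast+
  have "(LINT \<theta>:period|lborel. deriv \<phi> \<theta> *\<^sub>R (\<gamma> \<theta> - \<delta> \<theta>)) =
      (LINT \<theta>:period|lborel. deriv \<phi> \<theta> *\<^sub>R \<gamma> \<theta>) - (LINT \<theta>:period|lborel. deriv \<phi> \<theta> *\<^sub>R \<delta> \<theta>)"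
    unfolding scaleR_diff_right by (rule set_integral_diff(2)[OF i1])
  also have "\<dots> = - (LINT \<theta>:period|lborel. \<phi> \<theta> *\<^sub>R g \<theta>) - - (LINT \<theta>:period|lborel. \<phi> \<theta> *\<^sub>R h \<theta>)"
    unfolding e ..
  also have "\<dots> = - ((LINT \<theta>:period|lborel. \<phi> \<theta> *\<^sub>R g \<theta>) - (LINT \<theta>:period|lborel. \<phi> \<theta> *\<^sub>R h \<theta>))" by simp
  also have "\<dots> = - (LINT \<theta>:period|lborel. \<phi> \<theta> *\<^sub>R (g \<theta> - h \<theta>))"
    unfolding scaleR_diff_right by (simp only: set_integral_diff(2)[OF i2])
  finally show "(LINT \<theta>:period|lborel. deriv \<phi> \<theta> *\<^sub>R (\<gamma> \<theta> - \<delta> \<theta>)) = - (LINT \<theta>:period|lborel. \<phi> \<theta> *\<^sub>R (g \<theta> - h \<theta>))" .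
qed

lemma integral_trig_poly_orthogonal:
  fixes h :: "real \<Rightarrow> 'a::euclidean_space" and a b :: "nat \<Rightarrow> real"
  assumes h: "circle_L2 h"
    and zero: "\<And>\<phi>. circle_test_function \<phi> \<Longrightarrow> (LINT \<theta>:period|lborel. \<phi> \<theta> *\<^sub>R h \<theta>) = 0"
  shows "(LINT \<theta>:period|lborel. trig_poly N a b \<theta> *\<^sub>R h \<theta>) = 0"
proof -
  let ?t = "\<lambda>j \<theta>. a j * cos (real j * \<theta>) + b j * sin (real j * \<theta>)"
  have eq: "trig_poly N a b \<theta> *\<^sub>R h \<theta> = (\<Sum>j\<le>N. ?t j \<theta> *\<^sub>R h \<theta>)" for \<theta>
    unfolding trig_poly_def scaleR_sum_left by (intro sum.cong refl) (simp add: mult.commute)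
  have "set_integrable lborel period (\<lambda>\<theta>. ?t j \<theta> *\<^sub>R h \<theta>)" for j
    by (intro circle_L2_times_continuous h continuous_intros)
  hence "(LINT \<theta>:period|lborel. (\<Sum>j\<le>N. ?t j \<theta> *\<^sub>R h \<theta>)) = (\<Sum>j\<le>N. LINT \<theta>:period|lborel. ?t j \<theta> *\<^sub>R h \<theta>)"
    unfolding set_integrable_def set_lebesgue_integral_def scaleR_sum_right
    by (intro Bochner_Integration.integral_sum)
  also have "\<dots> = 0" using zero[OF circle_test_function_trig] by (intro sum.neutral) auto
  finally show ?thesis unfolding eq .
qed

text \<open>The smoothings of a continuous periodic function are trigonometric polynomials and converge
  uniformly to it.\<close>

lemma integral_continuous_periodic_orthogonal:
  fixes h :: "real \<Rightarrow> 'a::euclidean_space" and \<psi> :: "real \<Rightarrow> real"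
  assumes h: "circle_L2 h"
    and zero: "\<And>\<phi>. circle_test_function \<phi> \<Longrightarrow> (LINT \<theta>:period|lborel. \<phi> \<theta> *\<^sub>R h \<theta>) = 0"
    and \<psi>: "continuous_on UNIV \<psi>" "periodic \<psi>"
  shows "(LINT \<theta>:period|lborel. \<psi> \<theta> *\<^sub>R h \<theta>) = 0"
proof -
  define H where "H = (LINT \<theta>:period|lborel. norm (h \<theta>))"
  have hi: "set_integrable lborel period (\<lambda>\<theta>. norm (h \<theta>))"
    using set_integrable_norm[OF circle_L2_times_continuous[OF h continuous_on_const[of _ 1]]] by simp
  have H: "H \<ge> 0" unfolding H_def set_lebesgue_integral_def by (intro integral_nonneg_AE) auto
  have bound: "norm (LINT \<theta>:period|lborel. \<psi> \<theta> *\<^sub>R h \<theta>) \<le> e * H" if e: "e > 0" for e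
  proof -
    obtain C where C: "\<And>\<theta> y. norm (\<psi> (\<theta> - y) - \<psi> \<theta>) \<le> e / 2 + C * (1 - cos y)"
    proof -
      \<comment> \<open>A single function as the central member of a family, to which the uniform modulus applies.\<close>
      define \<gamma> where "\<gamma> s \<theta> = (1 - norm s) *\<^sub>R \<psi> \<theta>" for s :: real and \<theta>
      have "continuous_on (cball 0 1 \<times> UNIV) (\<lambda>x :: real \<times> real. (1 - norm (fst x)) *\<^sub>R \<psi> (snd x))"
        by (intro continuous_intros continuous_on_compose2[OF \<psi>(1)]) auto
      hence "loop_family \<gamma>"
        using \<psi>(2) unfolding loop_family_def periodic_def \<gamma>_def by (auto simp: case_prod_unfold)
      moreover have "e / 2 > 0" using e by simp
      ultimately obtain C where C: "\<And>s \<theta> y. s \<in> cball 0 1 \<Longrightarrow> norm (\<gamma> s (\<theta> - y) - \<gamma> s \<theta>) \<le> e / 2 + C * (1 - cos y)"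
        using loop_family_modulus[of \<gamma>] by blast
      have "norm (\<psi> (\<theta> - y) - \<psi> \<theta>) \<le> e / 2 + C * (1 - cos y)" for \<theta> y
        using C[of 0 \<theta> y] by (simp add: \<gamma>_def)
      thus ?thesis by (rule that)
    qed
    obtain N where N: "2 * C / e < real N" using reals_Archimedean2 by blast
    have "C / (real N + 1) < e / 2"
    proof -
      have "2 * C < e * (real N + 1)" using N e by (simp add: field_simps)
      thus ?thesis by (simp add: field_simps)
    qed
    hence close: "\<bar>\<psi> \<theta> - smoothing N \<psi> \<theta>\<bar> \<le> e" for \<theta>
      using smoothing_error[OF \<psi>(2,1) C, of N \<theta>] unfolding real_norm_def by linarith
    have cs: "continuous_on UNIV (smoothing N \<psi>)" unfolding smoothing_def by (rule continuous_trig_poly)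
    have i1: "set_integrable lborel period (\<lambda>\<theta>. \<psi> \<theta> *\<^sub>R h \<theta>)" and i2: "set_integrable lborel period (\<lambda>\<theta>. smoothing N \<psi> \<theta> *\<^sub>R h \<theta>)"
      by (rule circle_L2_times_continuous[OF h \<psi>(1)], rule circle_L2_times_continuous[OF h cs])
    have "(LINT \<theta>:period|lborel. smoothing N \<psi> \<theta> *\<^sub>R h \<theta>) = 0"
      unfolding smoothing_def by (rule integral_trig_poly_orthogonal[OF h zero])
    hence "(LINT \<theta>:period|lborel. \<psi> \<theta> *\<^sub>R h \<theta>) = (LINT \<theta>:period|lborel. \<psi> \<theta> *\<^sub>R h \<theta> - smoothing N \<psi> \<theta> *\<^sub>R h \<theta>)"
      using set_integral_diff(2)[OF i1 i2] by simp
    also have "norm \<dots> \<le> (LINT \<theta>:period|lborel. norm (\<psi> \<theta> *\<^sub>R h \<theta> - smoothing N \<psi> \<theta> *\<^sub>R h \<theta>))"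
      by (rule set_integral_norm_bound[OF set_integral_diff(1)[OF i1 i2]])
    also have "\<dots> \<le> (LINT \<theta>:period|lborel. e * norm (h \<theta>))"
    proof (rule set_integral_mono)
      show "set_integrable lborel period (\<lambda>\<theta>. norm (\<psi> \<theta> *\<^sub>R h \<theta> - smoothing N \<psi> \<theta> *\<^sub>R h \<theta>))"
        by (rule set_integrable_norm[OF set_integral_diff(1)[OF i1 i2]])
      show "set_integrable lborel period (\<lambda>\<theta>. e * norm (h \<theta>))" using hi by simp
      show "norm (\<psi> \<theta> *\<^sub>R h \<theta> - smoothing N \<psi> \<theta> *\<^sub>R h \<theta>) \<le> e * norm (h \<theta>)" for \<theta>
        using mult_right_mono[OF close[of \<theta>] norm_ge_zero[of "h \<theta>"]] by (simp add: scaleR_diff_left[symmetric])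
    qed
    also have "\<dots> = e * H" unfolding H_def by simp
    finally show ?thesis .
  qed
  have "norm (LINT \<theta>:period|lborel. \<psi> \<theta> *\<^sub>R h \<theta>) \<le> 0"
  proof (rule field_le_epsilon)
    fix e :: real assume e: "e > 0"
    have "norm (LINT \<theta>:period|lborel. \<psi> \<theta> *\<^sub>R h \<theta>) \<le> e / (H + 1) * H" using e H by (intro bound) auto
    also have "\<dots> \<le> e" using e H by (simp add: field_simps)
    finally show "norm (LINT \<theta>:period|lborel. \<psi> \<theta> *\<^sub>R h \<theta>) \<le> 0 + e" by simp
  qed
  thus ?thesis by simp
qed

lemma cis_inj_period:
  assumes "\<theta> \<in> {0<..<2 * pi}" "\<phi> \<in> period" "cis \<theta> = cis \<phi>" shows "\<theta> = \<phi>"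
proof -
  have "sin \<theta> = sin \<phi> \<and> cos \<theta> = cos \<phi>" using assms(3) by (simp add: complex_eq_iff)
  then obtain n :: int where n: "\<theta> = \<phi> + 2 * pi * of_int n" using sin_cos_eq_iff by metis
  have "\<bar>2 * pi * of_int n\<bar> < 2 * pi * 1" using assms(1,2) n by auto
  hence "\<bar>of_int n :: real\<bar> < 1" unfolding abs_mult by simp
  hence "n = 0" by linarith
  thus ?thesis using n by simp
qed

text \<open>It suffices that the integrals of \<open>h\<close> over the Borel subsets of a period vanish, and since these
  are generated by the open sets, it suffices to consider open sets.  The indicator of an open set
  is a limit of continuous periodic functions, except at the end points of the period.\<close>

lemma AE_zero_of_orthogonal:
  fixes h :: "real \<Rightarrow> 'a::euclidean_space"
  assumes h: "circle_L2 h"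
    and zero: "\<And>\<phi>. circle_test_function \<phi> \<Longrightarrow> (LINT \<theta>:period|lborel. \<phi> \<theta> *\<^sub>R h \<theta>) = 0"
  shows "AE \<theta> in lborel. \<theta> \<in> period \<longrightarrow> h \<theta> = 0"
proof -
  define f where "f \<theta> = indicator period \<theta> *\<^sub>R h \<theta>" for \<theta>
  have hm: "h \<in> borel_measurable borel" using h unfolding circle_L2_def by blast
  have fi: "integrable lborel f"
    using circle_L2_times_continuous[OF h continuous_on_const[of _ 1]] unfolding set_integrable_def f_def by simp
  have si: "set_integrable lborel A f" if "A \<in> sets lborel" for A
    unfolding set_integrable_def by (rule integrable_mult_indicator[OF that fi])
  have total: "integral\<^sup>L lborel f = 0"
    using integral_continuous_periodic_orthogonal[OF h zero, of "\<lambda>_. 1"]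
    unfolding set_lebesgue_integral_def f_def by (simp add: periodic_def)
  have open_zero: "set_lebesgue_integral lborel U f = 0" if U: "open U" for U
  proof (cases "period \<subseteq> U")
    case True
    have "indicator U \<theta> *\<^sub>R f \<theta> = f \<theta>" for \<theta> using True by (auto simp: f_def indicator_def)
    thus ?thesis using total unfolding set_lebesgue_integral_def by simp
  next
    case False
    \<comment> \<open>The closed part of the circle from which the approximating functions measure the distance.\<close>
    define C where "C = cis ` (period - U)"
    have "compact (period - U)" by (rule compact_diff) (use U in auto)
    hence C: "closed C" "C \<noteq> {}"
      unfolding C_def using False
      by (auto intro!: compact_imp_closed compact_continuous_image continuous_on_cis continuous_on_id)
    define \<psi> where "\<psi> n \<theta> = min 1 (real n * infdist (cis \<theta>) C)" for n \<theta>
    have \<psi>c: "continuous_on UNIV (\<psi> n)" for n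
      unfolding \<psi>_def by (intro continuous_intros continuous_on_cis continuous_on_min)
    have "cis (\<theta> + 2 * pi) = cis \<theta>" for \<theta> by (simp add: complex_eq_iff)
    hence \<psi>p: "periodic (\<psi> n)" for n unfolding periodic_def \<psi>_def by simp
    have \<psi>0: "(LINT \<theta>|lborel. indicator period \<theta> *\<^sub>R (\<psi> n \<theta> *\<^sub>R h \<theta>)) = 0" for n
      using integral_continuous_periodic_orthogonal[OF h zero \<psi>c \<psi>p] unfolding set_lebesgue_integral_def .
    have lim: "(\<lambda>n. \<psi> n \<theta>) \<longlonglongrightarrow> (if cis \<theta> \<in> C then 0 else 1)" for \<theta>
    proof (cases "cis \<theta> \<in> C")
      case True thus ?thesis by (simp add: \<psi>_def)
    next
      case False
      hence pos: "infdist (cis \<theta>) C > 0" using C infdist_pos_not_in_closed by blast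
      obtain N where N: "1 / infdist (cis \<theta>) C < real N" using reals_Archimedean2 by blast
      have "\<psi> n \<theta> = 1" if "n \<ge> N" for n
      proof -
        have "1 < real N * infdist (cis \<theta>) C" using N pos by (simp add: field_simps)
        also have "\<dots> \<le> real n * infdist (cis \<theta>) C" using that pos by (intro mult_right_mono) auto
        finally show ?thesis by (simp add: \<psi>_def)
      qed
      hence "\<forall>\<^sub>F n in sequentially. \<psi> n \<theta> = 1" unfolding eventually_sequentially by blast
      thus ?thesis using False by (simp add: tendsto_eventually)
    qed
    have "(\<lambda>n. LINT \<theta>|lborel. indicator period \<theta> *\<^sub>R (\<psi> n \<theta> *\<^sub>R h \<theta>)) \<longlonglongrightarrow> (LINT \<theta>|lborel. indicator U \<theta> *\<^sub>R f \<theta>)"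
    proof (rule integral_dominated_convergence[where w = "\<lambda>\<theta>. norm (f \<theta>)"])
      show "(\<lambda>\<theta>. indicator U \<theta> *\<^sub>R f \<theta>) \<in> borel_measurable lborel"
        unfolding f_def using hm U by simp
      show "(\<lambda>\<theta>. indicator period \<theta> *\<^sub>R (\<psi> n \<theta> *\<^sub>R h \<theta>)) \<in> borel_measurable lborel" for n
        using hm borel_measurable_continuous_onI[OF \<psi>c[of n]] by simp
      show "integrable lborel (\<lambda>\<theta>. norm (f \<theta>))" using fi by simp
      have "AE \<theta> in lborel. \<theta> \<noteq> 0" "AE \<theta> in lborel. \<theta> \<noteq> 2 * pi" by (rule AE_lborel_singleton)+
      thus "AE \<theta> in lborel. (\<lambda>n. indicator period \<theta> *\<^sub>R (\<psi> n \<theta> *\<^sub>R h \<theta>)) \<longlonglongrightarrow> indicator U \<theta> *\<^sub>R f \<theta>"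
      proof eventually_elim
        case (elim \<theta>)
        show ?case
        proof (cases "\<theta> \<in> period")
          case True
          hence t: "\<theta> \<in> {0<..<2 * pi}" using elim by auto
          have "cis \<theta> \<in> C \<longleftrightarrow> \<theta> \<notin> U"
          proof
            assume "cis \<theta> \<in> C"
            then obtain \<phi> where "\<phi> \<in> period - U" "cis \<theta> = cis \<phi>" unfolding C_def by blast
            thus "\<theta> \<notin> U" using cis_inj_period[OF t] by blast
          next
            assume "\<theta> \<notin> U" thus "cis \<theta> \<in> C" using True unfolding C_def by blast
          qed
          hence "(if cis \<theta> \<in> C then 0 else 1) = (indicator U \<theta> :: real)" by (simp add: indicator_def)
          hence "(\<lambda>n. \<psi> n \<theta> *\<^sub>R h \<theta>) \<longlonglongrightarrow> indicator U \<theta> *\<^sub>R h \<theta>"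
            using tendsto_scaleR[OF lim[of \<theta>] tendsto_const[of "h \<theta>"]] by simp
          thus ?thesis using True by (simp add: f_def)
        qed (simp add: f_def)
      qed
      have "norm (indicator period \<theta> *\<^sub>R (\<psi> n \<theta> *\<^sub>R h \<theta>)) \<le> norm (f \<theta>)" for n \<theta>
      proof -
        have "\<bar>\<psi> n \<theta>\<bar> \<le> 1" using infdist_nonneg[of "cis \<theta>" C] by (simp add: \<psi>_def abs_le_iff)
        hence "\<bar>\<psi> n \<theta>\<bar> * norm (h \<theta>) \<le> 1 * norm (h \<theta>)" by (rule mult_right_mono) simp
        thus ?thesis by (simp add: f_def indicator_def)
      qed
      thus "AE \<theta> in lborel. norm (indicator period \<theta> *\<^sub>R (\<psi> n \<theta> *\<^sub>R h \<theta>)) \<le> norm (f \<theta>)" for n by simp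
    qed
    hence "(\<lambda>n::nat. 0) \<longlonglongrightarrow> (LINT \<theta>|lborel. indicator U \<theta> *\<^sub>R f \<theta>)" unfolding \<psi>0 .
    thus ?thesis unfolding set_lebesgue_integral_def using LIMSEQ_unique tendsto_const by metis
  qed
  have all: "set_lebesgue_integral lborel A f = 0" if "A \<in> sets lborel" for A
  proof -
    have sig: "sets lborel = sigma_sets UNIV {S :: real set. open S}" by (simp add: borel_def)
    have "Int_stable {S :: real set. open S}" by (auto simp: Int_stable_def)
    moreover have "{S :: real set. open S} \<subseteq> Pow UNIV" by simp
    moreover have "A \<in> sigma_sets UNIV {S. open S}" using that unfolding sig .
    ultimately show ?thesis
    proof (induction rule: sigma_sets_induct_disjoint)
      case (basic A) thus ?case using open_zero by simp
    next
      case empty thus ?case by (simp add: set_lebesgue_integral_def)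
    next
      case (compl A)
      have "A \<in> sets lborel" using compl(1) unfolding sig .
      hence "set_lebesgue_integral lborel UNIV f = set_lebesgue_integral lborel A f + set_lebesgue_integral lborel (UNIV - A) f"
        using set_integral_Un[of A "UNIV - A" lborel f] si by (simp add: Un_Diff_cancel)
      thus ?case using compl total by (simp add: set_lebesgue_integral_def)
    next
      case (union A)
      have m: "A i \<in> sets lborel" for i using union(2) unfolding sig by blast
      have "set_lebesgue_integral lborel (\<Union>i. A i) f = (\<Sum>i. set_lebesgue_integral lborel (A i) f)"
        by (rule lebesgue_integral_countable_add) (use m union(1) si in \<open>auto simp: disjoint_family_on_def\<close>)
      thus ?case using union by simp
    qed
  qed
  have "AE \<theta> in lborel. f \<theta> = 0" by (rule sigma_finite_measure.density_zero[OF sigma_finite_lborel fi all])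
  thus ?thesis by eventually_elim (auto simp: f_def)
qed

lemma is_weak_derivative_weak_deriv: "is_weak_derivative \<gamma> g \<Longrightarrow> is_weak_derivative \<gamma> (weak_deriv \<gamma>)"
  unfolding weak_deriv_def by (rule someI[of "is_weak_derivative \<gamma>"])

text \<open>The sum of weak derivatives of \<open>\<delta>\<close> and \<open>\<gamma> - \<delta>\<close> is a weak derivative of \<open>\<gamma>\<close>, and by the preceding
  lemma weak derivatives agree almost everywhere.\<close>

lemma energy_le_of_difference:
  fixes \<gamma> \<delta> :: "real \<Rightarrow> 'a::euclidean_space"
  assumes W: "W12 \<gamma>" "W12 \<delta>" and c: "continuous_on UNIV \<gamma>" "continuous_on UNIV \<delta>"
  shows "energy \<gamma> \<le> 2 * energy \<delta> + 2 * energy (\<lambda>\<theta>. \<gamma> \<theta> - \<delta> \<theta>)"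
proof -
  let ?\<epsilon> = "\<lambda>\<theta>. \<gamma> \<theta> - \<delta> \<theta>"
  define g where "g = weak_deriv \<gamma>"
  define d where "d = weak_deriv \<delta>"
  define e where "e = weak_deriv ?\<epsilon>"
  have g: "is_weak_derivative \<gamma> g" and d: "is_weak_derivative \<delta> d"
    using W is_weak_derivative_weak_deriv unfolding W12_def g_def d_def by blast+
  have gd: "is_weak_derivative ?\<epsilon> (\<lambda>\<theta>. g \<theta> - d \<theta>)" by (rule is_weak_derivative_diff[OF g d c])
  hence e: "is_weak_derivative ?\<epsilon> e" unfolding e_def by (rule is_weak_derivative_weak_deriv)
  have ce: "continuous_on UNIV ?\<epsilon>" by (intro continuous_intros c)
  have z: "is_weak_derivative (\<lambda>\<theta>. ?\<epsilon> \<theta> - ?\<epsilon> \<theta>) (\<lambda>\<theta>. (g \<theta> - d \<theta>) - e \<theta>)"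
    by (rule is_weak_derivative_diff[OF gd e ce ce])
  have "AE \<theta> in lborel. \<theta> \<in> period \<longrightarrow> (g \<theta> - d \<theta>) - e \<theta> = 0"
  proof (rule AE_zero_of_orthogonal)
    show "circle_L2 (\<lambda>\<theta>. (g \<theta> - d \<theta>) - e \<theta>)" using z unfolding is_weak_derivative_def by blast
    fix \<phi> assume "circle_test_function \<phi>"
    hence "(LINT \<theta>:period|lborel. deriv \<phi> \<theta> *\<^sub>R (?\<epsilon> \<theta> - ?\<epsilon> \<theta>)) = - (LINT \<theta>:period|lborel. \<phi> \<theta> *\<^sub>R ((g \<theta> - d \<theta>) - e \<theta>))"
      using z unfolding is_weak_derivative_def by blast
    thus "(LINT \<theta>:period|lborel. \<phi> \<theta> *\<^sub>R ((g \<theta> - d \<theta>) - e \<theta>)) = 0" by simp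
  qed
  hence ae: "AE \<theta> in lborel. \<theta> \<in> period \<longrightarrow> (norm (g \<theta>))\<^sup>2 \<le> 2 * (norm (d \<theta>))\<^sup>2 + 2 * (norm (e \<theta>))\<^sup>2"
  proof eventually_elim
    case (elim \<theta>)
    show ?case
    proof
      assume "\<theta> \<in> period"
      hence "g \<theta> = d \<theta> + e \<theta>" using elim by (simp add: algebra_simps)
      hence "(norm (g \<theta>))\<^sup>2 \<le> (norm (d \<theta>) + norm (e \<theta>))\<^sup>2" by (simp add: norm_triangle_ineq power_mono)
      also have "\<dots> \<le> 2 * (norm (d \<theta>))\<^sup>2 + 2 * (norm (e \<theta>))\<^sup>2"
        using sum_squares_bound[of "norm (d \<theta>)" "norm (e \<theta>)"] by (simp add: power2_sum)
      finally show "(norm (g \<theta>))\<^sup>2 \<le> 2 * (norm (d \<theta>))\<^sup>2 + 2 * (norm (e \<theta>))\<^sup>2" .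
    qed
  qed
  have ig: "set_integrable lborel period (\<lambda>\<theta>. (norm (g \<theta>))\<^sup>2)" and id: "set_integrable lborel period (\<lambda>\<theta>. (norm (d \<theta>))\<^sup>2)"
    and ie: "set_integrable lborel period (\<lambda>\<theta>. (norm (e \<theta>))\<^sup>2)"
    using g d e unfolding is_weak_derivative_def circle_L2_def by auto
  have i2: "set_integrable lborel period (\<lambda>\<theta>. 2 * (norm (d \<theta>))\<^sup>2)" "set_integrable lborel period (\<lambda>\<theta>. 2 * (norm (e \<theta>))\<^sup>2)"
    by (rule set_integrable_mult_right, rule id, rule set_integrable_mult_right, rule ie)
  have "energy \<gamma> \<le> (LINT \<theta>:period|lborel. 2 * (norm (d \<theta>))\<^sup>2 + 2 * (norm (e \<theta>))\<^sup>2)"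
    unfolding energy_def g_def[symmetric]
    by (rule set_integral_mono_AE[OF ig set_integral_add(1)[OF i2] ae])
  also have "\<dots> = 2 * energy \<delta> + 2 * energy ?\<epsilon>"
    unfolding set_integral_add(2)[OF i2] set_integral_mult_right energy_def d_def[symmetric] e_def[symmetric] ..
  finally show ?thesis .
qed

lemma energy_nonneg: "energy \<gamma> \<ge> 0"
  unfolding energy_def set_lebesgue_integral_def by (rule Bochner_Integration.integral_nonneg) simp

section \<open>Energies of the slices of a sweepout\<close>

text \<open>The integral of the squared distance from \<open>g\<close> to its Fourier polynomial is nonnegative.\<close>

lemma bessel_inequality:
  fixes g :: "real \<Rightarrow> 'a::euclidean_space"
  assumes g: "circle_L2 g"
  defines "A \<equiv> \<lambda>j. LINT \<theta>:period|lborel. cos (real j * \<theta>) *\<^sub>R g \<theta>"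
    and "B \<equiv> \<lambda>j. LINT \<theta>:period|lborel. sin (real j * \<theta>) *\<^sub>R g \<theta>"
  shows "(\<Sum>j=1..N. (norm (A j))\<^sup>2 + (norm (B j))\<^sup>2) / pi \<le> (LINT \<theta>:period|lborel. (norm (g \<theta>))\<^sup>2)"
proof -
  define S where "S = (\<Sum>j=1..N. (norm (A j))\<^sup>2 + (norm (B j))\<^sup>2)"
  define a where "a j = (if j = 0 then 0 else (1 / pi) *\<^sub>R A j)" for j
  define b where "b j = (1 / pi) *\<^sub>R B j" for j
  define Q where "Q = trig_poly N a b"
  have cQ: "continuous_on UNIV Q" unfolding Q_def by (rule continuous_trig_poly)
  have gm: "g \<in> borel_measurable borel" using g unfolding circle_L2_def by blast
  have ic: "set_integrable lborel period (\<lambda>\<theta>. cos (real j * \<theta>) *\<^sub>R g \<theta>)" "set_integrable lborel period (\<lambda>\<theta>. sin (real j * \<theta>) *\<^sub>R g \<theta>)" for j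
    by (intro circle_L2_times_continuous g continuous_intros)+
  have inner_int: "set_integrable lborel period (\<lambda>\<theta>. c \<bullet> f \<theta>)" "(LINT \<theta>:period|lborel. c \<bullet> f \<theta>) = c \<bullet> (LINT \<theta>:period|lborel. f \<theta>)"
    if "set_integrable lborel period f" for c and f :: "real \<Rightarrow> 'a"
    using integrable_inner_right[of c lborel "\<lambda>\<theta>. indicator period \<theta> *\<^sub>R f \<theta>"]
      integral_inner_right[of c lborel "\<lambda>\<theta>. indicator period \<theta> *\<^sub>R f \<theta>"] that
    unfolding set_integrable_def set_lebesgue_integral_def by (simp_all add: inner_scaleR_right)
  have Qg: "Q \<theta> \<bullet> g \<theta> = (\<Sum>j\<le>N. a j \<bullet> (cos (real j * \<theta>) *\<^sub>R g \<theta>) + b j \<bullet> (sin (real j * \<theta>) *\<^sub>R g \<theta>))" for \<theta>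
    unfolding Q_def trig_poly_def inner_sum_left by (intro sum.cong refl) (simp add: inner_add_left)
  have term_int: "set_integrable lborel period (\<lambda>\<theta>. a j \<bullet> (cos (real j * \<theta>) *\<^sub>R g \<theta>) + b j \<bullet> (sin (real j * \<theta>) *\<^sub>R g \<theta>))" for j
    by (intro set_integral_add(1) inner_int(1) ic)
  have term_val: "(LINT \<theta>:period|lborel. a j \<bullet> (cos (real j * \<theta>) *\<^sub>R g \<theta>) + b j \<bullet> (sin (real j * \<theta>) *\<^sub>R g \<theta>)) = a j \<bullet> A j + b j \<bullet> B j" for j
    unfolding set_integral_add(2)[OF inner_int(1)[OF ic(1)] inner_int(1)[OF ic(2)]] inner_int(2)[OF ic(1)] inner_int(2)[OF ic(2)] A_def B_def ..
  have iQg: "set_integrable lborel period (\<lambda>\<theta>. Q \<theta> \<bullet> g \<theta>)"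
    unfolding Qg using term_int unfolding set_integrable_def scaleR_sum_right by (intro Bochner_Integration.integrable_sum)
  have B0: "B 0 = 0" unfolding B_def set_lebesgue_integral_def by simp
  have "(LINT \<theta>:period|lborel. Q \<theta> \<bullet> g \<theta>) = (\<Sum>j\<le>N. LINT \<theta>:period|lborel. a j \<bullet> (cos (real j * \<theta>) *\<^sub>R g \<theta>) + b j \<bullet> (sin (real j * \<theta>) *\<^sub>R g \<theta>))"
    unfolding Qg using term_int unfolding set_integrable_def set_lebesgue_integral_def scaleR_sum_right
    by (intro Bochner_Integration.integral_sum)
  also have "\<dots> = (\<Sum>j\<le>N. a j \<bullet> A j + b j \<bullet> B j)" unfolding term_val ..
  also have "\<dots> = (\<Sum>j=1..N. a j \<bullet> A j + b j \<bullet> B j)"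
    using B0 by (intro sum.mono_neutral_right) (auto simp: a_def b_def Suc_le_eq)
  also have "\<dots> = (\<Sum>j=1..N. ((norm (A j))\<^sup>2 + (norm (B j))\<^sup>2) / pi)"
    by (intro sum.cong refl) (auto simp: a_def b_def power2_norm_eq_inner add_divide_distrib)
  finally have Qg_val: "(LINT \<theta>:period|lborel. Q \<theta> \<bullet> g \<theta>) = S / pi" by (simp add: S_def sum_divide_distrib)
  have iQ: "set_integrable lborel period (\<lambda>\<theta>. (norm (Q \<theta>))\<^sup>2)"
    by (intro continuous_set_integrable_period continuous_intros cQ)
  have "((\<lambda>\<theta>. (norm (Q \<theta>))\<^sup>2) has_integral pi * (\<Sum>j=1..N. (norm (a j))\<^sup>2 + (norm (b j))\<^sup>2)) period"
    unfolding Q_def by (rule parseval_trig_poly) (simp add: a_def)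
  moreover have "pi * (\<Sum>j=1..N. (norm (a j))\<^sup>2 + (norm (b j))\<^sup>2) = S / pi"
  proof -
    have "pi * (\<Sum>j=1..N. (norm (a j))\<^sup>2 + (norm (b j))\<^sup>2) = (\<Sum>j=1..N. ((norm (A j))\<^sup>2 + (norm (B j))\<^sup>2) / pi)"
      unfolding sum_distrib_left
      by (intro sum.cong refl) (auto simp: a_def b_def power_divide power2_eq_square field_simps)
    thus ?thesis by (simp add: S_def sum_divide_distrib)
  qed
  ultimately have Q_val: "(LINT \<theta>:period|lborel. (norm (Q \<theta>))\<^sup>2) = S / pi"
    using set_borel_integral_eq_integral(2)[OF iQ] by (simp add: integral_unique)
  have ig: "set_integrable lborel period (\<lambda>\<theta>. (norm (g \<theta>))\<^sup>2)" using g unfolding circle_L2_def by blast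
  have i2: "set_integrable lborel period (\<lambda>\<theta>. 2 * (Q \<theta> \<bullet> g \<theta>))" by (rule set_integrable_mult_right) (rule iQg)
  have "0 \<le> (LINT \<theta>:period|lborel. (norm (g \<theta> - Q \<theta>))\<^sup>2)"
    unfolding set_lebesgue_integral_def by (rule Bochner_Integration.integral_nonneg) simp
  also have "(\<lambda>\<theta>. (norm (g \<theta> - Q \<theta>))\<^sup>2) = (\<lambda>\<theta>. ((norm (g \<theta>))\<^sup>2 - 2 * (Q \<theta> \<bullet> g \<theta>)) + (norm (Q \<theta>))\<^sup>2)"
    by (auto simp: power2_norm_eq_inner inner_diff_left inner_diff_right inner_commute)
  also have "(LINT \<theta>:period|lborel. ((norm (g \<theta>))\<^sup>2 - 2 * (Q \<theta> \<bullet> g \<theta>)) + (norm (Q \<theta>))\<^sup>2) =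
      (LINT \<theta>:period|lborel. (norm (g \<theta>))\<^sup>2) - 2 * (S / pi) + S / pi"
    unfolding set_integral_add(2)[OF set_integral_diff(1)[OF ig i2] iQ] set_integral_diff(2)[OF ig i2] set_integral_mult_right Qg_val Q_val ..
  finally show ?thesis by (simp add: S_def)
qed

text \<open>Tested with \<open>sin (j \<theta>)\<close> and \<open>cos (j \<theta>)\<close>, the definition of the weak derivative \<open>g\<close> expresses its
  Fourier coefficients by those of \<open>\<gamma>\<close>.  The smoothing kernel does not increase them, so Bessel's
  inequality for \<open>g\<close> gives the bound.\<close>

lemma trig_energy_smoothing_le_energy:
  fixes \<gamma> :: "real \<Rightarrow> 'a::euclidean_space"
  assumes W: "W12 \<gamma>" and c: "continuous_on UNIV \<gamma>"
  shows "trig_energy N (smooth_cos N \<gamma>) (smooth_sin N \<gamma>) \<le> energy \<gamma>"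
proof -
  define g where "g = weak_deriv \<gamma>"
  have g: "is_weak_derivative \<gamma> g" using W is_weak_derivative_weak_deriv unfolding W12_def g_def by blast
  have L2: "circle_L2 g" using g unfolding is_weak_derivative_def by blast
  define A where "A j = (LINT \<theta>:period|lborel. cos (real j * \<theta>) *\<^sub>R g \<theta>)" for j
  define B where "B j = (LINT \<theta>:period|lborel. sin (real j * \<theta>) *\<^sub>R g \<theta>)" for j
  have weak: "(LINT \<theta>:period|lborel. deriv \<phi> \<theta> *\<^sub>R \<gamma> \<theta>) = - (LINT \<theta>:period|lborel. \<phi> \<theta> *\<^sub>R g \<theta>)" if "circle_test_function \<phi>" for \<phi>
    using g that unfolding is_weak_derivative_def by blast
  have HK: "(LINT \<theta>:period|lborel. f \<theta> *\<^sub>R \<gamma> \<theta>) = integral period (\<lambda>\<theta>. f \<theta> *\<^sub>R \<gamma> \<theta>)" if "continuous_on UNIV f" for f :: "real \<Rightarrow> real"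
    by (rule set_borel_integral_eq_integral(2)) (intro continuous_set_integrable_period continuous_on_scaleR that c)
  have c1: "real j *\<^sub>R integral period (\<lambda>y. cos (real j * y) *\<^sub>R \<gamma> y) = - B j" for j
  proof -
    have "deriv (\<lambda>\<theta>. sin (real j * \<theta>)) \<theta> = real j * cos (real j * \<theta>)" for \<theta>
      by (intro DERIV_imp_deriv) (auto intro!: derivative_eq_intros)
    hence "(LINT \<theta>:period|lborel. (real j * cos (real j * \<theta>)) *\<^sub>R \<gamma> \<theta>) = - B j"
      using weak[of "\<lambda>\<theta>. sin (real j * \<theta>)"] circle_test_function_trig[of 0 j 1] by (simp add: B_def)
    moreover have "(LINT \<theta>:period|lborel. (real j * cos (real j * \<theta>)) *\<^sub>R \<gamma> \<theta>) = integral period (\<lambda>\<theta>. (real j * cos (real j * \<theta>)) *\<^sub>R \<gamma> \<theta>)"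
      by (rule HK) (intro continuous_intros)
    moreover have "\<dots> = real j *\<^sub>R integral period (\<lambda>\<theta>. cos (real j * \<theta>) *\<^sub>R \<gamma> \<theta>)"
      unfolding scaleR_scaleR[symmetric] by (rule integral_cmul)
    ultimately show ?thesis by (simp only:)
  qed
  have c2: "real j *\<^sub>R integral period (\<lambda>y. sin (real j * y) *\<^sub>R \<gamma> y) = A j" for j
  proof -
    have "deriv (\<lambda>\<theta>. cos (real j * \<theta>)) \<theta> = - real j * sin (real j * \<theta>)" for \<theta>
      by (intro DERIV_imp_deriv) (auto intro!: derivative_eq_intros)
    hence "(LINT \<theta>:period|lborel. (- real j * sin (real j * \<theta>)) *\<^sub>R \<gamma> \<theta>) = - A j"
      using weak[of "\<lambda>\<theta>. cos (real j * \<theta>)"] circle_test_function_trig[of 1 j 0] by (simp add: A_def)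
    moreover have "(LINT \<theta>:period|lborel. (- real j * sin (real j * \<theta>)) *\<^sub>R \<gamma> \<theta>) = integral period (\<lambda>\<theta>. (- real j * sin (real j * \<theta>)) *\<^sub>R \<gamma> \<theta>)"
      by (rule HK) (intro continuous_intros)
    moreover have "\<dots> = - real j *\<^sub>R integral period (\<lambda>\<theta>. sin (real j * \<theta>) *\<^sub>R \<gamma> \<theta>)"
      unfolding scaleR_scaleR[symmetric] by (rule integral_cmul)
    ultimately have "- real j *\<^sub>R integral period (\<lambda>\<theta>. sin (real j * \<theta>) *\<^sub>R \<gamma> \<theta>) = - A j" by (simp only:)
    thus ?thesis by simp
  qed
  have "(real j)\<^sup>2 * ((norm (smooth_cos N \<gamma> j))\<^sup>2 + (norm (smooth_sin N \<gamma> j))\<^sup>2) \<le> ((norm (A j))\<^sup>2 + (norm (B j))\<^sup>2) / pi\<^sup>2"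
    if j: "j \<in> {1..N}" for j
  proof -
    have "real j * norm (smooth_cos N \<gamma> j) = \<bar>bump_coeff N j\<bar> * norm (real j *\<^sub>R integral period (\<lambda>y. cos (real j * y) *\<^sub>R \<gamma> y))"
      by (simp add: smooth_cos_def)
    hence 1: "real j * norm (smooth_cos N \<gamma> j) = \<bar>bump_coeff N j\<bar> * norm (B j)" unfolding c1 by simp
    have "real j * norm (smooth_sin N \<gamma> j) = \<bar>bump_coeff N j\<bar> * norm (real j *\<^sub>R integral period (\<lambda>y. sin (real j * y) *\<^sub>R \<gamma> y))"
      by (simp add: smooth_sin_def)
    hence 2: "real j * norm (smooth_sin N \<gamma> j) = \<bar>bump_coeff N j\<bar> * norm (A j)" unfolding c2 .
    have "\<bar>bump_coeff N j\<bar> \<le> 1 / pi" using bump_coeff_bound[OF j] by (simp add: abs_mult field_simps)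
    hence w: "(bump_coeff N j)\<^sup>2 \<le> 1 / pi\<^sup>2" using power_mono[of "\<bar>bump_coeff N j\<bar>" "1 / pi" 2] by (simp add: power_divide)
    have "(real j)\<^sup>2 * ((norm (smooth_cos N \<gamma> j))\<^sup>2 + (norm (smooth_sin N \<gamma> j))\<^sup>2)
       = (real j * norm (smooth_cos N \<gamma> j))\<^sup>2 + (real j * norm (smooth_sin N \<gamma> j))\<^sup>2" by (simp add: power_mult_distrib distrib_left)
    also have "\<dots> = (bump_coeff N j)\<^sup>2 * ((norm (A j))\<^sup>2 + (norm (B j))\<^sup>2)" unfolding 1 2 by (simp add: power_mult_distrib distrib_left)
    also have "\<dots> \<le> 1 / pi\<^sup>2 * ((norm (A j))\<^sup>2 + (norm (B j))\<^sup>2)" using w by (rule mult_right_mono) simp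
    finally show ?thesis by simp
  qed
  hence "trig_energy N (smooth_cos N \<gamma>) (smooth_sin N \<gamma>) \<le> pi * (\<Sum>j=1..N. ((norm (A j))\<^sup>2 + (norm (B j))\<^sup>2) / pi\<^sup>2)"
    unfolding trig_energy_def by (intro mult_left_mono sum_mono) auto
  also have "\<dots> = (\<Sum>j=1..N. (norm (A j))\<^sup>2 + (norm (B j))\<^sup>2) / pi"
    unfolding sum_divide_distrib[symmetric] by (simp add: power2_eq_square)
  also have "\<dots> \<le> energy \<gamma>"
    unfolding energy_def g_def[symmetric] A_def B_def by (rule bessel_inequality[OF L2])
  finally show ?thesis .
qed

lemma trig_energy_dilation:
  fixes \<gamma> :: "real \<Rightarrow> 'a::euclidean_space"
  assumes c: "continuous_on UNIV \<gamma>"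
  shows "trig_energy N (smooth_cos N (\<lambda>\<theta>. x + m *\<^sub>R \<gamma> \<theta>)) (smooth_sin N (\<lambda>\<theta>. x + m *\<^sub>R \<gamma> \<theta>)) =
    m\<^sup>2 * trig_energy N (smooth_cos N \<gamma>) (smooth_sin N \<gamma>)"
proof -
  have i: "(\<lambda>y. cos (real j * y) *\<^sub>R \<gamma> y) integrable_on period" "(\<lambda>y. sin (real j * y) *\<^sub>R \<gamma> y) integrable_on period" for j
    by (intro integrable_continuous_interval continuous_intros continuous_on_subset[OF c]; simp)+
  have cos0: "((\<lambda>y. cos (real j * y) *\<^sub>R x) has_integral 0 *\<^sub>R x) period" if "j \<ge> 1" for j
    using has_integral_linear[OF has_integral_cos_int[of "int j"] bounded_linear_scaleR_left[of x]] that by (simp add: o_def)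
  have sin0: "((\<lambda>y. sin (real j * y) *\<^sub>R x) has_integral 0 *\<^sub>R x) period" for j
    using has_integral_linear[OF has_integral_sin_int[of "int j"] bounded_linear_scaleR_left[of x]] by (simp add: o_def)
  have 1: "smooth_cos N (\<lambda>\<theta>. x + m *\<^sub>R \<gamma> \<theta>) j = m *\<^sub>R smooth_cos N \<gamma> j" if "j \<ge> 1" for j
  proof -
    have "((\<lambda>y. cos (real j * y) *\<^sub>R x + m *\<^sub>R (cos (real j * y) *\<^sub>R \<gamma> y)) has_integral 0 *\<^sub>R x + m *\<^sub>R integral period (\<lambda>y. cos (real j * y) *\<^sub>R \<gamma> y)) period"
      by (intro has_integral_add has_integral_cmul integrable_integral i cos0 that)
    hence "integral period (\<lambda>y. cos (real j * y) *\<^sub>R (x + m *\<^sub>R \<gamma> y)) = m *\<^sub>R integral period (\<lambda>y. cos (real j * y) *\<^sub>R \<gamma> y)"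
      by (simp add: integral_unique scaleR_add_right mult.commute)
    thus ?thesis by (simp add: smooth_cos_def mult.commute)
  qed
  have 2: "smooth_sin N (\<lambda>\<theta>. x + m *\<^sub>R \<gamma> \<theta>) j = m *\<^sub>R smooth_sin N \<gamma> j" for j
  proof -
    have "((\<lambda>y. sin (real j * y) *\<^sub>R x + m *\<^sub>R (sin (real j * y) *\<^sub>R \<gamma> y)) has_integral 0 *\<^sub>R x + m *\<^sub>R integral period (\<lambda>y. sin (real j * y) *\<^sub>R \<gamma> y)) period"
      by (intro has_integral_add has_integral_cmul integrable_integral i sin0)
    hence "integral period (\<lambda>y. sin (real j * y) *\<^sub>R (x + m *\<^sub>R \<gamma> y)) = m *\<^sub>R integral period (\<lambda>y. sin (real j * y) *\<^sub>R \<gamma> y)"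
      by (simp add: integral_unique scaleR_add_right mult.commute)
    thus ?thesis by (simp add: smooth_sin_def mult.commute)
  qed
  have "(\<Sum>j=1..N. (real j)\<^sup>2 * ((norm (smooth_cos N (\<lambda>\<theta>. x + m *\<^sub>R \<gamma> \<theta>) j))\<^sup>2 + (norm (smooth_sin N (\<lambda>\<theta>. x + m *\<^sub>R \<gamma> \<theta>) j))\<^sup>2))
     = (\<Sum>j=1..N. m\<^sup>2 * ((real j)\<^sup>2 * ((norm (smooth_cos N \<gamma> j))\<^sup>2 + (norm (smooth_sin N \<gamma> j))\<^sup>2)))"
    by (intro sum.cong refl) (simp add: 1 2 power_mult_distrib distrib_left mult_ac)
  thus ?thesis unfolding trig_energy_def sum_distrib_left[symmetric] by simp
qed

lemma slice_continuous_periodic: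
  assumes "continuous_on cylinder \<sigma>" "s \<in> cball 0 1"
  shows "continuous_on UNIV (slice \<sigma> s)" "periodic (slice \<sigma> s)"
proof -
  show "continuous_on UNIV (slice \<sigma> s)"
    unfolding slice_def by (rule continuous_on_compose2[OF assms(1)]) (use assms(2) in \<open>auto intro!: continuous_intros continuous_on_cis\<close>)
  have "cis (\<theta> + 2 * pi) = cis \<theta>" for \<theta> by (simp add: complex_eq_iff)
  thus "periodic (slice \<sigma> s)" by (simp add: periodic_def slice_def)
qed

text \<open>The width is defined with a supremum of real numbers, which is an upper bound only if the energies
  are bounded.  They are bounded near each parameter because the slices depend continuously on it
  in \<open>W\<^sup>1\<^sup>2\<close>, and the parameters form a compact set.\<close>

lemma sweepout_energies_bounded:
  fixes \<sigma> :: "complex \<times> 'p::euclidean_space \<Rightarrow> 'a::euclidean_space"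
  assumes \<sigma>: "\<sigma> \<in> sweepouts M"
  shows "bdd_above ((\<lambda>s. energy (slice \<sigma> s)) ` cball 0 1)"
proof (rule ccontr)
  assume nb: "\<not> ?thesis"
  have "\<exists>s. s \<in> cball 0 1 \<and> energy (slice \<sigma> s) > real n" for n
    using nb unfolding bdd_above_def by (force simp: not_le)
  then obtain x where x: "\<And>n. x n \<in> cball 0 1" "\<And>n. energy (slice \<sigma> (x n)) > real n" by metis
  have "compact (cball (0::'p) 1)" by simp
  then obtain s r where s: "s \<in> cball 0 1" "strict_mono (r::nat\<Rightarrow>nat)" "(x \<circ> r) \<longlonglongrightarrow> s"
    using x(1) unfolding compact_def by metis
  have co: "continuous_on cylinder \<sigma>" and W: "\<And>s. s \<in> cball 0 1 \<Longrightarrow> W12 (slice \<sigma> s)"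
    using \<sigma> unfolding sweepouts_def by auto
  have "((\<lambda>s'. W12_norm (\<lambda>\<theta>. slice \<sigma> s' \<theta> - slice \<sigma> s \<theta>)) \<longlongrightarrow> 0) (at s within cball 0 1)"
    using \<sigma> s(1) unfolding sweepouts_def by blast
  hence "\<forall>\<^sub>F s' in at s within cball 0 1. W12_norm (\<lambda>\<theta>. slice \<sigma> s' \<theta> - slice \<sigma> s \<theta>) < 1"
    by (rule order_tendstoD) simp
  then obtain d where d: "d > 0" "\<And>s'. s' \<in> cball 0 1 \<Longrightarrow> s' \<noteq> s \<Longrightarrow> dist s' s < d \<Longrightarrow>
      W12_norm (\<lambda>\<theta>. slice \<sigma> s' \<theta> - slice \<sigma> s \<theta>) < 1"
    unfolding eventually_at by auto
  have le: "energy (slice \<sigma> s') \<le> 2 * energy (slice \<sigma> s) + 2" if s': "s' \<in> cball 0 1" "dist s' s < d" for s'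
  proof (cases "s' = s")
    case True thus ?thesis using energy_nonneg[of "slice \<sigma> s"] by simp
  next
    case False
    let ?e = "energy (\<lambda>\<theta>. slice \<sigma> s' \<theta> - slice \<sigma> s \<theta>)"
    let ?n = "LINT \<theta>:period|lborel. (norm (slice \<sigma> s' \<theta> - slice \<sigma> s \<theta>))\<^sup>2"
    have "sqrt (?n + ?e) < 1" using d(2)[OF s'(1) False s'(2)] unfolding W12_norm_def .
    hence "?n + ?e < 1" by simp
    moreover have "?n \<ge> 0" unfolding set_lebesgue_integral_def by (rule Bochner_Integration.integral_nonneg) simp
    ultimately have "?e \<le> 1" by linarith
    moreover have "energy (slice \<sigma> s') \<le> 2 * energy (slice \<sigma> s) + 2 * ?e"
      by (rule energy_le_of_difference[OF W[OF s'(1)] W[OF s(1)] slice_continuous_periodic(1)[OF co s'(1)] slice_continuous_periodic(1)[OF co s(1)]])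
    ultimately show ?thesis by linarith
  qed
  obtain N1 where N1: "\<And>n. n \<ge> N1 \<Longrightarrow> dist ((x \<circ> r) n) s < d" using metric_LIMSEQ_D[OF s(3) d(1)] by blast
  obtain N2 :: nat where N2: "2 * energy (slice \<sigma> s) + 2 < real N2" using reals_Archimedean2 by blast
  define n where "n = max N1 N2"
  have "real N2 \<le> real (r n)" using seq_suble[OF s(2), of n] by (simp add: n_def)
  also have "\<dots> < energy (slice \<sigma> (x (r n)))" by (rule x(2))
  also have "\<dots> \<le> 2 * energy (slice \<sigma> s) + 2" by (rule le) (use x(1) N1[of n] in \<open>auto simp: n_def\<close>)
  finally show False using N2 by simp
qed

section \<open>The map of the sphere induced by a sweepout\<close>

text \<open>The sphere is the quotient of the cylinder by the map that takes \<open>(z, y)\<close> to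
  \<open>(sqrt (1 - |y|\<^sup>2) z, y)\<close>, and collapsed maps are constant on its fibers.\<close>

lemma homotopic_induced_map:
  fixes f g :: "complex \<times> 'p::euclidean_space \<Rightarrow> 'a::euclidean_space"
  assumes "homotopic_with_canon collapsed cylinder Y f g"
  shows "homotopic_with_canon (\<lambda>_. True) (sphere 0 1) Y (induced_map f) (induced_map g)"
proof -
  obtain h where h: "continuous_on ({0..1::real} \<times> cylinder) h" "h \<in> {0..1} \<times> cylinder \<rightarrow> Y"
    "\<And>x. h (0, x) = f x" "\<And>x. h (1, x) = g x" "\<And>t. t \<in> {0..1} \<Longrightarrow> collapsed (\<lambda>x. h (t, x))"
  proof -
    from assms[unfolded homotopic_with_def prod_topology_subtopology_eu]
    obtain h where h: "continuous_map (top_of_set ({0..1::real} \<times> cylinder)) (top_of_set Y) h"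
      "\<forall>x. h (0, x) = f x" "\<forall>x. h (1, x) = g x" "\<forall>t\<in>{0..1}. collapsed (\<lambda>x. h (t, x))"
      by (elim exE conjE)
    from h(1) have "continuous_on ({0..1} \<times> cylinder) h" "h \<in> {0..1} \<times> cylinder \<rightarrow> Y" by simp_all
    from that[OF this spec[OF h(2)] spec[OF h(3)] bspec[OF h(4)]] show ?thesis .
  qed
  define q where "q = (\<lambda>(u :: real, z :: complex, y :: 'p). (u, (of_real (sqrt (1 - (norm y)\<^sup>2)) * z, y)))"
  define k where "k = (\<lambda>(u, x). induced_map (\<lambda>w. h (u, w)) x)"
  let ?A = "{0..1 :: real} \<times> (cylinder :: (complex \<times> 'p) set)"
  have kq: "k (q w) = h w" if w: "w \<in> ?A" for w
  proof -
    obtain u z y where wu: "w = (u, z, y)" by (cases w) auto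
    have u: "u \<in> {0..1}" and z: "norm z = 1" and y: "norm y \<le> 1" using w wu by auto
    show ?thesis
    proof (cases "norm y = 1")
      case True
      obtain c where c: "\<forall>z\<in>sphere 0 1. h (u, z, y) = c"
        using h(5)[OF u] True unfolding collapsed_def by (metis mem_sphere_0)
      have "k (q w) = h (u, 1, y)" using True by (simp add: wu q_def k_def induced_map_def)
      also have "\<dots> = h (u, z, y)" using c z by simp
      finally show ?thesis using wu by simp
    next
      case False
      hence "(norm y)\<^sup>2 < 1" using y by (simp add: power_less_one_iff abs_square_less_1)
      hence s: "sqrt (1 - (norm y)\<^sup>2) > 0" by simp
      define r where "r = sqrt (1 - (norm y)\<^sup>2)"
      have "r > 0" using s by (simp add: r_def)
      have "z \<noteq> 0" using z by auto
      have "sgn (of_real r * z) = z" using \<open>r > 0\<close> z by (simp add: sgn_div_norm norm_mult scaleR_conv_of_real)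
      moreover have "of_real r * z \<noteq> 0" using \<open>r > 0\<close> \<open>z \<noteq> 0\<close> by simp
      ultimately show ?thesis by (simp add: wu q_def k_def induced_map_def r_def[symmetric])
    qed
  qed
  have "continuous_on (q ` ?A) k"
  proof (rule continuous_on_compact_quotient)
    show "compact ?A" by (intro compact_Times compact_Icc compact_cball compact_sphere)
    show "continuous_on ?A q" unfolding q_def case_prod_unfold by (intro continuous_intros)
    show "continuous_on ?A (\<lambda>x. k (q x))" by (rule continuous_on_eq[OF h(1) kq[symmetric]])
  qed
  moreover have qA: "q ` ?A = {0..1} \<times> sphere 0 1"
  proof
    have nq: "norm (complex_of_real (sqrt (1 - (norm y)\<^sup>2)) * z, y) = 1" if "norm z = 1" "norm y \<le> 1" for z and y :: 'p
    proof -
      have "(norm y)\<^sup>2 \<le> 1" using that(2) by (simp add: power_le_one)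
      thus ?thesis using that(1) by (simp add: norm_Pair norm_mult)
    qed
    show "q ` ?A \<subseteq> {0..1} \<times> sphere 0 1"
    proof (rule image_subsetI)
      fix w assume "w \<in> ?A"
      hence "fst w \<in> {0..1}" "norm (fst (snd w)) = 1" "norm (snd (snd w)) \<le> 1" by (simp_all add: mem_Times_iff)
      thus "q w \<in> {0..1} \<times> sphere 0 1" using nq by (simp add: q_def case_prod_unfold)
    qed
    show "{0..1} \<times> sphere 0 1 \<subseteq> q ` ?A"
    proof
      fix w :: "real \<times> complex \<times> 'p" assume w: "w \<in> {0..1} \<times> sphere 0 1"
      obtain u x y where wu: "w = (u, x, y)" by (cases w) auto
      have u: "u \<in> {0..1}" and n: "norm (x, y) = 1" using w wu by auto
      have n2: "(norm x)\<^sup>2 + (norm y)\<^sup>2 = 1" using n by (simp add: norm_Pair)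
      hence "(norm y)\<^sup>2 \<le> 1" using zero_le_power2[of "norm x"] by linarith
      hence y: "norm y \<le> 1" by (simp add: abs_square_le_1)
      have sx: "sqrt (1 - (norm y)\<^sup>2) = norm x" using n2 by (metis add_diff_cancel_right' norm_ge_zero real_sqrt_unique)
      define z where "z = (if x = 0 then 1 else sgn x)"
      have "norm z = 1" by (simp add: z_def norm_sgn)
      moreover have "of_real (norm x) * z = x" by (simp add: z_def sgn_div_norm scaleR_conv_of_real)
      ultimately show "w \<in> q ` ?A" using u y wu sx by (intro image_eqI[of _ _ "(u, z, y)"]) (auto simp: q_def)
    qed
  qed
  ultimately have "continuous_on ({0..1} \<times> sphere 0 1) k" by simp
  moreover have "k \<in> {0..1} \<times> sphere 0 1 \<rightarrow> Y"
  proof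
    fix w assume "w \<in> {0..1 :: real} \<times> sphere (0 :: complex \<times> 'p) 1"
    then obtain v where "v \<in> ?A" "w = q v" unfolding qA[symmetric] by blast
    thus "k w \<in> Y" using kq h(2) by auto
  qed
  ultimately show ?thesis
    unfolding homotopic_with_def prod_topology_subtopology_eu
    by (intro exI[of _ k]) (simp add: k_def h(3,4))
qed

text \<open>A null homotopy extends the map of the sphere to the ball.  Contracting the ball to the base point
  then gives a null homotopy that fixes the base point.\<close>

lemma trivial_induced_class_of_nullhomotopic:
  fixes \<sigma> :: "complex \<times> 'p::euclidean_space \<Rightarrow> 'a::euclidean_space"
  assumes "homotopic_with_canon (\<lambda>_. True) (sphere 0 1) Y (induced_map \<sigma>) (\<lambda>_. c)"
  shows "trivial_induced_class Y \<sigma>"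
proof -
  let ?f = "induced_map \<sigma>" and ?e = "(1, 0) :: complex \<times> 'p"
  define p where "p = ?f ?e"
  obtain G where G: "continuous_on (cball 0 1) G" "G ` cball 0 1 \<subseteq> Y" "\<And>x. x \<in> sphere 0 1 \<Longrightarrow> G x = ?f x"
    using assms nullhomotopic_from_sphere_extension[of 0 1 Y ?f] by blast
  have e: "?e \<in> sphere 0 1" by (simp add: norm_Pair)
  define h where "h = (\<lambda>(u :: real, x). G ((1 - u) *\<^sub>R x + u *\<^sub>R ?e))"
  have inb: "(1 - u) *\<^sub>R x + u *\<^sub>R ?e \<in> cball 0 1" if "u \<in> {0..1}" "x \<in> sphere 0 1" for u :: real and x
    by (rule convexD[OF convex_cball]) (use that e in auto)
  have "homotopic_with_canon (\<lambda>g. g ?e = p) (sphere 0 1) Y ?f (\<lambda>_. p)"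
  proof (subst homotopic_with)
    show "(h ?e = p) = (k ?e = p)" if "\<And>x. x \<in> topspace (top_of_set (sphere 0 1)) \<Longrightarrow> h x = k x" for h k :: "complex \<times> 'p \<Rightarrow> 'a"
      using that[of ?e] e by simp
    show "\<exists>h. continuous_map (prod_topology (top_of_set {0..1::real}) (top_of_set (sphere 0 1))) (top_of_set Y) h \<and>
        (\<forall>x\<in>topspace (top_of_set (sphere 0 1)). h (0, x) = ?f x) \<and>
        (\<forall>x\<in>topspace (top_of_set (sphere 0 1)). h (1, x) = p) \<and> (\<forall>t\<in>{0..1::real}. h (t, ?e) = p)"
    proof (intro exI[of _ h] conjI ballI)
      have "continuous_on ({0..1::real} \<times> sphere (0 :: complex \<times> 'p) 1) (\<lambda>x. G ((1 - fst x) *\<^sub>R snd x + fst x *\<^sub>R ?e))"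
      proof (rule continuous_on_compose2[OF G(1)])
        show "(\<lambda>x. (1 - fst x) *\<^sub>R snd x + fst x *\<^sub>R ?e) ` ({0..1::real} \<times> sphere (0 :: complex \<times> 'p) 1) \<subseteq> cball 0 1"
          by (rule image_subsetI, rule inb) (simp_all add: mem_Times_iff)
      qed (intro continuous_intros)
      moreover have "h \<in> {0..1} \<times> sphere (0 :: complex \<times> 'p) 1 \<rightarrow> Y"
      proof
        fix x assume "x \<in> {0..1::real} \<times> sphere (0 :: complex \<times> 'p) 1"
        hence "(1 - fst x) *\<^sub>R snd x + fst x *\<^sub>R ?e \<in> cball 0 1" by (intro inb) (simp_all add: mem_Times_iff)
        thus "h x \<in> Y" using G(2) by (auto simp: h_def case_prod_unfold)
      qed
      ultimately show "continuous_map (prod_topology (top_of_set {0..1}) (top_of_set (sphere 0 1))) (top_of_set Y) h"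
        unfolding prod_topology_subtopology_eu by (simp add: h_def case_prod_unfold)
      show "h (0, x) = ?f x" if "x \<in> topspace (top_of_set (sphere 0 1))" for x using that G(3) by (simp add: h_def flip: zero_prod_def)
      show "h (1, x) = p" for x using G(3)[OF e] by (simp add: h_def p_def)
      show "h (t, ?e) = p" for t using G(3)[OF e] by (simp add: h_def p_def scaleR_add_left[symmetric] del: scaleR_Pair)
    qed
  qed
  thus ?thesis unfolding trivial_induced_class_def Let_def p_def .
qed

section \<open>The width bounds the extinction time\<close>

lemma sweepouts_cong:
  fixes \<sigma> \<tau> :: "complex \<times> 'p::euclidean_space \<Rightarrow> 'a::euclidean_space"
  assumes \<sigma>: "\<sigma> \<in> sweepouts M" and eq: "\<And>x. x \<in> cylinder \<Longrightarrow> \<tau> x = \<sigma> x"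
  shows "\<tau> \<in> sweepouts M"
proof -
  have sl: "slice \<tau> s = slice \<sigma> s" if "s \<in> cball 0 1" for s
    using eq that by (auto simp: slice_def)
  have "continuous_on cylinder \<tau>"
    using \<sigma> eq unfolding sweepouts_def by (auto intro: continuous_on_eq[of _ \<sigma>])
  moreover have "\<tau> ` cylinder = \<sigma> ` cylinder" by (rule image_cong[OF refl eq])
  moreover have "((\<lambda>s'. W12_norm (\<lambda>\<theta>. slice \<tau> s' \<theta> - slice \<tau> s \<theta>)) \<longlongrightarrow> 0) (at s within cball 0 1)"
    if s: "s \<in> cball 0 1" for s
  proof -
    have "((\<lambda>s'. W12_norm (\<lambda>\<theta>. slice \<sigma> s' \<theta> - slice \<sigma> s \<theta>)) \<longlongrightarrow> 0) (at s within cball 0 1)"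
      using \<sigma> s unfolding sweepouts_def by blast
    moreover have "\<forall>\<^sub>F s' in at s within cball 0 1.
        W12_norm (\<lambda>\<theta>. slice \<sigma> s' \<theta> - slice \<sigma> s \<theta>) = W12_norm (\<lambda>\<theta>. slice \<tau> s' \<theta> - slice \<tau> s \<theta>)"
      unfolding eventually_at_filter using sl s by (intro always_eventually) simp
    ultimately show ?thesis by (rule Lim_transform_eventually)
  qed
  moreover have "\<exists>c. \<forall>z\<in>sphere 0 1. \<tau> (z, s) = c" if s: "s \<in> sphere 0 1" for s
  proof -
    obtain c where "\<forall>z\<in>sphere 0 1. \<sigma> (z, s) = c" using \<sigma> s unfolding sweepouts_def by blast
    hence "\<forall>z\<in>sphere 0 1. \<tau> (z, s) = c" using eq s by simp
    thus ?thesis by blast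
  qed
  ultimately show ?thesis using \<sigma> sl unfolding sweepouts_def by auto
qed

lemma sweepout_collapsed: "\<sigma> \<in> sweepouts M \<Longrightarrow> collapsed \<sigma>"
  unfolding sweepouts_def collapsed_def by blast

lemma induced_map_cong:
  fixes \<sigma> \<tau> :: "complex \<times> 'p::euclidean_space \<Rightarrow> 'a::euclidean_space"
  assumes "\<And>x. x \<in> cylinder \<Longrightarrow> \<tau> x = \<sigma> x" "x \<in> sphere 0 1"
  shows "induced_map \<tau> x = induced_map \<sigma> x"
proof -
  obtain z y where x: "x = (z, y)" by (cases x)
  have "norm y \<le> norm (z, y)" by (rule norm_snd_le)
  hence "norm y \<le> 1" using assms(2) x by simp
  hence "(if z = 0 then 1 else sgn z, y) \<in> cylinder" by (auto simp: norm_sgn)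
  from assms(1)[OF this] show ?thesis by (simp add: x induced_map_def)
qed

context convex_flow
begin

lemma F_0: "z \<in> M 0 \<Longrightarrow> F 0 z = z"
  using flow unfolding strictly_convex_mcf_def by blast

lemma dilation_outside:
  assumes p: "p \<in> interior (K 0)" and x: "x \<in> M 0" and m: "m > 1"
  shows "p + m *\<^sub>R (x - p) \<notin> K 0"
proof
  assume in_K: "p + m *\<^sub>R (x - p) \<in> K 0"
  have "(p + m *\<^sub>R (x - p)) - (1 - 1 / m) *\<^sub>R ((p + m *\<^sub>R (x - p)) - p) \<in> interior (K 0)"
    by (rule mem_interior_convex_shrink[OF convex_convex_hull p in_K]) (use m in \<open>auto simp: field_simps\<close>)
  also have "(p + m *\<^sub>R (x - p)) - (1 - 1 / m) *\<^sub>R ((p + m *\<^sub>R (x - p)) - p) = x"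
  proof -
    have "(1 - 1 / m) * m = m - 1" using m by (simp add: field_simps)
    thus ?thesis by (simp add: scaleR_diff_left)
  qed
  finally have "x \<in> interior (K 0)" .
  moreover have "x \<in> frontier (K 0)" using x K_facts(3)[OF I_0] by simp
  ultimately show False unfolding frontier_def by blast
qed

text \<open>The curves have to be strictly outside the body at the beginning.  So the sweepout is first dilated
  from \<open>p\<close>, by a factor so close to 1 that the energies remain below \<open>4 \<pi> T'\<close>.\<close>

lemma low_energy_sweepout_contractible:
  fixes \<sigma> :: "complex \<times> 'p::euclidean_space \<Rightarrow> 'a"
  assumes \<sigma>: "\<sigma> \<in> sweepouts (M 0)" and T: "T' \<in> I" and p: "p \<in> interior (K T')"
    and en: "\<And>s. s \<in> cball 0 1 \<Longrightarrow> energy (slice \<sigma> s) \<le> E" and E: "E < 4 * pi * T'"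
  obtains x where "homotopic_avoiding p \<sigma> (\<lambda>_. x)"
proof -
  have T0: "T' \<ge> 0" using T unfolding time_interval_def by simp
  have p0: "p \<in> interior (K 0)" using interior_mono[OF K_antimono[OF order_refl T0 T]] p by blast
  have E0: "E \<ge> 0" using en[of 0] energy_nonneg[of "slice \<sigma> 0"] by simp
  have co: "continuous_on cylinder \<sigma>" and im: "\<And>x. x \<in> cylinder \<Longrightarrow> \<sigma> x \<in> M 0"
    and W: "\<And>s. s \<in> cball 0 1 \<Longrightarrow> W12 (slice \<sigma> s)"
    using \<sigma> unfolding sweepouts_def by auto
  obtain m where m: "m > 1" "m\<^sup>2 * E < 4 * pi * T'"
  proof -
    have "((\<lambda>m. m\<^sup>2 * E) \<longlongrightarrow> 1\<^sup>2 * E) (at_right 1)" by (intro tendsto_intros)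
    hence "\<forall>\<^sub>F m in at_right 1. m\<^sup>2 * E < 4 * pi * T'" using E by (intro order_tendstoD(2)) auto
    moreover have "\<forall>\<^sub>F m in at_right (1::real). m > 1" by (simp add: eventually_at_right_less)
    ultimately have "\<forall>\<^sub>F m in at_right (1::real). m > 1 \<and> m\<^sup>2 * E < 4 * pi * T'" by eventually_elim simp
    thus ?thesis using that eventually_happens' trivial_limit_at_right_real by blast
  qed
  have cyl: "(cis \<theta>, s) \<in> cylinder" if "s \<in> cball (0::'p) 1" for \<theta> s using that by simp
  define h where "h u s \<theta> = p + (1 + u * (m - 1)) *\<^sub>R (slice \<sigma> s \<theta> - p)" for u s \<theta>
  define \<gamma> where "\<gamma> = h 1"
  have cont_slice: "continuous_on (cball 0 1 \<times> UNIV) (\<lambda>(s, \<theta>). slice \<sigma> s \<theta>)"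
  proof -
    have "continuous_on (cball 0 1 \<times> UNIV) (\<lambda>x :: 'p \<times> real. \<sigma> (cis (snd x), fst x))"
      by (rule continuous_on_compose2[OF co]) (auto intro!: continuous_intros continuous_on_cis)
    thus ?thesis by (simp add: slice_def case_prod_unfold)
  qed
  have cont: "continuous_on ({0..1} \<times> cball 0 1 \<times> UNIV) (\<lambda>(u, s, \<theta>). h u s \<theta>)"
  proof -
    have "continuous_on ({0..1} \<times> cball 0 1 \<times> UNIV) (\<lambda>x :: real \<times> 'p \<times> real. (\<lambda>(s, \<theta>). slice \<sigma> s \<theta>) (snd x))"
      by (rule continuous_on_compose2[OF cont_slice]) (auto intro!: continuous_intros)
    hence "continuous_on ({0..1} \<times> cball 0 1 \<times> UNIV)
       (\<lambda>x :: real \<times> 'p \<times> real. p + (1 + fst x * (m - 1)) *\<^sub>R ((\<lambda>(s, \<theta>). slice \<sigma> s \<theta>) (snd x) - p))"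
      by (intro continuous_intros)
    thus ?thesis by (simp add: h_def case_prod_unfold)
  qed
  have per: "periodic (h u s)" if s: "s \<in> cball 0 1" for u s
    using slice_continuous_periodic(2)[OF co s] unfolding periodic_def h_def by simp
  have const: "h u s \<theta> = h u s 0" if s: "s \<in> sphere 0 1" for u s \<theta>
  proof -
    obtain c where "\<forall>z\<in>sphere 0 1. \<sigma> (z, s) = c" using sweepout_collapsed[OF \<sigma>] s unfolding collapsed_def by blast
    hence "slice \<sigma> s \<theta> = slice \<sigma> s 0" by (simp add: slice_def)
    thus ?thesis by (simp only: h_def)
  qed
  have M0: "slice \<sigma> s \<theta> \<in> M 0" if "s \<in> cball 0 1" for s \<theta>
    unfolding slice_def by (rule im[OF cyl[OF that]])
  have pM: "p \<notin> M 0"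
    using p0 K_facts(3)[OF I_0] unfolding frontier_def by blast
  have hom1: "homotopic_avoiding p (on_circle (h 0)) (on_circle (h 1))"
  proof (rule loop_family_homotopy[OF cont per const])
    fix u s \<theta> assume u: "u \<in> {0..1::real}" and s: "s \<in> cball (0::'p) 1"
    have "0 \<le> u * (m - 1)" using u m(1) by simp
    hence "1 + u * (m - 1) \<noteq> 0" by linarith
    moreover have "slice \<sigma> s \<theta> \<noteq> p" using M0[OF s, of \<theta>] pM by auto
    ultimately show "h u s \<theta> \<in> - {p}" by (simp add: h_def)
  qed
  have lf: "loop_family \<gamma>"
    unfolding loop_family_def
  proof (intro conjI ballI allI)
    have "continuous_on (cball 0 1 \<times> UNIV) (\<lambda>x. (\<lambda>(u, s, \<theta>). h u s \<theta>) (1, fst x, snd x))"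
      by (rule continuous_on_compose2[OF cont]) (auto intro!: continuous_intros)
    thus "continuous_on (cball 0 1 \<times> UNIV) (\<lambda>(s, \<theta>). \<gamma> s \<theta>)" by (simp add: \<gamma>_def case_prod_unfold)
  qed (unfold \<gamma>_def, (rule per const, assumption)+)
  have \<gamma>s: "\<gamma> s = (\<lambda>\<theta>. (p - m *\<^sub>R p) + m *\<^sub>R slice \<sigma> s \<theta>)" for s
    by (auto simp: \<gamma>_def h_def algebra_simps)
  have dir: "trig_energy N (smooth_cos N (\<gamma> s)) (smooth_sin N (\<gamma> s)) \<le> m\<^sup>2 * E" if s: "s \<in> cball 0 1" for s N
  proof -
    have "trig_energy N (smooth_cos N (\<gamma> s)) (smooth_sin N (\<gamma> s)) =
        m\<^sup>2 * trig_energy N (smooth_cos N (slice \<sigma> s)) (smooth_sin N (slice \<sigma> s))"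
      unfolding \<gamma>s by (rule trig_energy_dilation[OF slice_continuous_periodic(1)[OF co s]])
    also have "\<dots> \<le> m\<^sup>2 * energy (slice \<sigma> s)"
      by (intro mult_left_mono trig_energy_smoothing_le_energy W s slice_continuous_periodic(1)[OF co s]) simp
    also have "\<dots> \<le> m\<^sup>2 * E" by (intro mult_left_mono en s) simp
    finally show ?thesis .
  qed
  have out: "\<gamma> s \<theta> \<notin> K 0" if s: "s \<in> cball 0 1" for s \<theta>
    using dilation_outside[OF p0 M0[OF s, of \<theta>] m(1)] by (simp add: \<gamma>_def h_def)
  obtain x where x: "homotopic_avoiding p (on_circle \<gamma>) (\<lambda>_. x)"
    using bounded_energy_family_contractible[OF lf out dir T m(2) p] .
  have eq: "\<sigma> y = on_circle (h 0) y" if y: "y \<in> cylinder" for y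
  proof -
    obtain z s where zs: "y = (z, s)" "norm z = 1" using y by auto
    have "z \<noteq> 0" using zs by auto
    hence "cis (Arg z) = z" using zs(2) by (simp add: cis_Arg sgn_eq)
    thus ?thesis by (simp add: zs h_def on_circle_def slice_def)
  qed
  have "homotopic_avoiding p \<sigma> (on_circle (h 0))"
  proof (rule homotopic_with_equal)
    show "collapsed \<sigma>" by (rule sweepout_collapsed[OF \<sigma>])
    show "collapsed (on_circle (h 0))"
      unfolding collapsed_def
    proof
      fix s :: 'p assume s: "s \<in> sphere 0 1"
      have "on_circle (h 0) (z, s) = h 0 s 0" for z
        unfolding on_circle_def prod.case by (rule const[OF s])
      thus "\<exists>c. \<forall>z\<in>sphere 0 1. on_circle (h 0) (z, s) = c" by blast
    qed
    show "continuous_map (top_of_set cylinder) (top_of_set (- {p})) \<sigma>"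
      using co im pM by auto
  qed (use eq in simp)
  from homotopic_with_trans[OF this homotopic_with_trans[OF hom1 x[unfolded \<gamma>_def]]]
  show ?thesis by (rule that)
qed

text \<open>Otherwise some sweepout in the class has energies below \<open>4 \<pi> T'\<close> and is homotopic to a constant in
  the complement of an interior point \<open>p\<close> of \<open>K T'\<close>.  The radial retraction of this complement to
  \<open>M 0\<close> turns this into a null homotopy in \<open>M 0\<close>.\<close>

lemma extinction_time_le_width:
  fixes \<sigma>\<^sub>0 :: "complex \<times> 'p::euclidean_space \<Rightarrow> 'a"
  assumes \<sigma>\<^sub>0: "\<sigma>\<^sub>0 \<in> sweepouts (M 0)" and nontrivial: "\<not> trivial_induced_class (M 0) \<sigma>\<^sub>0" and T: "T' \<in> I"
  shows "4 * pi * T' \<le> flow_width M F \<sigma>\<^sub>0 0"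
proof (rule ccontr)
  define \<sigma>\<^sub>1 where "\<sigma>\<^sub>1 = F 0 \<circ> \<sigma>\<^sub>0"
  have eq: "\<sigma>\<^sub>1 x = \<sigma>\<^sub>0 x" if "x \<in> cylinder" for x
    using \<sigma>\<^sub>0 that F_0 unfolding sweepouts_def \<sigma>\<^sub>1_def by auto
  have \<sigma>\<^sub>1: "\<sigma>\<^sub>1 \<in> sweepouts (M 0)" by (rule sweepouts_cong[OF \<sigma>\<^sub>0 eq])
  assume "\<not> ?thesis"
  hence less: "(INF \<sigma>\<in>sweepout_class (M 0) \<sigma>\<^sub>1. SUP s\<in>cball 0 1. energy (slice \<sigma> s)) < 4 * pi * T'"
    unfolding flow_width_def width_def \<sigma>\<^sub>1_def by simp
  have "homotopic_with_canon (\<lambda>\<rho>. \<rho> \<in> sweepouts (M 0)) cylinder (M 0) \<sigma>\<^sub>1 \<sigma>\<^sub>1"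
    using \<sigma>\<^sub>1 by (auto simp: sweepouts_def image_subset_iff_funcset)
  hence "\<sigma>\<^sub>1 \<in> sweepout_class (M 0) \<sigma>\<^sub>1" using \<sigma>\<^sub>1 unfolding sweepout_class_def by blast
  hence "(\<lambda>\<sigma>. SUP s\<in>cball 0 1. energy (slice \<sigma> s)) ` sweepout_class (M 0) \<sigma>\<^sub>1 \<noteq> {}" by blast
  from cInf_lessD[OF this less] obtain \<sigma> where \<sigma>: "\<sigma> \<in> sweepout_class (M 0) \<sigma>\<^sub>1"
    "(SUP s\<in>cball 0 1. energy (slice \<sigma> s)) < 4 * pi * T'" by blast
  have \<sigma>s: "\<sigma> \<in> sweepouts (M 0)"
    and hom: "homotopic_with_canon (\<lambda>\<rho>. \<rho> \<in> sweepouts (M 0)) cylinder (M 0) \<sigma>\<^sub>1 \<sigma>"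
    using \<sigma>(1) unfolding sweepout_class_def by auto
  have en: "energy (slice \<sigma> s) \<le> (SUP s\<in>cball 0 1. energy (slice \<sigma> s))" if "s \<in> cball 0 1" for s
    by (rule cSUP_upper[OF that sweepout_energies_bounded[OF \<sigma>s]])
  obtain p where p: "p \<in> interior (K T')" using K_facts(2)[OF T] by blast
  have T0: "T' \<ge> 0" using T unfolding time_interval_def by simp
  have p0: "p \<in> interior (K 0)" using interior_mono[OF K_antimono[OF order_refl T0 T]] p by blast
  have pM: "M 0 \<subseteq> - {p}" using p0 K_facts(3)[OF I_0] unfolding frontier_def by blast
  obtain x where x: "homotopic_avoiding p \<sigma> (\<lambda>_. x)"
    using low_energy_sweepout_contractible[OF \<sigma>s T p en \<sigma>(2)] .
  have "homotopic_with_canon collapsed cylinder (M 0) \<sigma>\<^sub>1 \<sigma>"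
    by (rule homotopic_with_mono[OF hom sweepout_collapsed])
  hence "homotopic_avoiding p \<sigma>\<^sub>1 \<sigma>"
    using pM by (rule homotopic_with_subset_right)
  hence null: "homotopic_avoiding p \<sigma>\<^sub>1 (\<lambda>_. x)" using x by (rule homotopic_with_trans)
  have "M 0 retract_of - {p}"
  proof -
    have "rel_frontier (K 0) retract_of affine hull K 0 - {p}"
    proof (rule rel_frontier_retract_of_punctured_affine_hull)
      show "bounded (K 0)" using K_facts(1)[OF I_0] compact_imp_bounded by blast
      show "p \<in> rel_interior (K 0)" using p0 interior_subset_rel_interior by blast
    qed (rule convex_convex_hull)
    moreover have "affine hull K 0 = UNIV" using affine_hull_nonempty_interior K_facts(2)[OF I_0] by blast
    moreover have "rel_frontier (K 0) = M 0" using rel_frontier_nonempty_interior K_facts(2,3)[OF I_0] by metis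
    ultimately show ?thesis by (simp add: Compl_eq_Diff_UNIV)
  qed
  then obtain r where r: "continuous_on (- {p}) r" "r ` (- {p}) \<subseteq> M 0" "\<And>y. y \<in> M 0 \<Longrightarrow> r y = y"
    unfolding retract_of_def retraction_def by auto
  have "homotopic_with_canon collapsed cylinder (M 0) (r \<circ> \<sigma>\<^sub>1) (r \<circ> (\<lambda>_. x))"
  proof (rule homotopic_with_compose_continuous_map_left[OF null])
    show "continuous_map (top_of_set (- {p})) (top_of_set (M 0)) r" using r(1,2) by auto
    show "collapsed (r \<circ> j)" if "collapsed j" for j :: "complex \<times> 'p \<Rightarrow> 'a"
      using that unfolding collapsed_def by (metis comp_apply)
  qed
  from homotopic_induced_map[OF this]
  have ind: "homotopic_with_canon (\<lambda>_. True) (sphere 0 1) (M 0) (induced_map (r \<circ> \<sigma>\<^sub>1)) (\<lambda>_. r x)"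
    by (simp add: induced_map_def o_def case_prod_unfold)
  have "induced_map (r \<circ> \<sigma>\<^sub>1) y = induced_map \<sigma>\<^sub>0 y" if "y \<in> sphere 0 1" for y
  proof (rule induced_map_cong[OF _ that])
    fix w assume w: "w \<in> (cylinder :: (complex \<times> 'p) set)"
    hence "\<sigma>\<^sub>0 w \<in> M 0" using \<sigma>\<^sub>0 unfolding sweepouts_def by blast
    thus "(r \<circ> \<sigma>\<^sub>1) w = \<sigma>\<^sub>0 w" using eq[OF w] r(3) by simp
  qed
  hence "homotopic_with_canon (\<lambda>_. True) (sphere 0 1) (M 0) (induced_map \<sigma>\<^sub>0) (\<lambda>_. r x)"
    by (intro homotopic_with_eq[OF ind]) auto
  thus False using trivial_induced_class_of_nullhomotopic nontrivial by blast
qed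

end

theorem corollary3p5:
  fixes n :: nat
    and M :: "real \<Rightarrow> 'a::euclidean_space set"
    and F :: "real \<Rightarrow> 'a \<Rightarrow> 'a"
    and T :: ereal
    and \<sigma>\<^sub>0 :: "complex \<times> 'p::euclidean_space \<Rightarrow> 'a"
  assumes "n \<ge> 2"
    and "DIM('a) = n + 1"
    and "DIM('p) = n - 1"
    and flow: "strictly_convex_mcf M F T"
    and until_extinction: "\<And>\<tau>. T = ereal \<tau> \<Longrightarrow> extinct_at M \<tau>"
    and sweepout: "\<sigma>\<^sub>0 \<in> sweepouts (M 0)"
    and nontrivial: "\<not> trivial_induced_class (M 0) \<sigma>\<^sub>0"
  shows "\<exists>\<tau>. T = ereal \<tau> \<and> extinct_at M \<tau> \<and> \<tau> \<le> flow_width M F \<sigma>\<^sub>0 0 / (4 * pi)"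
proof -
  interpret convex_flow M F T
    by unfold_locales (use flow assms(1,2) in auto)
  define w where "w = flow_width M F \<sigma>\<^sub>0 0 / (4 * pi)"
  have bound: "t \<le> w" if "t \<in> I" for t
    using extinction_time_le_width[OF sweepout nontrivial that] by (simp add: w_def field_simps)
  have pos: "0 < T" using flow unfolding strictly_convex_mcf_def by blast
  have "w \<ge> 0" using bound[OF I_0] .
  have "T \<le> ereal w"
  proof (rule ccontr)
    assume "\<not> T \<le> ereal w"
    hence "ereal w < T" by simp
    then obtain t where t: "ereal w < ereal t" "ereal t < T" using ereal_dense2 by blast
    hence "t \<in> I" using \<open>w \<ge> 0\<close> unfolding time_interval_def by simp
    thus False using bound t(1) by fastforce
  qed
  then obtain \<tau> where \<tau>: "T = ereal \<tau>" using pos by (cases T) auto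
  have "\<tau> \<le> w" using \<open>T \<le> ereal w\<close> \<tau> by simp
  thus ?thesis using \<tau> until_extinction[OF \<tau>] unfolding w_def by blast
qed

end
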